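(* Let $(\mathcal{X},\rho,\mu)$ be a space of homogeneous type satisfying the weak reverse doubling (WRD) condition. Let $\varphi\in\mathcal{G}^{\rm dec}_1$ satisfy the nearness condition and let $\Psi$ be an Orlicz function with lower type $r_\Psi^-$ and upper type $r_\Psi^+$, where $1<r_\Psi^-\le r_\Psi^+<\infty$. Assume that there exists a positive constant $C$ such that, for any $x\in\mathcal{X}$ and $r\in(0,\infty)$, $\int_r^\infty\frac{\varphi(x,t)}{t}\,dt\le C\varphi(x,r)$. Then the Hardy--Littlewood maximal operator $\mathcal{M}$ is bounded on the generalized Orlicz-block space $B_{(\varphi,\Psi)}(\mathcal{X})$.
   Context: A quasi-metric on a nonempty set $\mathcal{X}$ is $\rho:\mathcal{X}\times\mathcal{X}\to[0,\infty)$ with $\rho(x,y)=0$ iff $x=y$, $\rho(x,y)=\rho(y,x)$, and $\rho(x,z)\le K_0[\rho(x,y)+\rho(y,z)]$ for some constant $K_0\in[1,\infty)$. Balls: $B(x,r):=\{y:\rho(x,y)<r\}$. $(\mathcal{X},\rho,\mu)$ is a space of homogeneous type if $\rho$ is a quasi-metric, $\mu$ is a nonnegative measure on a $\sigma$-algebra containing all balls, and there is $L_{(\mu)}\in[1,\infty)$ with $0<\mu(B(x,2r))\le L_{(\mu)}\mu(B(x,r))<\infty$ for all $x,r$. WRD condition: there exist $x_0\in\mathcal{X}$ and $\lambda,C_{(\mu)}\in(1,\infty)$ with $\liminf_{r\to\infty}\frac{\mu(B(x_0,\lambda r))}{\mu(B(x_0,r))}\ge C_{(\mu)}$. $\mathcal{M}f(x):=\sup_{B\ni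 x}\frac1{\mu(B)}\int_B|f|\,d\mu$, supremum over all balls containing $x$. For $\varphi:\mathcal{X}\times(0,\infty)\to(0,\infty)$ and $B=B(x,r)$, write $\varphi(B):=\varphi(x,r)$. Nearness condition: there is $C>0$ with $\frac1C\le\frac{\varphi(x,r)}{\varphi(y,r)}\le C$ whenever $\rho(x,y)\le r$. $\mathcal{G}^{\rm dec}_1$: functions $\varphi:\mathcal{X}\times(0,\infty)\to(0,\infty)$ for which there is $C>0$ with $\mu(B(x,r))\varphi(x,r)\le C\mu(B(x,s))\varphi(x,s)$ and $\varphi(x,s)\le C\varphi(x,r)$ for all $x\in\mathcal{X}$, $0<r<s<\infty$. An Orlicz function is a non-decreasing $\Phi:[0,\infty)\to[0,\infty)$ with $\Phi(0)=0$, $\Phi(t)>0$ for $t>0$, $\lim_{t\to\infty}\Phi(t)=\infty$. It is of lower (resp. upper) type $r$ if there is $C_{(r)}\in[1,\infty)$ with $\Phi(st)\le C_{(r)}s^r\Phi(t)$ for all $t\in(0,\infty)$ and $s\in(0,1)$ (resp. $s\in(1,\infty)$). Standing assumption: $\Psi$ is strictly increasing and convex. Its complementary function is $\widetilde\Psi(t):=\sup\{tu-\Psi(u):u\in[0,\infty)\}$. $\|f\|_{L^\Phi(\mathcal{X})}:=\inf\{\lambda>0:\int_{\mathcal{X}}\Phi(|f|/\lambda)\,d\mu\le1\}$; $L^\Phi_{\mathrm{loc}}(\mathcal{X})$: measurable $f$ such that each $x$ has some $r_x>0$ with $\|f\mathbf{1}_{B(x,r_x)}\|_{L^\Phi(\mathcal{X})}<\infty$.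 For an Orlicz function $\Phi$, $\|f\|_{\Phi,\varphi,B}:=\inf\{\lambda\in(0,\infty):\frac1{\mu(B)}\int_B\Phi(\frac{|f|}{\lambda})\,d\mu\le\varphi(B)\}$, and $L^{(\Phi,\varphi)}(\mathcal{X})$ is the set of $f\in L^\Phi_{\mathrm{loc}}(\mathcal{X})$ with $\|f\|_{L^{(\Phi,\varphi)}(\mathcal{X})}:=\sup_B\|f\|_{\Phi,\varphi,B}<\infty$ (supremum over all balls). A $(\varphi,\Psi)$-block is a function $b\in L^\Psi(\mathcal{X})$ for which there is a ball $B$ with $\mathrm{supp}\,b\subset B$ and $\|b\|_{\Psi,\varphi,B}\le\frac1{\mu(B)\varphi(B)}$; each block acts as the bounded functional $g\mapsto\int_{\mathcal{X}}bg\,d\mu$ on $L^{(\widetilde\Psi,\varphi)}(\mathcal{X})$. $B_{(\varphi,\Psi)}(\mathcal{X})$ is the set of all $f$ in the dual space $[L^{(\widetilde\Psi,\varphi)}(\mathcal{X})]^*$ that can be written as $f=\sum_{j\in\mathbb{N}}\lambda_jb_j$ in $[L^{(\widetilde\Psi,\varphi)}(\mathcal{X})]^*$ with $(\varphi,\Psi)$-blocks $b_j$ and $\lambda_j\in[0,\infty)$, $\sum_j\lambda_j<\infty$; $\|f\|_{B_{(\varphi,\Psi)}(\mathcal{X})}$ is the infimum of $\sum_j\lambda_j$ over all such decompositions. Under the hypotheses, such series converge $\mu$-a.e. to a locally integrable function and $f$ is identified with this function. Bounded means there is a constant $C$ with $\|\mathcal{M}f\|\le C\|f\|$ for all $f$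 in the space.
   Formalization: The bound is proved for those f whose maximal function Mf is a.e. equal to a measurable function; since quasi-metric balls need not be open, Mf can be non-measurable, and the claim then fails. The condition is automatic when balls are open. *)

theory Defs
  imports "HOL-Analysis.Analysis"
begin

text \<open>
  The underlying set of the space of homogeneous type is the carrier \<^term>\<open>space M\<close> of the
  measure.  A ball is always given together with its centre and radius, because \<^term>\<open>\<phi>\<close> is
  evaluated at the pair and not at the underlying set.  Norms that may be infinite take values
  in \<^typ>\<open>ennreal\<close>, where \<^term>\<open>Inf {}\<close> is infinity.

  Functions take values in a type of class \<open>real_normed_field\<close> that is complete and second
  countable: this covers both the real and the complex numbers as scalar field.
\<close>

subsection \<open>Spaces of homogeneous type\<close>

definition quasi_metric_on :: "'a set \<Rightarrow> ('a \<Rightarrow> 'a \<Rightarrow> real) \<Rightarrow> bool" where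
  "quasi_metric_on X \<rho> \<longleftrightarrow>
     X \<noteq> {} \<and>
     (\<forall>x\<in>X. \<forall>y\<in>X. 0 \<le> \<rho> x y) \<and>
     (\<forall>x\<in>X. \<forall>y\<in>X. \<rho> x y = 0 \<longleftrightarrow> x = y) \<and>
     (\<forall>x\<in>X. \<forall>y\<in>X. \<rho> x y = \<rho> y x) \<and>
     (\<exists>K\<ge>1. \<forall>x\<in>X. \<forall>y\<in>X. \<forall>z\<in>X. \<rho> x z \<le> K * (\<rho> x y + \<rho> y z))"

definition qball :: "'a measure \<Rightarrow> ('a \<Rightarrow> 'a \<Rightarrow> real) \<Rightarrow> 'a \<Rightarrow> real \<Rightarrow> 'a set" where
  "qball M \<rho> x r = {y \<in> space M. \<rho> x y < r}"

definition homogeneous_space :: "'a measure \<Rightarrow> ('a \<Rightarrow> 'a \<Rightarrow> real) \<Rightarrow> bool" where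
  "homogeneous_space M \<rho> \<longleftrightarrow>
     quasi_metric_on (space M) \<rho> \<and>
     (\<forall>x\<in>space M. \<forall>r>0. qball M \<rho> x r \<in> sets M) \<and>
     (\<exists>L::real. L \<ge> 1 \<and>
        (\<forall>x\<in>space M. \<forall>r>0.
           0 < emeasure M (qball M \<rho> x (2 * r)) \<and>
           emeasure M (qball M \<rho> x (2 * r)) \<le> ennreal L * emeasure M (qball M \<rho> x r) \<and>
           ennreal L * emeasure M (qball M \<rho> x r) < \<infinity>))"

definition weak_reverse_doubling :: "'a measure \<Rightarrow> ('a \<Rightarrow> 'a \<Rightarrow> real) \<Rightarrow> bool" where
  "weak_reverse_doubling M \<rho> \<longleftrightarrow>
     (\<exists>x\<^sub>0\<in>space M. \<exists>l>1. \<exists>C>1.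
        Liminf at_top
          (\<lambda>r. ereal (measure M (qball M \<rho> x\<^sub>0 (l * r)) / measure M (qball M \<rho> x\<^sub>0 r))) \<ge> ereal C)"

definition hl_maximal ::
  "'a measure \<Rightarrow> ('a \<Rightarrow> 'a \<Rightarrow> real) \<Rightarrow> ('a \<Rightarrow> 'b::real_normed_vector) \<Rightarrow> 'a \<Rightarrow> ennreal" where
  "hl_maximal M \<rho> f x =
     (SUP (y, r) \<in> {(y, r). y \<in> space M \<and> r > 0 \<and> x \<in> qball M \<rho> y r}.
        (\<integral>\<^sup>+z\<in>qball M \<rho> y r. ennreal (norm (f z)) \<partial>M) / emeasure M (qball M \<rho> y r))"

subsection \<open>The weight function\<close>

definition nearness ::
  "'a measure \<Rightarrow> ('a \<Rightarrow> 'a \<Rightarrow> real) \<Rightarrow> ('a \<Rightarrow> real \<Rightarrow> real) \<Rightarrow> bool" where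
  "nearness M \<rho> \<phi> \<longleftrightarrow>
     (\<exists>C>0. \<forall>x\<in>space M. \<forall>y\<in>space M. \<forall>r>0. \<rho> x y \<le> r \<longrightarrow>
        1 / C \<le> \<phi> x r / \<phi> y r \<and> \<phi> x r / \<phi> y r \<le> C)"

definition G1_dec ::
  "'a measure \<Rightarrow> ('a \<Rightarrow> 'a \<Rightarrow> real) \<Rightarrow> ('a \<Rightarrow> real \<Rightarrow> real) set" where
  "G1_dec M \<rho> =
     {\<phi>. (\<forall>x\<in>space M. \<forall>r>0. \<phi> x r > 0) \<and>
         (\<exists>C>0. \<forall>x\<in>space M. \<forall>r s. 0 < r \<and> r < s \<longrightarrow>
            measure M (qball M \<rho> x r) * \<phi> x r \<le> C * (measure M (qball M \<rho> x s) * \<phi> x s) \<and>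
            \<phi> x s \<le> C * \<phi> x r)}"

subsection \<open>Orlicz functions\<close>

text \<open>Functions on the half-line are total functions on \<^typ>\<open>real\<close>; values at negative
  arguments are irrelevant throughout.\<close>

definition orlicz_function :: "(real \<Rightarrow> real) \<Rightarrow> bool" where
  "orlicz_function \<Phi> \<longleftrightarrow>
     mono_on {0..} \<Phi> \<and> \<Phi> 0 = 0 \<and> (\<forall>t>0. \<Phi> t > 0) \<and> filterlim \<Phi> at_top at_top"

definition lower_type :: "(real \<Rightarrow> real) \<Rightarrow> real \<Rightarrow> bool" where
  "lower_type \<Phi> p \<longleftrightarrow> (\<exists>C\<ge>1. \<forall>t>0. \<forall>s. 0 < s \<and> s < 1 \<longrightarrow> \<Phi> (s * t) \<le> C * s powr p * \<Phi> t)"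

definition upper_type :: "(real \<Rightarrow> real) \<Rightarrow> real \<Rightarrow> bool" where
  "upper_type \<Phi> p \<longleftrightarrow> (\<exists>C\<ge>1. \<forall>t>0. \<forall>s>1. \<Phi> (s * t) \<le> C * s powr p * \<Phi> t)"

text \<open>The supremum below is finite whenever \<^term>\<open>\<Psi>\<close> is an Orlicz function of lower type
  greater than one.\<close>

definition complementary :: "(real \<Rightarrow> real) \<Rightarrow> real \<Rightarrow> real" where
  "complementary \<Psi> t = (SUP u\<in>{0..}. t * u - \<Psi> u)"

subsection \<open>Orlicz and generalized Orlicz--Morrey spaces\<close>

definition orlicz_norm ::
  "'a measure \<Rightarrow> (real \<Rightarrow> real) \<Rightarrow> ('a \<Rightarrow> 'b::real_normed_vector) \<Rightarrow> ennreal" where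
  "orlicz_norm M \<Phi> f =
     Inf {ennreal l | l. l > 0 \<and> (\<integral>\<^sup>+x. ennreal (\<Phi> (norm (f x) / l)) \<partial>M) \<le> 1}"

definition orlicz_space ::
  "'a measure \<Rightarrow> (real \<Rightarrow> real) \<Rightarrow> ('a \<Rightarrow> 'b::real_normed_vector) set" where
  "orlicz_space M \<Phi> = {f \<in> borel_measurable M. orlicz_norm M \<Phi> f < \<infinity>}"

definition orlicz_space_loc ::
  "'a measure \<Rightarrow> ('a \<Rightarrow> 'a \<Rightarrow> real) \<Rightarrow> (real \<Rightarrow> real) \<Rightarrow> ('a \<Rightarrow> 'b::real_normed_vector) set" where
  "orlicz_space_loc M \<rho> \<Phi> =
     {f \<in> borel_measurable M.
        \<forall>x\<in>space M. \<exists>r>0. orlicz_norm M \<Phi> (\<lambda>y. indicator (qball M \<rho> x r) y *\<^sub>R f y) < \<infinity>}"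

definition ball_norm ::
  "'a measure \<Rightarrow> ('a \<Rightarrow> 'a \<Rightarrow> real) \<Rightarrow> ('a \<Rightarrow> real \<Rightarrow> real) \<Rightarrow> (real \<Rightarrow> real) \<Rightarrow>
   'a \<Rightarrow> real \<Rightarrow> ('a \<Rightarrow> 'b::real_normed_vector) \<Rightarrow> ennreal" where
  "ball_norm M \<rho> \<phi> \<Phi> x r f =
     Inf {ennreal l | l. l > 0 \<and>
       (\<integral>\<^sup>+y\<in>qball M \<rho> x r. ennreal (\<Phi> (norm (f y) / l)) \<partial>M) / emeasure M (qball M \<rho> x r)
         \<le> ennreal (\<phi> x r)}"

definition morrey_norm ::
  "'a measure \<Rightarrow> ('a \<Rightarrow> 'a \<Rightarrow> real) \<Rightarrow> ('a \<Rightarrow> real \<Rightarrow> real) \<Rightarrow> (real \<Rightarrow> real) \<Rightarrow>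
   ('a \<Rightarrow> 'b::real_normed_vector) \<Rightarrow> ennreal" where
  "morrey_norm M \<rho> \<phi> \<Phi> f = (SUP (x, r) \<in> space M \<times> {0<..}. ball_norm M \<rho> \<phi> \<Phi> x r f)"

definition morrey_space ::
  "'a measure \<Rightarrow> ('a \<Rightarrow> 'a \<Rightarrow> real) \<Rightarrow> ('a \<Rightarrow> real \<Rightarrow> real) \<Rightarrow> (real \<Rightarrow> real) \<Rightarrow>
   ('a \<Rightarrow> 'b::real_normed_vector) set" where
  "morrey_space M \<rho> \<phi> \<Phi> = {f \<in> orlicz_space_loc M \<rho> \<Phi>. morrey_norm M \<rho> \<phi> \<Phi> f < \<infinity>}"

subsection \<open>The dual space\<close>

text \<open>Functionals are total functions of which only the values on the Orlicz--Morrey space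
  matter; a bounded functional does not distinguish functions that agree almost everywhere.\<close>

definition morrey_dual ::
  "'a measure \<Rightarrow> ('a \<Rightarrow> 'a \<Rightarrow> real) \<Rightarrow> ('a \<Rightarrow> real \<Rightarrow> real) \<Rightarrow> (real \<Rightarrow> real) \<Rightarrow>
   (('a \<Rightarrow> 'b::real_normed_field) \<Rightarrow> 'b) set" where
  "morrey_dual M \<rho> \<phi> \<Phi> =
     {F. (\<forall>g\<in>morrey_space M \<rho> \<phi> \<Phi>. \<forall>h\<in>morrey_space M \<rho> \<phi> \<Phi>. F (\<lambda>x. g x + h x) = F g + F h) \<and>
         (\<forall>c. \<forall>g\<in>morrey_space M \<rho> \<phi> \<Phi>. F (\<lambda>x. c * g x) = c * F g) \<and>
         (\<exists>K\<ge>0. \<forall>g\<in>morrey_space M \<rho> \<phi> \<Phi>.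
            ennreal (norm (F g)) \<le> ennreal K * morrey_norm M \<rho> \<phi> \<Phi> g)}"

definition morrey_dual_norm ::
  "'a measure \<Rightarrow> ('a \<Rightarrow> 'a \<Rightarrow> real) \<Rightarrow> ('a \<Rightarrow> real \<Rightarrow> real) \<Rightarrow> (real \<Rightarrow> real) \<Rightarrow>
   (('a \<Rightarrow> 'b::real_normed_field) \<Rightarrow> 'b) \<Rightarrow> ennreal" where
  "morrey_dual_norm M \<rho> \<phi> \<Phi> F =
     (SUP g \<in> {g \<in> morrey_space M \<rho> \<phi> \<Phi>. morrey_norm M \<rho> \<phi> \<Phi> g \<le> 1}. ennreal (norm (F g)))"

subsection \<open>The generalized Orlicz-block space\<close>

definition orlicz_block ::
  "'a measure \<Rightarrow> ('a \<Rightarrow> 'a \<Rightarrow> real) \<Rightarrow> ('a \<Rightarrow> real \<Rightarrow> real) \<Rightarrow> (real \<Rightarrow> real) \<Rightarrow>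
   ('a \<Rightarrow> 'b::real_normed_vector) \<Rightarrow> bool" where
  "orlicz_block M \<rho> \<phi> \<Psi> b \<longleftrightarrow>
     b \<in> orlicz_space M \<Psi> \<and>
     (\<exists>x\<in>space M. \<exists>r>0.
        {y \<in> space M. b y \<noteq> 0} \<subseteq> qball M \<rho> x r \<and>
        ball_norm M \<rho> \<phi> \<Psi> x r b \<le> ennreal (1 / (measure M (qball M \<rho> x r) * \<phi> x r)))"

definition block_functional ::
  "'a measure \<Rightarrow> ('a \<Rightarrow> 'b::{real_normed_field, banach, second_countable_topology}) \<Rightarrow>
   ('a \<Rightarrow> 'b) \<Rightarrow> 'b" where
  "block_functional M b g = (\<integral>x. b x * g x \<partial>M)"

text \<open>\<open>F = (\<Sum>j. l j * b j)\<close>, with convergence in the norm of the dual of the Orlicz--Morrey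
  space for the complementary function.\<close>

definition block_decomposition ::
  "'a measure \<Rightarrow> ('a \<Rightarrow> 'a \<Rightarrow> real) \<Rightarrow> ('a \<Rightarrow> real \<Rightarrow> real) \<Rightarrow> (real \<Rightarrow> real) \<Rightarrow>
   (('a \<Rightarrow> 'b::{real_normed_field, banach, second_countable_topology}) \<Rightarrow> 'b) \<Rightarrow>
   (nat \<Rightarrow> real) \<Rightarrow> (nat \<Rightarrow> 'a \<Rightarrow> 'b) \<Rightarrow> bool" where
  "block_decomposition M \<rho> \<phi> \<Psi> F l b \<longleftrightarrow>
     (\<forall>j. orlicz_block M \<rho> \<phi> \<Psi> (b j)) \<and> (\<forall>j. 0 \<le> l j) \<and> summable l \<and>
     (\<lambda>n. morrey_dual_norm M \<rho> \<phi> (complementary \<Psi>)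
            (\<lambda>g. F g - (\<Sum>j<n. l j *\<^sub>R block_functional M (b j) g))) \<longlonglongrightarrow> 0"

definition block_space ::
  "'a measure \<Rightarrow> ('a \<Rightarrow> 'a \<Rightarrow> real) \<Rightarrow> ('a \<Rightarrow> real \<Rightarrow> real) \<Rightarrow> (real \<Rightarrow> real) \<Rightarrow>
   (('a \<Rightarrow> 'b::{real_normed_field, banach, second_countable_topology}) \<Rightarrow> 'b) set" where
  "block_space M \<rho> \<phi> \<Psi> =
     {F \<in> morrey_dual M \<rho> \<phi> (complementary \<Psi>). \<exists>l b. block_decomposition M \<rho> \<phi> \<Psi> F l b}"

definition block_norm ::
  "'a measure \<Rightarrow> ('a \<Rightarrow> 'a \<Rightarrow> real) \<Rightarrow> ('a \<Rightarrow> real \<Rightarrow> real) \<Rightarrow> (real \<Rightarrow> real) \<Rightarrow>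
   (('a \<Rightarrow> 'b::{real_normed_field, banach, second_countable_topology}) \<Rightarrow> 'b) \<Rightarrow> ennreal" where
  "block_norm M \<rho> \<phi> \<Psi> F =
     Inf {ennreal (\<Sum>j. l j) | l. \<exists>b. block_decomposition M \<rho> \<phi> \<Psi> F l b}"

text \<open>The identification of a functional in the block space with a function: the function is
  the almost everywhere sum of a block decomposition of the functional.\<close>

definition identified_with ::
  "'a measure \<Rightarrow> ('a \<Rightarrow> 'a \<Rightarrow> real) \<Rightarrow> ('a \<Rightarrow> real \<Rightarrow> real) \<Rightarrow> (real \<Rightarrow> real) \<Rightarrow>
   (('a \<Rightarrow> 'b::{real_normed_field, banach, second_countable_topology}) \<Rightarrow> 'b) \<Rightarrow>
   ('a \<Rightarrow> 'b) \<Rightarrow> bool" where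
  "identified_with M \<rho> \<phi> \<Psi> F f \<longleftrightarrow>
     (\<exists>l b. block_decomposition M \<rho> \<phi> \<Psi> F l b \<and> (AE x in M. (\<lambda>j. l j *\<^sub>R b j x) sums f x))"

end

theory Submission
  imports Defs
begin

text \<open>
  Let \<open>b\<close> be a block carried by the ball \<open>B = B(x, r)\<close>, and let \<open>A = \<mu>(B) \<phi>(B)\<close>.  Up to a factor
  two the block condition says that \<open>\<integral> \<Psi>(A |b|) \<le> A\<close>.  The maximal function of \<open>b\<close> is split along
  the dilated balls \<open>B\<^sub>n = B(x, \<kappa>\<^sup>n r)\<close>.

  On \<open>B\<^sub>1\<close> the modular inequality \<open>\<integral> \<Psi>(M h) \<le> C \<integral> \<Psi>(4 h)\<close> plus a term for small values keeps the
  block condition up to a constant.  It comes from the weak type estimate at dyadic heights;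
  the resulting sum converges because the lower type of \<open>\<Psi>\<close> exceeds one.

  On \<open>B\<^sub>n - B\<^sub>n\<^sub>-\<^sub>1\<close> every ball that contributes to the maximal function is comparable to \<open>B\<^sub>n\<close>,
  so \<open>M b\<close> is at most a constant divided by \<open>\<mu>(B\<^sub>n)\<close>.  This constant is a multiple of a block on
  \<open>B\<^sub>n\<close>, with the factor \<open>(\<phi>(B\<^sub>n) / \<phi>(B))\<^bsup>1 - 1/p\<^esup>\<close>.  The integral condition on \<open>\<phi>\<close> allows the
  choice of \<open>\<kappa>\<close> with \<open>\<phi>(B\<^sub>n) \<le> 2\<^bsup>-n\<^esup> \<phi>(B)\<close>, and the factors form a geometric series.  Hence
  \<open>M b \<le> \<Sum> c\<^sub>n \<gamma>\<^sub>n\<close> with blocks \<open>\<gamma>\<^sub>n\<close> and coefficients \<open>c\<^sub>n\<close> that do not depend on \<open>b\<close>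
  (\<open>maximal_block_decomposition\<close>).

  Since \<open>M\<close> is sublinear, the maximal function of \<open>f = \<Sum> l\<^sub>j b\<^sub>j\<close> is dominated by a series of blocks
  with coefficients \<open>2 l\<^sub>j c\<^sub>n\<close>.  The block space is a lattice: a measurable function dominated by such
  a series is itself the sum of a block decomposition with the same coefficients
  (\<open>majorized_in_block_space\<close>), which bounds its norm.  The norm of the functional \<open>F\<close> is an infimum
  over all its decompositions, whereas the function is read off from only one of them.  Therefore the
  almost everywhere sum must be shown to depend on \<open>F\<close> alone (\<open>decomposition_sum_unique\<close>); this holds
  because small multiples of indicators of subsets of balls belong to the Orlicz--Morrey space.

  Balls of a quasi-metric need not be open, so the maximal function of a block need not be measurable.
  All integral estimates are therefore made for a comparable maximal function over a countable family
  of balls.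
\<close>

section \<open>Doubling quasi-metric spaces\<close>

locale doubling_space =
  fixes M :: "'a measure" and \<rho> :: "'a \<Rightarrow> 'a \<Rightarrow> real" and K L :: real
  assumes space_ne: "space M \<noteq> {}"
    and rho_nonneg: "\<And>x y. x \<in> space M \<Longrightarrow> y \<in> space M \<Longrightarrow> 0 \<le> \<rho> x y"
    and rho_refl: "\<And>x. x \<in> space M \<Longrightarrow> \<rho> x x = 0"
    and rho_sym: "\<And>x y. x \<in> space M \<Longrightarrow> y \<in> space M \<Longrightarrow> \<rho> x y = \<rho> y x"
    and K_ge1: "1 \<le> K"
    and rho_triangle: "\<And>x y z. x \<in> space M \<Longrightarrow> y \<in> space M \<Longrightarrow> z \<in> space M \<Longrightarrow>
           \<rho> x z \<le> K * (\<rho> x y + \<rho> y z)"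
    and ball_sets: "\<And>x r. x \<in> space M \<Longrightarrow> 0 < r \<Longrightarrow> qball M \<rho> x r \<in> sets M"
    and L_ge1: "1 \<le> L"
    and ball_emeasure_pos: "\<And>x r. x \<in> space M \<Longrightarrow> 0 < r \<Longrightarrow> 0 < emeasure M (qball M \<rho> x r)"
    and ball_emeasure_fin: "\<And>x r. x \<in> space M \<Longrightarrow> 0 < r \<Longrightarrow> emeasure M (qball M \<rho> x r) < \<infinity>"
    and doubling: "\<And>x r. x \<in> space M \<Longrightarrow> 0 < r \<Longrightarrow>
           measure M (qball M \<rho> x (2 * r)) \<le> L * measure M (qball M \<rho> x r)"
begin

abbreviation B :: "'a \<Rightarrow> real \<Rightarrow> 'a set" where "B \<equiv> qball M \<rho>"

abbreviation vol :: "'a \<Rightarrow> real \<Rightarrow> real" where "vol x r \<equiv> measure M (B x r)"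

lemma mem_B: "y \<in> B x r \<longleftrightarrow> y \<in> space M \<and> \<rho> x y < r"
  by (simp add: qball_def)

lemma B_sub_space: "B x r \<subseteq> space M"
  by (auto simp: qball_def)

lemma emeasure_B: "x \<in> space M \<Longrightarrow> 0 < r \<Longrightarrow> emeasure M (B x r) = ennreal (vol x r)"
  using ball_emeasure_fin[of x r] by (intro emeasure_eq_ennreal_measure) (auto simp: top.not_eq_extremum)

lemma vol_pos: "x \<in> space M \<Longrightarrow> 0 < r \<Longrightarrow> 0 < vol x r"
  using ball_emeasure_pos[of x r] emeasure_B[of x r] by simp

lemma vol_mono:
  assumes "x \<in> space M" "0 < r" "B y s \<subseteq> B x r" "y \<in> space M" "0 < s"
  shows "vol y s \<le> vol x r"
  using assms ball_sets ball_emeasure_fin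
  by (intro measure_mono_fmeasurable) (auto simp: fmeasurable_def)

lemma ball_shift:
  assumes "x \<in> space M" "y \<in> space M" "K * (\<rho> x y + s) \<le> r"
  shows "B y s \<subseteq> B x r"
proof
  fix z assume z: "z \<in> B y s"
  have "\<rho> x z \<le> K * (\<rho> x y + \<rho> y z)" using assms z rho_triangle by (auto simp: mem_B)
  also have "\<dots> < K * (\<rho> x y + s)" using z K_ge1 by (auto simp: mem_B)
  finally show "z \<in> B x r" using z assms by (auto simp: mem_B)
qed

text \<open>A bound for the growth of volume under dilation by \<open>c\<close>: since \<open>c \<le> 2\<^sup>m\<close> for the natural number
  \<open>m \<ge> c\<close> chosen here, \<open>m\<close> doublings suffice.\<close>

definition dilation_const :: "real \<Rightarrow> real" where "dilation_const c = L ^ nat \<lceil>c\<rceil>"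

lemma dilation_const_ge1: "1 \<le> dilation_const c"
  unfolding dilation_const_def using L_ge1 by simp

lemma vol_power2: "x \<in> space M \<Longrightarrow> 0 < r \<Longrightarrow> vol x (2 ^ n * r) \<le> L ^ n * vol x r"
proof (induction n)
  case (Suc n)
  have "vol x (2 ^ Suc n * r) \<le> L * vol x (2 ^ n * r)"
    using doubling[of x "2 ^ n * r"] Suc.prems by (simp add: mult.assoc)
  also have "\<dots> \<le> L * (L ^ n * vol x r)"
    using Suc L_ge1 by (intro mult_left_mono) auto
  finally show ?case by (simp add: mult.assoc)
qed simp

lemma vol_dilate:
  assumes "x \<in> space M" "0 < r" "0 < c"
  shows "vol x (c * r) \<le> dilation_const c * vol x r"
proof -
  have "c \<le> real (nat \<lceil>c\<rceil>)" by linarith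
  also have "\<dots> \<le> 2 ^ nat \<lceil>c\<rceil>" by (rule of_nat_less_two_power[THEN less_imp_le])
  finally have c: "c * r \<le> 2 ^ nat \<lceil>c\<rceil> * r" using assms by (intro mult_right_mono) auto
  have "vol x (c * r) \<le> vol x (2 ^ nat \<lceil>c\<rceil> * r)"
    using assms c less_le_trans[OF _ c] by (intro vol_mono) (auto simp: mem_B)
  also have "\<dots> \<le> dilation_const c * vol x r" unfolding dilation_const_def using assms by (intro vol_power2) auto
  finally show ?thesis .
qed

lemma vol_compare:
  assumes "x \<in> space M" "y \<in> space M" "0 < r" "0 < s" "K * (\<rho> x y + s) \<le> c * r" "0 < c"
  shows "vol y s \<le> dilation_const c * vol x r"
proof -
  have "vol y s \<le> vol x (c * r)"
    using assms by (intro vol_mono ball_shift) auto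
  also have "\<dots> \<le> dilation_const c * vol x r" using assms by (intro vol_dilate) auto
  finally show ?thesis .
qed

lemma space_exhaust:
  assumes "x \<in> space M" "y \<in> space M"
  shows "\<exists>n. y \<in> B x (real (Suc n))"
proof -
  obtain n where "\<rho> x y < real n" using reals_Archimedean2 by blast
  then show ?thesis using assms by (intro exI[of _ n]) (auto simp: mem_B)
qed

text \<open>Balls of radius \<open>e / (2 K)\<close> around separated points are disjoint and lie in one fixed ball, and by
  doubling each of them has a fixed fraction of its volume.\<close>

lemma separated_card_bound:
  assumes x0: "x0 \<in> space M" and R: "0 < R" and e: "0 < e"
  shows "\<exists>N. \<forall>S. finite S \<and> S \<subseteq> B x0 R \<and> (\<forall>s\<in>S. \<forall>t\<in>S. s \<noteq> t \<longrightarrow> e \<le> \<rho> s t) \<longrightarrow> card S \<le> N"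
proof -
  \<comment> \<open>The ratio of \<open>2 K R\<close>, a radius for which the balls around the points contain the ball around \<open>x0\<close>, to \<open>e / (2 K)\<close>.\<close>
  define c where "c = 4 * K\<^sup>2 * R / e"
  have c: "0 < c" using R e K_ge1 by (simp add: c_def)
  define V where "V = vol x0 (K * (R + e))"
  define v where "v = vol x0 R / dilation_const c"
  have v: "0 < v" using vol_pos[OF x0 R] dilation_const_ge1[of c] by (simp add: v_def)
  have "card S \<le> nat \<lceil>V / v\<rceil>"
    if S: "finite S" "S \<subseteq> B x0 R" "\<forall>s\<in>S. \<forall>t\<in>S. s \<noteq> t \<longrightarrow> e \<le> \<rho> s t" for S
  proof -
    have sp: "s \<in> space M" if "s \<in> S" for s using S that by (auto simp: mem_B)
    have dp: "0 < e / (2 * K)" using e K_ge1 by simp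
    have disj: "disjoint_family_on (\<lambda>s. B s (e / (2 * K))) S"
    proof (unfold disjoint_family_on_def, intro ballI impI, rule ccontr)
      fix s t assume st: "s \<in> S" "t \<in> S" "s \<noteq> t" "B s (e / (2 * K)) \<inter> B t (e / (2 * K)) \<noteq> {}"
      then obtain z where z: "z \<in> B s (e / (2 * K))" "z \<in> B t (e / (2 * K))" by auto
      have "\<rho> s t \<le> K * (\<rho> s z + \<rho> z t)"
        using st sp z by (intro rho_triangle) (auto simp: mem_B)
      also have "\<dots> < K * (e / (2 * K) + e / (2 * K))"
        using z K_ge1 rho_sym[of z t] sp st by (intro mult_strict_left_mono) (auto simp: mem_B)
      also have "\<dots> = e" using K_ge1 by (simp add: field_simps)
      finally show False using S st by force
    qed
    have le: "e / (2 * K) \<le> e" using e K_ge1 by (simp add: divide_le_eq)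
    have "(\<Sum>s\<in>S. vol s (e / (2 * K))) = measure M (\<Union>s\<in>S. B s (e / (2 * K)))"
      using S disj sp dp ball_sets ball_emeasure_fin
      by (intro measure_finite_Union[symmetric]) (auto simp: less_top)
    also have "\<dots> \<le> V" unfolding V_def
    proof (intro measure_mono_fmeasurable UN_least)
      fix s assume s: "s \<in> S"
      have "K * (\<rho> x0 s + e / (2 * K)) \<le> K * (R + e)"
        using s S K_ge1 le by (intro mult_left_mono add_mono) (auto simp: mem_B)
      then show "B s (e / (2 * K)) \<subseteq> B x0 (K * (R + e))"
        using s sp x0 by (intro ball_shift) auto
    next
      show "(\<Union>s\<in>S. B s (e / (2 * K))) \<in> sets M" using S sp dp ball_sets by auto
      show "B x0 (K * (R + e)) \<in> fmeasurable M"
        using ball_sets ball_emeasure_fin x0 R e K_ge1 by (auto simp: fmeasurable_def)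
    qed
    finally have "(\<Sum>s\<in>S. vol s (e / (2 * K))) \<le> V" .
    moreover have "(\<Sum>s\<in>S. v) \<le> (\<Sum>s\<in>S. vol s (e / (2 * K)))"
    proof (rule sum_mono)
      fix s assume s: "s \<in> S"
      have "\<rho> s x0 \<le> R" using s S x0 sp rho_sym[of s x0] by (auto simp: mem_B)
      then have "K * (\<rho> s x0 + R) \<le> K * (R + R)" using K_ge1 by (intro mult_left_mono) auto
      also have "\<dots> = c * (e / (2 * K))" using e K_ge1 by (simp add: c_def field_simps power2_eq_square)
      finally have "vol x0 R \<le> dilation_const c * vol s (e / (2 * K))"
        using s sp x0 R dp c by (intro vol_compare) auto
      then show "v \<le> vol s (e / (2 * K))"
        using dilation_const_ge1[of c] by (simp add: v_def divide_le_eq mult.commute)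
    qed
    ultimately have "real (card S) * v \<le> V" by simp
    then have "real (card S) \<le> V / v" using v by (simp add: le_divide_eq)
    then show ?thesis by linarith
  qed
  then show ?thesis by blast
qed

text \<open>A separated subset of maximal cardinality is a net, because any point far from it could be added.\<close>

lemma finite_net:
  assumes x0: "x0 \<in> space M" and R: "0 < R" and e: "0 < e"
  shows "\<exists>S. finite S \<and> S \<subseteq> space M \<and> (\<forall>y\<in>B x0 R. \<exists>s\<in>S. \<rho> y s < e)"
proof -
  define P where "P S \<longleftrightarrow> finite S \<and> S \<subseteq> B x0 R \<and>
    (\<forall>s\<in>S. \<forall>t\<in>S. s \<noteq> t \<longrightarrow> e \<le> \<rho> s t)" for S
  obtain N where N: "\<And>S. P S \<Longrightarrow> card S \<le> N"
    using separated_card_bound[OF assms] unfolding P_def by blast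
  have "P {}" by (simp add: P_def)
  moreover have "\<forall>S. P S \<longrightarrow> card S < Suc N" using N by (simp add: le_imp_less_Suc)
  ultimately have "\<exists>S. P S \<and> (\<forall>T. P T \<longrightarrow> card T \<le> card S)"
    by (rule Lattices_Big.ex_has_greatest_nat)
  then obtain S where S: "P S" "\<And>T. P T \<Longrightarrow> card T \<le> card S" by blast
  have "\<exists>s\<in>S. \<rho> y s < e" if y: "y \<in> B x0 R" for y
  proof (rule ccontr)
    assume "\<not> (\<exists>s\<in>S. \<rho> y s < e)"
    then have far: "\<And>s. s \<in> S \<Longrightarrow> e \<le> \<rho> y s" by (meson not_le)
    then have nin: "y \<notin> S" using rho_refl[of y] y e by (auto simp: mem_B dest!: far)
    have "e \<le> \<rho> s y" if "s \<in> S" for s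
      using far[OF that] rho_sym[of s y] y S(1) that by (auto simp: P_def mem_B)
    then have "P (insert y S)" using S(1) y far by (auto simp: P_def)
    then have "card (insert y S) \<le> card S" by (rule S(2))
    then show False using nin S(1) by (simp add: P_def)
  qed
  then show ?thesis using S(1) B_sub_space[of x0 R] by (intro exI[of _ S]) (auto simp: P_def)
qed

lemma ex_countable_dense:
  "\<exists>D. countable D \<and> D \<subseteq> space M \<and> (\<forall>y\<in>space M. \<forall>r>0. \<exists>d\<in>D. \<rho> y d < r)"
proof -
  obtain x0 where x0: "x0 \<in> space M" using space_ne by auto
  have "\<forall>n m. \<exists>S. finite S \<and> S \<subseteq> space M \<and>
    (\<forall>y\<in>B x0 (real (Suc n)). \<exists>s\<in>S. \<rho> y s < 1 / real (Suc m))"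
    using finite_net[OF x0] by simp
  then obtain S where S: "\<And>n m. finite (S n m)" "\<And>n m. S n m \<subseteq> space M"
    "\<And>n m y. y \<in> B x0 (real (Suc n)) \<Longrightarrow> \<exists>s\<in>S n m. \<rho> y s < 1 / real (Suc m)" by metis
  have "\<exists>d\<in>(\<Union>n m. S n m). \<rho> y d < r" if y: "y \<in> space M" and r: "0 < r" for y r
  proof -
    obtain n where n: "y \<in> B x0 (real (Suc n))" using space_exhaust[OF x0 y] by blast
    obtain m where m: "inverse (real (Suc m)) < r" using reals_Archimedean[OF r] by blast
    obtain s where "s \<in> S n m" "\<rho> y s < 1 / real (Suc m)" using S(3)[OF n] by blast
    then show ?thesis using m by (force simp: inverse_eq_divide)
  qed
  moreover have "countable (\<Union>n m. S n m)" by (intro countable_UN countable_finite S(1) countableI_type)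
  moreover have "(\<Union>n m. S n m) \<subseteq> space M" using S(2) by blast
  ultimately show ?thesis by (intro exI[of _ "\<Union>n m. S n m"]) simp
qed

definition dense_points :: "'a set" where
  "dense_points = (SOME D. countable D \<and> D \<subseteq> space M \<and> (\<forall>y\<in>space M. \<forall>r>0. \<exists>d\<in>D. \<rho> y d < r))"

lemma dense_points: "countable dense_points" "dense_points \<subseteq> space M"
    "\<And>y r. y \<in> space M \<Longrightarrow> 0 < r \<Longrightarrow> \<exists>d\<in>dense_points. \<rho> y d < r"
  using someI_ex[OF ex_countable_dense] unfolding dense_points_def[symmetric] by simp_all

text \<open>A countable family that contains, for every ball, a larger ball of comparable volume.\<close>

definition net_balls :: "('a \<times> real) set" where
  "net_balls = dense_points \<times> {q \<in> \<rat>. 0 < q}"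

lemma countable_net_balls: "countable net_balls"
  unfolding net_balls_def using dense_points(1) countable_rat
  by (intro countable_SIGMA) (auto intro: countable_subset)

lemma net_ballsD: "(d, q) \<in> net_balls \<Longrightarrow> d \<in> space M \<and> 0 < q"
  using dense_points(2) by (auto simp: net_balls_def)

section \<open>The maximal function over countably many balls\<close>

definition average :: "('a \<Rightarrow> ennreal) \<Rightarrow> 'a \<Rightarrow> real \<Rightarrow> ennreal" where
  "average w y r = (\<integral>\<^sup>+z\<in>B y r. w z \<partial>M) / emeasure M (B y r)"

text \<open>Unlike \<^const>\<open>hl_maximal\<close> this is a countable supremum of measurable functions, hence measurable.\<close>

definition countable_maximal :: "('a \<Rightarrow> ennreal) \<Rightarrow> 'a \<Rightarrow> ennreal" where
  "countable_maximal w x = (SUP (d, q)\<in>net_balls. average w d q * indicator (B d q) x)"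

lemma countable_maximal_measurable[measurable]: "countable_maximal w \<in> borel_measurable M"
proof -
  have "(\<lambda>x. average w d q * indicator (B d q) x) \<in> borel_measurable M" if "(d, q) \<in> net_balls" for d q
    using net_ballsD[OF that] ball_sets by simp
  then show ?thesis unfolding countable_maximal_def
    by (intro borel_measurable_SUP countable_net_balls) auto
qed

text \<open>Move the centre to a point of the dense set at distance less than \<open>r\<close> and enlarge the radius to a
  rational between \<open>2 K r\<close> and \<open>4 K r\<close>; the volume grows by a bounded factor.\<close>

lemma average_le_countable_maximal:
  assumes x: "x \<in> B y r" and y: "y \<in> space M" and r: "0 < r"
  shows "average w y r \<le> ennreal (dilation_const (K * (1 + 4 * K))) * countable_maximal w x"
proof -
  define c where "c = K * (1 + 4 * K)"
  have c: "0 < c" using K_ge1 by (simp add: c_def)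
  obtain d where d: "d \<in> dense_points" "\<rho> y d < r" using dense_points(3)[OF y r] by blast
  then have ds: "d \<in> space M" using dense_points(2) by auto
  have "K * 2 * r < K * 4 * r" using K_ge1 r by simp
  then obtain q where q: "q \<in> \<rat>" "K * 2 * r < q" "q < K * 4 * r" using Rats_dense_in_real by blast
  have q0: "0 < q" using q(2) K_ge1 r by (auto intro: less_trans[rotated])
  have bal: "(d, q) \<in> net_balls" using d q q0 by (simp add: net_balls_def)
  have "K * (\<rho> d y + r) \<le> K * (r + r)"
    using d(2) rho_sym[of y d] y ds K_ge1 by (intro mult_left_mono) auto
  then have sub: "B y r \<subseteq> B d q" using q ds y by (intro ball_shift) (auto simp: algebra_simps)
  have "K * (\<rho> y d + q) \<le> K * (r + K * 4 * r)"
    using d(2) q K_ge1 by (intro mult_left_mono add_mono) auto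
  also have "\<dots> = c * r" by (simp add: c_def algebra_simps)
  finally have vl: "vol d q \<le> dilation_const c * vol y r" using ds y r q0 c by (intro vol_compare) auto
  have "average w y r \<le> (\<integral>\<^sup>+z\<in>B d q. w z \<partial>M) / emeasure M (B y r)"
    unfolding average_def using sub
    by (intro divide_right_mono_ennreal nn_integral_mono) (auto split: split_indicator)
  also have "\<dots> \<le> (\<integral>\<^sup>+z\<in>B d q. w z \<partial>M) * (ennreal (dilation_const c) / emeasure M (B d q))"
  proof -
    have "1 / vol y r \<le> dilation_const c / vol d q"
      using vl vol_pos[OF y r] vol_pos[OF ds q0] by (simp add: field_simps)
    then have "1 / emeasure M (B y r) \<le> ennreal (dilation_const c) / emeasure M (B d q)"
      unfolding emeasure_B[OF y r] emeasure_B[OF ds q0] ennreal_1[symmetric]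
      using vol_pos[OF y r] vol_pos[OF ds q0] dilation_const_ge1[of c]
      by (subst (1 2) divide_ennreal) (auto intro: ennreal_leI)
    then show ?thesis
      by (subst divide_ennreal_def) (auto intro!: mult_left_mono simp: divide_ennreal_def)
  qed
  also have "\<dots> = ennreal (dilation_const c) * average w d q"
    unfolding average_def by (simp add: divide_ennreal_def mult_ac)
  also have "average w d q = average w d q * indicator (B d q) x" using x sub by auto
  also have "\<dots> \<le> countable_maximal w x" unfolding countable_maximal_def
    by (rule SUP_upper2[OF bal]) auto
  finally show ?thesis unfolding c_def by (simp add: mult_left_mono)
qed

lemma hl_maximal_eq: 
  "hl_maximal M \<rho> f x =
    (SUP (y, r) \<in> {(y, r). y \<in> space M \<and> r > 0 \<and> x \<in> B y r}. average (\<lambda>z. ennreal (norm (f z))) y r)"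
  by (simp add: hl_maximal_def average_def)

lemma hl_maximal_le_countable_maximal:
  "hl_maximal M \<rho> f x \<le> ennreal (dilation_const (K * (1 + 4 * K))) * countable_maximal (\<lambda>z. ennreal (norm (f z))) x"
  unfolding hl_maximal_eq by (rule SUP_least) (auto intro: average_le_countable_maximal)

text \<open>Keep a ball of largest radius, discard the balls that meet it, and repeat.  A discarded ball has no
  larger radius than the kept one, so by two uses of the quasi-triangle inequality it lies in the dilation of
  the kept ball by \<open>K (1 + 2 K)\<close>.\<close>

lemma finite_vitali:
  assumes "finite I" "\<And>d q. (d, q) \<in> I \<Longrightarrow> d \<in> space M \<and> 0 < q"
  shows "\<exists>J\<subseteq>I. disjoint_family_on (\<lambda>(d, q). B d q) J \<and>
    (\<Union>(d, q)\<in>I. B d q) \<subseteq> (\<Union>(d, q)\<in>J. B d (K * (1 + 2 * K) * q))"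
  using assms
proof (induction "card I" arbitrary: I rule: less_induct)
  case less
  show ?case
  proof (cases "I = {}")
    case True then show ?thesis by (auto simp: disjoint_family_on_def)
  next
    case False
    obtain i where i: "i \<in> I" "\<And>j. j \<in> I \<Longrightarrow> snd j \<le> snd i"
      using Max_in[of "snd ` I"] Max_ge[of "snd ` I"] less.prems(1) False by fastforce
    obtain d q where dq: "i = (d, q)" by (cases i)
    define I' where "I' = {(e, s) \<in> I. B e s \<inter> B d q = {}}"
    have d: "d \<in> space M" "0 < q" using less.prems(2) i dq by auto
    have "d \<in> B d q" using d rho_refl by (simp add: mem_B)
    then have "i \<notin> I'" by (auto simp: I'_def dq)
    then have "I' \<subset> I" using i(1) by (auto simp: I'_def)
    then have "card I' < card I" "finite I'" using less.prems(1) by (auto intro: psubset_card_mono finite_subset)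
    then obtain J where J: "J \<subseteq> I'" "disjoint_family_on (\<lambda>(d, q). B d q) J"
      "(\<Union>(d, q)\<in>I'. B d q) \<subseteq> (\<Union>(d, q)\<in>J. B d (K * (1 + 2 * K) * q))"
      using less.hyps[of I'] less.prems(2) \<open>I' \<subset> I\<close> by blast
    have cov: "B e s \<subseteq> B d (K * (1 + 2 * K) * q)" if e: "(e, s) \<in> I" "(e, s) \<notin> I'" for e s
    proof -
      obtain z where z: "z \<in> B e s" "z \<in> B d q" using e by (auto simp: I'_def)
      have es: "e \<in> space M" "s \<le> q" using less.prems(2) e i(2) dq by fastforce+
      have "\<rho> z e = \<rho> e z" using z es rho_sym by (auto simp: mem_B)
      have "\<rho> d e \<le> K * (\<rho> d z + \<rho> z e)" using z es d by (intro rho_triangle) (auto simp: mem_B)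
      have "z \<in> space M" using z by (auto simp: mem_B)
      show ?thesis
      proof
        fix y assume y: "y \<in> B e s"
        then have ys: "y \<in> space M" by (auto simp: mem_B)
        have "\<rho> z y \<le> K * (\<rho> z e + \<rho> e y)" using \<open>z \<in> space M\<close> es ys by (intro rho_triangle)
        also have "\<dots> \<le> K * (q + q)" using y z \<open>\<rho> z e = \<rho> e z\<close> es K_ge1
          by (intro mult_left_mono add_mono) (auto simp: mem_B)
        finally have zy: "\<rho> z y \<le> 2 * K * q" by simp
        have "\<rho> d y \<le> K * (\<rho> d z + \<rho> z y)" using \<open>z \<in> space M\<close> d ys by (intro rho_triangle)
        also have "\<dots> < K * (q + 2 * K * q)"
          using z zy K_ge1 by (intro mult_strict_left_mono add_less_le_mono) (auto simp: mem_B)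
        also have "\<dots> = K * (1 + 2 * K) * q" by (simp add: algebra_simps)
        finally show "y \<in> B d (K * (1 + 2 * K) * q)" using ys by (simp add: mem_B)
      qed
    qed
    have "disjoint_family_on (\<lambda>(d, q). B d q) (insert i J)"
      using J(1,2) unfolding disjoint_family_on_def dq I'_def by blast
    moreover have "insert i J \<subseteq> I" using i J(1) \<open>I' \<subset> I\<close> by auto
    moreover have "(\<Union>(d, q)\<in>I. B d q) \<subseteq> (\<Union>(d, q)\<in>insert i J. B d (K * (1 + 2 * K) * q))"
    proof
      fix y assume "y \<in> (\<Union>(d, q)\<in>I. B d q)"
      then obtain e s where es: "(e, s) \<in> I" "y \<in> B e s" by auto
      show "y \<in> (\<Union>(d, q)\<in>insert i J. B d (K * (1 + 2 * K) * q))"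
      proof (cases "(e, s) \<in> I'")
        case True then show ?thesis using J(3) es by blast
      next
        case False then show ?thesis using cov es by (auto simp: dq)
      qed
    qed
    ultimately show ?thesis by blast
  qed
qed

lemma weak_type_finite:
  assumes "finite I" "\<And>d q. (d, q) \<in> I \<Longrightarrow> d \<in> space M \<and> 0 < q \<and> t < average w d q"
    and [measurable]: "w \<in> borel_measurable M"
  shows "t * emeasure M (\<Union>(d, q)\<in>I. B d q) \<le> ennreal (dilation_const (K * (1 + 2 * K))) * (\<integral>\<^sup>+x. w x \<partial>M)"
proof -
  define k where "k = K * (1 + 2 * K)"
  have k: "0 < k" using K_ge1 by (simp add: k_def)
  obtain J where J: "J \<subseteq> I" "disjoint_family_on (\<lambda>(d, q). B d q) J"
    "(\<Union>(d, q)\<in>I. B d q) \<subseteq> (\<Union>(d, q)\<in>J. B d (k * q))"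
    using finite_vitali[OF assms(1)] assms(2) unfolding k_def by blast
  have fJ: "finite J" using J(1) assms(1) finite_subset by blast
  have JD: "d \<in> space M" "0 < q" "t < average w d q" if "(d, q) \<in> J" for d q
    using assms(2) J(1) that by blast+
  have setsJ: "(case i of (d, q) \<Rightarrow> B d q) \<in> sets M" if "i \<in> J" for i
    using JD that ball_sets by (cases i) auto
  have setskJ: "(case i of (d, q) \<Rightarrow> B d (k * q)) \<in> sets M" if "i \<in> J" for i
    using JD that ball_sets k by (cases i) auto
  have dil: "emeasure M (case i of (d, q) \<Rightarrow> B d (k * q))
      \<le> ennreal (dilation_const k) * emeasure M (case i of (d, q) \<Rightarrow> B d q)" if i: "i \<in> J" for i
  proof -
    obtain d q where dq: "i = (d, q)" by (cases i)
    then have "vol d (k * q) \<le> dilation_const k * vol d q" using JD[of d q] i k by (intro vol_dilate) auto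
    then show ?thesis using JD[of d q] i k dilation_const_ge1[of k]
      by (simp add: dq emeasure_B ennreal_leI flip: ennreal_mult)
  qed
  have average: "t * emeasure M (case i of (d, q) \<Rightarrow> B d q)
      \<le> (\<integral>\<^sup>+x. w x * indicator (case i of (d, q) \<Rightarrow> B d q) x \<partial>M)" if i: "i \<in> J" for i
  proof -
    obtain d q where dq: "i = (d, q)" by (cases i)
    have e: "emeasure M (B d q) \<noteq> 0" "emeasure M (B d q) \<noteq> \<infinity>"
      using JD[of d q] i dq ball_emeasure_pos[of d q] ball_emeasure_fin[of d q] by auto
    have "t * emeasure M (B d q) \<le> average w d q * emeasure M (B d q)"
      using JD[of d q] i dq by (intro mult_right_mono) auto
    also have "\<dots> = (\<integral>\<^sup>+z\<in>B d q. w z \<partial>M)"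
      unfolding average_def using e
      by (metis ennreal_times_divide infinity_ennreal_def mult.commute mult_divide_eq_ennreal)
    finally show ?thesis by (simp add: dq)
  qed
  have "t * emeasure M (\<Union>(d, q)\<in>I. B d q) \<le> t * emeasure M (\<Union>i\<in>J. case i of (d, q) \<Rightarrow> B d (k * q))"
    using J(3) setskJ fJ by (intro mult_left_mono emeasure_mono sets.finite_UN) auto
  also have "\<dots> \<le> t * (\<Sum>i\<in>J. emeasure M (case i of (d, q) \<Rightarrow> B d (k * q)))"
    using setskJ fJ by (intro mult_left_mono emeasure_subadditive_finite) auto
  also have "\<dots> \<le> t * (\<Sum>i\<in>J. ennreal (dilation_const k) * emeasure M (case i of (d, q) \<Rightarrow> B d q))"
    using dil by (intro mult_left_mono sum_mono) auto
  also have "\<dots> = ennreal (dilation_const k) * (\<Sum>i\<in>J. t * emeasure M (case i of (d, q) \<Rightarrow> B d q))"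
    by (simp add: sum_distrib_left mult_ac)
  also have "\<dots> \<le> ennreal (dilation_const k) * (\<Sum>i\<in>J. \<integral>\<^sup>+x. w x * indicator (case i of (d, q) \<Rightarrow> B d q) x \<partial>M)"
    using average by (intro mult_left_mono sum_mono) auto
  also have "(\<Sum>i\<in>J. \<integral>\<^sup>+x. w x * indicator (case i of (d, q) \<Rightarrow> B d q) x \<partial>M)
      = (\<integral>\<^sup>+x. (\<Sum>i\<in>J. w x * indicator (case i of (d, q) \<Rightarrow> B d q) x) \<partial>M)"
    using setsJ by (subst nn_integral_sum) auto
  also have "\<dots> \<le> (\<integral>\<^sup>+x. w x \<partial>M)"
  proof (rule nn_integral_mono)
    fix x
    have "(\<Sum>i\<in>J. w x * indicator (case i of (d, q) \<Rightarrow> B d q) x)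
        = w x * indicator (\<Union>i\<in>J. case i of (d, q) \<Rightarrow> B d q) x"
      unfolding sum_distrib_left[symmetric] indicator_UN_disjoint[OF fJ J(2)] ..
    also have "\<dots> \<le> w x * 1" by (intro mult_left_mono) (auto split: split_indicator)
    finally show "(\<Sum>i\<in>J. w x * indicator (case i of (d, q) \<Rightarrow> B d q) x) \<le> w x" by simp
  qed
  finally show ?thesis unfolding k_def by (simp add: mult_left_mono)
qed

text \<open>The level set is a countable union of balls with large average; exhaust it by finite unions and use
  the covering lemma for each of them.\<close>

lemma weak_type:
  assumes [measurable]: "w \<in> borel_measurable M"
  shows "t * emeasure M {x \<in> space M. t < countable_maximal w x} \<le> ennreal (dilation_const (K * (1 + 2 * K))) * (\<integral>\<^sup>+x. w x \<partial>M)"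
proof -
  define I where "I = {(d, q) \<in> net_balls. t < average w d q}"
  have cI: "countable I" unfolding I_def by (rule countable_subset[OF _ countable_net_balls]) auto
  have eq: "{x \<in> space M. t < countable_maximal w x} = (\<Union>(d, q)\<in>I. B d q)"
  proof (intro set_eqI iffI)
    fix x assume "x \<in> {x \<in> space M. t < countable_maximal w x}"
    then obtain i where i: "i \<in> net_balls" "t < (case i of (d, q) \<Rightarrow> average w d q * indicator (B d q) x)"
      unfolding countable_maximal_def less_SUP_iff by blast
    obtain d q where dq: "i = (d, q)" by (cases i)
    have "x \<in> B d q" using i(2) unfolding dq by (rule_tac ccontr) simp
    then show "x \<in> (\<Union>(d, q)\<in>I. B d q)" using i unfolding dq I_def by auto
  next
    fix x assume "x \<in> (\<Union>(d, q)\<in>I. B d q)"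
    then obtain d q where dq: "(d, q) \<in> net_balls" "t < average w d q" "x \<in> B d q" by (auto simp: I_def)
    then have "t < countable_maximal w x" unfolding countable_maximal_def less_SUP_iff by (intro bexI[of _ "(d, q)"]) auto
    then show "x \<in> {x \<in> space M. t < countable_maximal w x}" using dq(3) by (simp add: mem_B)
  qed
  show ?thesis
  proof (cases "I = {}")
    case True then show ?thesis unfolding eq by simp
  next
    case False
    define U where "U n = (\<Union>(d, q)\<in>from_nat_into I ` {..<n}. B d q)" for n :: nat
    have mem: "from_nat_into I m \<in> I" for m by (rule from_nat_into[OF False])
    have ID: "d \<in> space M \<and> 0 < q \<and> t < average w d q" if "(d, q) \<in> I" for d q
      using that net_ballsD by (auto simp: I_def)
    have sets_B: "(case i of (d, q) \<Rightarrow> B d q) \<in> sets M" if "i \<in> I" for i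
      using ID that ball_sets by (cases i) auto
    have "(\<Union>n. U n) = (\<Union>(d, q)\<in>I. B d q)"
    proof -
      have "(\<Union>n. U n) = (\<Union>(d, q)\<in>range (from_nat_into I). B d q)"
        unfolding U_def UN_UN_flatten[symmetric] image_UN[symmetric] UN_lessThan_UNIV ..
      then show ?thesis by (simp add: range_from_nat_into[OF False cI])
    qed
    moreover have "incseq U" unfolding U_def incseq_def
      by (intro allI impI UN_mono image_mono) auto
    moreover have "range U \<subseteq> sets M" 
    proof (clarify)
      fix n show "U n \<in> sets M" unfolding U_def using sets_B mem by (intro sets.finite_UN) auto
    qed
    ultimately have "emeasure M (\<Union>(d, q)\<in>I. B d q) = (SUP n. emeasure M (U n))"
      using SUP_emeasure_incseq[of U M] by simp
    then have "t * emeasure M {x \<in> space M. t < countable_maximal w x} = (SUP n. t * emeasure M (U n))"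
      unfolding eq by (simp add: SUP_mult_left_ennreal)
    also have "\<dots> \<le> ennreal (dilation_const (K * (1 + 2 * K))) * (\<integral>\<^sup>+x. w x \<partial>M)"
    proof (rule SUP_least)
      fix n show "t * emeasure M (U n) \<le> ennreal (dilation_const (K * (1 + 2 * K))) * (\<integral>\<^sup>+x. w x \<partial>M)"
        unfolding U_def
      proof (rule weak_type_finite)
        fix d q assume "(d, q) \<in> from_nat_into I ` {..<n}"
        then have "(d, q) \<in> I" using mem by (metis imageE)
        then show "d \<in> space M \<and> 0 < q \<and> t < average w d q" by (rule ID)
      qed auto
    qed
    finally show ?thesis .
  qed
qed

lemma average_split:
  assumes "y \<in> space M" "0 < r" and [measurable]: "w \<in> borel_measurable M"
  shows "average w y r \<le> average (\<lambda>x. w x * indicator {x \<in> space M. s < w x} x) y r + s"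
proof -
  have [measurable]: "B y r \<in> sets M" using ball_sets assms by simp
  have e: "emeasure M (B y r) \<noteq> 0" "emeasure M (B y r) \<noteq> \<infinity>"
    using assms ball_emeasure_pos[of y r] ball_emeasure_fin[of y r] by auto
  let ?w = "\<lambda>x. w x * indicator {x \<in> space M. s < w x} x"
  have "(\<integral>\<^sup>+z\<in>B y r. w z \<partial>M) \<le> (\<integral>\<^sup>+z. ?w z * indicator (B y r) z + s * indicator (B y r) z \<partial>M)"
    by (intro nn_integral_mono) (auto split: split_indicator)
  also have "\<dots> = (\<integral>\<^sup>+z\<in>B y r. ?w z \<partial>M) + s * emeasure M (B y r)"
    by (subst nn_integral_add) (auto simp: nn_integral_cmult_indicator)
  finally have "average w y r \<le> ((\<integral>\<^sup>+z\<in>B y r. ?w z \<partial>M) + s * emeasure M (B y r)) / emeasure M (B y r)"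
    unfolding average_def by (rule divide_right_mono_ennreal)
  also have "\<dots> = average ?w y r + s"
    unfolding average_def using e by (simp add: add_divide_distrib_ennreal mult_divide_eq_ennreal)
  finally show ?thesis .
qed

text \<open>The part of \<open>w\<close> below \<open>s / 2\<close> contributes at most \<open>s / 2\<close> to every average, so at height \<open>s\<close> only
  the part above \<open>s / 2\<close> matters.  This localisation is what makes the dyadic summation converge.\<close>

lemma weak_type_truncated:
  assumes [measurable]: "w \<in> borel_measurable M" and s: "0 < s"
  shows "ennreal s * emeasure M {x \<in> space M. ennreal s < countable_maximal w x}
    \<le> ennreal (2 * dilation_const (K * (1 + 2 * K))) * (\<integral>\<^sup>+x. w x * indicator {x \<in> space M. ennreal (s / 2) < w x} x \<partial>M)"
proof -
  let ?w = "\<lambda>x. w x * indicator {x \<in> space M. ennreal (s / 2) < w x} x"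
  have le: "countable_maximal w x \<le> countable_maximal ?w x + ennreal (s / 2)" for x
  proof (unfold countable_maximal_def[of w], rule SUP_least)
    fix i assume i: "i \<in> net_balls"
    obtain d q where dq: "i = (d, q)" by (cases i)
    have "average w d q * indicator (B d q) x \<le> (average ?w d q + ennreal (s / 2)) * indicator (B d q) x"
      using net_ballsD[of d q] i dq by (intro mult_right_mono average_split) auto
    also have "\<dots> \<le> average ?w d q * indicator (B d q) x + ennreal (s / 2)"
      by (auto split: split_indicator)
    also have "average ?w d q * indicator (B d q) x \<le> countable_maximal ?w x"
      unfolding countable_maximal_def by (rule SUP_upper2[OF i]) (auto simp: dq)
    finally show "(case i of (d, q) \<Rightarrow> average w d q * indicator (B d q) x) \<le> countable_maximal ?w x + ennreal (s / 2)"
      by (simp add: dq add_right_mono)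
  qed
  have half: "ennreal s = ennreal (s / 2) + ennreal (s / 2)" using s by (simp flip: ennreal_plus)
  have sub: "{x \<in> space M. ennreal s < countable_maximal w x} \<subseteq> {x \<in> space M. ennreal (s / 2) < countable_maximal ?w x}"
  proof safe
    fix x assume "ennreal s < countable_maximal w x"
    then have "ennreal (s / 2) + ennreal (s / 2) < ennreal (s / 2) + countable_maximal ?w x"
      using order_less_le_trans[OF _ le[of x], of "ennreal s"] half by (simp add: add.commute)
    then show "ennreal (s / 2) < countable_maximal ?w x" by (simp add: ennreal_add_left_cancel_less)
  qed
  have "ennreal s * emeasure M {x \<in> space M. ennreal s < countable_maximal w x}
      \<le> ennreal s * emeasure M {x \<in> space M. ennreal (s / 2) < countable_maximal ?w x}"
    by (intro mult_left_mono emeasure_mono sub) measurable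
  also have "\<dots> = 2 * (ennreal (s / 2) * emeasure M {x \<in> space M. ennreal (s / 2) < countable_maximal ?w x})"
  proof -
    have "ennreal s = 2 * ennreal (s / 2)" using half by (simp add: mult_2)
    then show ?thesis by (simp add: mult.assoc)
  qed
  also have "\<dots> \<le> 2 * (ennreal (dilation_const (K * (1 + 2 * K))) * (\<integral>\<^sup>+x. ?w x \<partial>M))"
    by (intro mult_left_mono weak_type) auto
  also have "\<dots> = ennreal (2 * dilation_const (K * (1 + 2 * K))) * (\<integral>\<^sup>+x. ?w x \<partial>M)"
    using dilation_const_ge1[of "K * (1 + 2 * K)"] by (simp add: ennreal_mult mult.assoc)
  finally show ?thesis .
qed

lemma countable_maximal_AE_finite:
  assumes [measurable]: "w \<in> borel_measurable M" and fin: "(\<integral>\<^sup>+x. w x \<partial>M) < \<infinity>"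
  shows "AE x in M. countable_maximal w x < \<infinity>"
proof -
  define D where "D = dilation_const (K * (1 + 2 * K))"
  define N where "N = {x \<in> space M. countable_maximal w x = \<infinity>}"
  have [measurable]: "N \<in> sets M" unfolding N_def by measurable
  obtain c where c: "ennreal D * (\<integral>\<^sup>+x. w x \<partial>M) = ennreal c" "0 \<le> c"
    using fin by (cases "ennreal D * (\<integral>\<^sup>+x. w x \<partial>M)") (auto simp: ennreal_mult_eq_top_iff)
  have le: "ennreal n * emeasure M N \<le> ennreal c" for n :: nat
  proof -
    have "ennreal n * emeasure M N \<le> ennreal n * emeasure M {x \<in> space M. ennreal n < countable_maximal w x}"
      by (intro mult_left_mono emeasure_mono) (auto simp: N_def)
    also have "\<dots> \<le> ennreal c" unfolding c(1)[symmetric] D_def by (rule weak_type) measurable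
    finally show ?thesis .
  qed
  have "emeasure M N = 0"
  proof (rule ccontr)
    assume "emeasure M N \<noteq> 0"
    moreover have "emeasure M N \<noteq> top" using le[of 1] by (auto simp: top_unique)
    ultimately obtain e where e: "emeasure M N = ennreal e" "0 < e"
      by (cases "emeasure M N") (auto simp: zero_less_iff_neq_zero less_le)
    obtain n :: nat where "c / e < real n" using reals_Archimedean2 by blast
    then have "c < real n * e" using e by (simp add: field_simps)
    moreover have "real n * e \<le> c" using le[of n] e c by (simp flip: ennreal_mult)
    ultimately show False by simp
  qed
  then show ?thesis
    by (intro AE_I[of _ _ N]) (auto simp: N_def less_top[symmetric])
qed

lemma average_cmult:
  assumes [measurable]: "w \<in> borel_measurable M" and "y \<in> space M" "0 < r"
  shows "average (\<lambda>z. ennreal c * w z) y r = ennreal c * average w y r"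
proof -
  have [measurable]: "B y r \<in> sets M" using assms ball_sets by blast
  show ?thesis unfolding average_def
    by (simp add: mult.assoc nn_integral_cmult ennreal_times_divide)
qed

lemma countable_maximal_cmult:
  assumes [measurable]: "w \<in> borel_measurable M"
  shows "countable_maximal (\<lambda>z. ennreal c * w z) x = ennreal c * countable_maximal w x"
proof -
  have "countable_maximal (\<lambda>z. ennreal c * w z) x = (SUP i\<in>net_balls. ennreal c * (case i of (d, q) \<Rightarrow> average w d q * indicator (B d q) x))"
    unfolding countable_maximal_def by (intro SUP_cong) (auto simp: average_cmult dest!: net_ballsD split: split_indicator)
  then show ?thesis unfolding countable_maximal_def by (simp add: SUP_mult_left_ennreal)
qed

text \<open>Countable subadditivity of the maximal operator, by monotone convergence for the majorants on each
  ball.\<close>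

lemma hl_maximal_suminf_le:
  fixes f :: "'a \<Rightarrow> 'b::real_normed_vector" and \<beta> :: "nat \<Rightarrow> 'a \<Rightarrow> real"
  assumes le: "AE z in M. ennreal (norm (f z)) \<le> (\<Sum>j. ennreal (l j) * ennreal (\<beta> j z))"
    and [measurable]: "\<And>j. \<beta> j \<in> borel_measurable M" and b0: "\<And>j z. 0 \<le> \<beta> j z"
  shows "hl_maximal M \<rho> f y \<le> (\<Sum>j. ennreal (l j) * hl_maximal M \<rho> (\<beta> j) y)"
  unfolding hl_maximal_eq[of f]
proof (rule SUP_least, clarify)
  fix z t assume z: "z \<in> space M" and t: "0 < t" and yz: "y \<in> B z t"
  have [measurable]: "B z t \<in> sets M" using z t by (rule ball_sets)
  have "(\<integral>\<^sup>+w\<in>B z t. ennreal (norm (f w)) \<partial>M)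
     \<le> (\<integral>\<^sup>+w. (\<Sum>j. ennreal (l j) * (ennreal (norm (\<beta> j w)) * indicator (B z t) w)) \<partial>M)"
    by (rule nn_integral_mono_AE, use le in eventually_elim) (use b0 in \<open>auto split: split_indicator\<close>)
  also have "\<dots> = (\<Sum>j. ennreal (l j) * (\<integral>\<^sup>+w\<in>B z t. ennreal (norm (\<beta> j w)) \<partial>M))"
    by (simp add: nn_integral_suminf nn_integral_cmult)
  finally have "average (\<lambda>z. ennreal (norm (f z))) z t
     \<le> (\<Sum>j. ennreal (l j) * (\<integral>\<^sup>+w\<in>B z t. ennreal (norm (\<beta> j w)) \<partial>M)) / emeasure M (B z t)"
    unfolding average_def by (rule divide_right_mono_ennreal)
  also have "\<dots> = (\<Sum>j. ennreal (l j) * average (\<lambda>z. ennreal (norm (\<beta> j z))) z t)"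
    by (simp only: average_def divide_ennreal_def ennreal_suminf_multc[symmetric] mult.assoc)
  also have "\<dots> \<le> (\<Sum>j. ennreal (l j) * hl_maximal M \<rho> (\<beta> j) y)"
    unfolding hl_maximal_eq
    by (intro suminf_le mult_left_mono SUP_upper2[of "(z, t)"]) (use z t yz in auto)
  finally show "average (\<lambda>z. ennreal (norm (f z))) z t \<le> \<dots>" .
qed

lemma sigma_finite: "sigma_finite_measure M"
proof
  obtain x0 where x0: "x0 \<in> space M" using space_ne by blast
  show "\<exists>A. countable A \<and> A \<subseteq> sets M \<and> \<Union> A = space M \<and> (\<forall>a\<in>A. emeasure M a \<noteq> \<infinity>)"
  proof (intro exI[of _ "range (\<lambda>n. B x0 (real (Suc n)))"] conjI)
    show "\<Union> (range (\<lambda>n. B x0 (real (Suc n)))) = space M"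
    proof (intro equalityI subsetI)
      fix y assume "y \<in> space M"
      then obtain n where "y \<in> B x0 (real (Suc n))" using space_exhaust[OF x0] by metis
      then show "y \<in> \<Union> (range (\<lambda>n. B x0 (real (Suc n))))" by (intro UnionI[OF rangeI])
    qed (auto simp: mem_B)
    show "\<forall>a\<in>range (\<lambda>n. B x0 (real (Suc n))). emeasure M a \<noteq> \<infinity>"
      using ball_emeasure_fin[OF x0] by (auto simp: less_top[symmetric])
    show "range (\<lambda>n. B x0 (real (Suc n))) \<subseteq> sets M" using ball_sets[OF x0] by auto
  qed auto
qed

end

section \<open>Convex functions of lower type greater than one\<close>

text \<open>Each term below one equals an increment of \<open>min (a\<^sup>k x) a / (a - 1)\<close>, so the sum telescopes.  The
  bound is uniform in \<open>x\<close> and in the number of terms.\<close>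

lemma truncated_geometric_sum:
  fixes a x :: real
  assumes a: "1 < a" and x: "0 \<le> x"
  shows "(\<Sum>k<n. (if a ^ k * x < 1 then a ^ k * x else 0)) \<le> a / (a - 1)"
proof -
  have "(if a ^ k * x < 1 then a ^ k * x else 0)
      \<le> (min (a ^ Suc k * x) a - min (a ^ k * x) a) / (a - 1)" for k
  proof (cases "a ^ k * x < 1")
    case True
    have "a ^ Suc k * x < a" using True a by (simp add: mult.assoc)
    then have "min (a ^ Suc k * x) a - min (a ^ k * x) a = a ^ Suc k * x - a ^ k * x"
      using True a by (simp add: min_def)
    also have "\<dots> = (a - 1) * (a ^ k * x)" by (simp add: algebra_simps)
    finally show ?thesis using a True by simp
  next
    case False
    have "a ^ k * x \<le> a ^ Suc k * x" using a x by (intro mult_right_mono power_increasing) auto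
    then show ?thesis using a False by (simp add: min_def)
  qed
  then have "(\<Sum>k<n. (if a ^ k * x < 1 then a ^ k * x else 0))
     \<le> (\<Sum>k<n. (min (a ^ Suc k * x) a - min (a ^ k * x) a) / (a - 1))" by (intro sum_mono)
  also have "\<dots> = (min (a ^ n * x) a - min x a) / (a - 1)"
    unfolding sum_divide_distrib[symmetric]
    using sum_lessThan_telescope[of "\<lambda>k. min (a ^ k * x) a" n] by simp
  also have "\<dots> \<le> a / (a - 1)" using a x by (intro divide_right_mono) (auto simp: min_def)
  finally show ?thesis .
qed

locale convex_orlicz =
  fixes \<Psi> :: "real \<Rightarrow> real" and p Cp :: real
  assumes Psi_convex: "convex_on {0..} \<Psi>"
    and Psi_mono: "\<And>s t. 0 \<le> s \<Longrightarrow> s \<le> t \<Longrightarrow> \<Psi> s \<le> \<Psi> t"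
    and Psi_0: "\<Psi> 0 = 0"
    and Psi_pos: "\<And>t. 0 < t \<Longrightarrow> 0 < \<Psi> t"
    and p_gt1: "1 < p"
    and Cp_ge1: "1 \<le> Cp"
    and Psi_lower: "\<And>s t. 0 < t \<Longrightarrow> 0 < s \<Longrightarrow> s < 1 \<Longrightarrow> \<Psi> (s * t) \<le> Cp * s powr p * \<Psi> t"
begin

lemma Psi_nonneg: "0 \<le> t \<Longrightarrow> 0 \<le> \<Psi> t"
  using Psi_pos[of t] Psi_0 by (cases "t = 0") auto

lemma Psi_scale:
  assumes "0 \<le> s" "s \<le> 1" "0 \<le> t"
  shows "\<Psi> (s * t) \<le> s * \<Psi> t"
  using convex_onD[OF Psi_convex, of s 0 t] assms by (simp add: Psi_0)

lemma Psi_scale_up: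
  assumes "1 \<le> c" "0 \<le> t"
  shows "c * \<Psi> t \<le> \<Psi> (c * t)"
  using Psi_scale[of "1 / c" "c * t"] assms by (simp add: field_simps)

lemma Psi_measurable:
  assumes [measurable]: "f \<in> borel_measurable N" and "\<And>x. 0 \<le> f x"
  shows "(\<lambda>x. \<Psi> (f x)) \<in> borel_measurable N"
proof -
  have [measurable]: "(\<lambda>t. \<Psi> (max 0 t)) \<in> borel_measurable borel"
    by (intro borel_measurable_mono monoI Psi_mono) auto
  have "(\<lambda>x. \<Psi> (max 0 (f x))) \<in> borel_measurable N" by measurable
  then show ?thesis using assms(2) by (simp add: max_absorb2)
qed

lemma Psi_surj:
  assumes "0 < y" shows "\<exists>u>0. \<Psi> u = y"
proof -
  define a where "a = min 1 (y / \<Psi> 1)"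
  define b where "b = max 1 (y / \<Psi> 1)"
  have P1: "0 < \<Psi> 1" by (rule Psi_pos) simp
  have a: "0 < a" "a \<le> 1" "a * \<Psi> 1 \<le> y" using P1 assms by (auto simp: a_def min_def field_simps)
  have b: "1 \<le> b" "y \<le> b * \<Psi> 1" using P1 by (auto simp: b_def max_def field_simps)
  have "\<Psi> a \<le> y" using Psi_scale[of a 1] a by simp
  moreover have "y \<le> \<Psi> b" using Psi_scale_up[of b 1] b by simp
  moreover have "continuous_on {0<..} \<Psi>"
    by (rule convex_on_continuous[OF open_greaterThan convex_on_subset[OF Psi_convex]]) auto
  then have "continuous_on {a..b} \<Psi>" by (rule continuous_on_subset) (use a in auto)
  ultimately obtain u where "a \<le> u" "u \<le> b" "\<Psi> u = y"
    using IVT'[of \<Psi> a y b] a b by auto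
  then show ?thesis using a by (intro exI[of _ u]) auto
qed

lemma Psi_growth:
  assumes "1 \<le> u" shows "\<Psi> 1 * u powr p \<le> Cp * \<Psi> u"
proof (cases "u = 1")
  case True then show ?thesis using Cp_ge1 Psi_pos[of 1] by simp
next
  case False
  then have u: "1 < u" using assms by simp
  have "\<Psi> 1 \<le> Cp * (1 / u) powr p * \<Psi> u" using Psi_lower[of u "1 / u"] u by simp
  also have "\<dots> = Cp * \<Psi> u / u powr p" using u by (simp add: powr_divide)
  finally show ?thesis using u by (simp add: field_simps)
qed

text \<open>By the lower type \<open>\<Psi>\<close> grows at least like \<open>u\<^sup>p\<close>, which beats \<open>t u\<close> because \<open>p > 1\<close>.  Thus the
  complementary function is finite and its supremum is not a default value.\<close>

lemma bdd_above_complementary: "bdd_above ((\<lambda>u. t * u - \<Psi> u) ` {0..})"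
proof -
  define T where "T = max 1 \<bar>t\<bar>"
  define c where "c = \<Psi> 1 / Cp"
  have c: "0 < c" using Psi_pos[of 1] Cp_ge1 by (simp add: c_def)
  define U where "U = max 1 ((T / c) powr (1 / (p - 1)))"
  have "t * u - \<Psi> u \<le> T * U" if u: "0 \<le> u" for u
  proof (cases "u \<le> U")
    case True
    have "t * u \<le> T * U" using True u by (intro mult_mono) (auto simp: T_def)
    then show ?thesis using Psi_nonneg[OF u] by simp
  next
    case False
    then have u1: "1 \<le> u" "(T / c) powr (1 / (p - 1)) \<le> u" by (auto simp: U_def)
    have "((T / c) powr (1 / (p - 1))) powr (p - 1) \<le> u powr (p - 1)"
      using u1 p_gt1 by (intro powr_mono2) auto
    moreover have "((T / c) powr (1 / (p - 1))) powr (p - 1) = T / c"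
      using p_gt1 c by (simp add: powr_powr T_def)
    ultimately have "T \<le> c * u powr (p - 1)" using c by (simp add: field_simps)
    then have "T * u \<le> c * u powr (p - 1) * u" using u by (intro mult_right_mono)
    also have "\<dots> = c * u powr p" using u1 by (simp add: powr_diff)
    also have "\<dots> \<le> \<Psi> u" using Psi_growth[OF u1(1)] Cp_ge1 by (simp add: c_def field_simps)
    finally have "T * u \<le> \<Psi> u" .
    moreover have "t * u \<le> T * u" using u by (intro mult_right_mono) (auto simp: T_def)
    moreover have "0 \<le> T * U" by (simp add: T_def U_def)
    ultimately show ?thesis by linarith
  qed
  then show ?thesis by (intro bdd_aboveI2) auto
qed

lemma complementary_upper: "0 \<le> u \<Longrightarrow> t * u - \<Psi> u \<le> complementary \<Psi> t"
  unfolding complementary_def by (rule cSUP_upper[OF _ bdd_above_complementary]) simp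

lemma young_inequality: "0 \<le> u \<Longrightarrow> u * v \<le> \<Psi> u + complementary \<Psi> v"
  using complementary_upper[of u v] by (simp add: mult.commute)

lemma complementary_nonneg: "0 \<le> complementary \<Psi> t"
  using complementary_upper[of 0 t] Psi_0 by simp

lemma complementary_mono: "s \<le> t \<Longrightarrow> complementary \<Psi> s \<le> complementary \<Psi> t"
  unfolding complementary_def[of _ s]
proof (rule cSUP_least)
  fix u :: real assume "s \<le> t" "u \<in> {0..}"
  then have "s * u - \<Psi> u \<le> t * u - \<Psi> u" by (auto intro: mult_right_mono)
  also have "\<dots> \<le> complementary \<Psi> t" using \<open>u \<in> {0..}\<close> by (intro complementary_upper) auto
  finally show "s * u - \<Psi> u \<le> complementary \<Psi> t" .
qed simp

lemma complementary_0: "complementary \<Psi> 0 = 0"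
proof (rule antisym)
  show "complementary \<Psi> 0 \<le> 0" unfolding complementary_def
    by (rule cSUP_least) (auto simp: Psi_nonneg)
qed (rule complementary_nonneg)

lemma complementary_scale:
  assumes "0 \<le> s" "s \<le> 1"
  shows "complementary \<Psi> (s * t) \<le> s * complementary \<Psi> t"
  unfolding complementary_def[of _ "s * t"]
proof (rule cSUP_least)
  fix u :: real assume u: "u \<in> {0..}"
  have "s * \<Psi> u \<le> 1 * \<Psi> u" using assms u by (intro mult_right_mono Psi_nonneg) auto
  then have "s * t * u - \<Psi> u \<le> s * (t * u - \<Psi> u)" by (simp add: algebra_simps)
  also have "\<dots> \<le> s * complementary \<Psi> t" using u assms by (intro mult_left_mono complementary_upper) auto
  finally show "s * t * u - \<Psi> u \<le> s * complementary \<Psi> t" .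
qed simp

lemma complementary_measurable[measurable]: "complementary \<Psi> \<in> borel_measurable borel"
  by (intro borel_measurable_mono monoI complementary_mono)

text \<open>The bound in \<open>dyadic_sum\<close> below: half the lower type constant times the geometric series of ratio
  \<open>2\<^bsup>1 - p\<^esup>\<close>.\<close>

definition dyadic_const :: real where
  "dyadic_const = Cp / 2 * (2 powr (p - 1) / (2 powr (p - 1) - 1))"

lemma two_powr_gt1: "1 < (2::real) powr (p - 1)"
  using p_gt1 powr_less_mono[of 0 "p - 1" 2] by simp

lemma dyadic_const_pos: "0 < dyadic_const"
  using two_powr_gt1 Cp_ge1 by (simp add: dyadic_const_def)

text \<open>If \<open>v > u0\<close>, one of the heights satisfies \<open>2\<^sup>k u0 < v \<le> 2\<^bsup>k+1\<^esup> u0\<close>, and its term alone dominates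
  \<open>\<Psi> v\<close>.  Starting at \<open>u0\<close> instead of zero makes the heights a one-sided sequence.\<close>

lemma dyadic_upper:
  assumes u0: "0 < u0" and v: "0 \<le> v"
  shows "ennreal (\<Psi> v) \<le> ennreal (\<Psi> u0) +
    (\<Sum>k. ennreal (\<Psi> (2 ^ Suc k * u0)) * indicator {2 ^ k * u0 <..} v)"
proof (cases "v \<le> u0")
  case True
  then have "ennreal (\<Psi> v) \<le> ennreal (\<Psi> u0)" using v by (intro ennreal_leI Psi_mono)
  then show ?thesis by (rule order_trans) simp
next
  case False
  define f where "f k = ennreal (\<Psi> (2 ^ Suc k * u0)) * indicator {2 ^ k * u0 <..} v" for k
  obtain n where "v / u0 < 2 ^ n" using real_arch_pow[of 2 "v / u0"] by auto
  then have ex: "v \<le> 2 ^ n * u0" using u0 by (simp add: field_simps)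
  define m where "m = (LEAST n. v \<le> 2 ^ n * u0)"
  have m: "v \<le> 2 ^ m * u0" unfolding m_def by (rule LeastI[of _ n]) (rule ex)
  have "m \<noteq> 0" using m False by (cases "m = 0") auto
  then obtain k where k: "m = Suc k" by (cases m) auto
  have "2 ^ k * u0 < v"
  proof (rule ccontr)
    assume "\<not> 2 ^ k * u0 < v"
    then have "m \<le> k" unfolding m_def by (intro Least_le) auto
    then show False using k by simp
  qed
  then have "ennreal (\<Psi> v) \<le> f k"
    using m v k by (auto simp: f_def intro!: ennreal_leI Psi_mono)
  also have "\<dots> = (\<Sum>i\<in>{k}. f i)" by simp
  also have "\<dots> \<le> (\<Sum>k. f k)" by (rule sum_le_suminf) auto
  finally show ?thesis unfolding f_def[symmetric] by (simp add: add_increasing)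
qed

text \<open>With \<open>t = 2\<^sup>k u0 / (2 u) < 1\<close> the lower type gives \<open>\<Psi>(2\<^bsup>k+1\<^esup> u0) = \<Psi>(t 4 u) \<le> C t\<^sup>p \<Psi>(4 u)\<close>.  The
  division by the height leaves \<open>t\<^bsup>p-1\<^esup>\<close>, a geometric progression cut off at one.\<close>

lemma dyadic_sum:
  assumes u0: "0 < u0" and u: "0 \<le> u"
  shows "(\<Sum>k. ennreal (\<Psi> (2 ^ Suc k * u0) / (2 ^ k * u0)) * (ennreal u * indicator {2 ^ k * u0 / 2 <..} u))
    \<le> ennreal (dyadic_const * \<Psi> (4 * u))"
proof (cases "u = 0")
  case True then show ?thesis by simp
next
  case False
  then have up: "0 < u" using u by simp
  define a where "a = 2 powr (p - 1)"
  define x where "x = (u0 / (2 * u)) powr (p - 1)"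
  have a1: "1 < a" unfolding a_def by (rule two_powr_gt1)
  have tau: "a ^ k * x = (2 ^ k * u0 / (2 * u)) powr (p - 1)" for k
  proof -
    have "a ^ k = (2 ^ k) powr (p - 1)"
      unfolding a_def by (simp add: powr_powr powr_realpow[symmetric] mult.commute)
    then show ?thesis using u0 up by (simp add: x_def powr_mult[symmetric])
  qed
  have less1: "a ^ k * x < 1 \<longleftrightarrow> 2 ^ k * u0 / 2 < u" for k
  proof -
    have "(2 ^ k * u0 / (2 * u)) powr (p - 1) < 1 \<longleftrightarrow> 2 ^ k * u0 / (2 * u) < 1"
      using powr_less_cancel_iff[of _ _ "p - 1"] powr_less_mono2[of "p - 1" "2 ^ k * u0 / (2 * u)" 1]
        ge_one_powr_ge_zero[of "2 ^ k * u0 / (2 * u)" "p - 1"] p_gt1 u0 up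
      by (smt (verit) divide_nonneg_nonneg mult_nonneg_nonneg powr_one_eq_one zero_le_power)
    then show ?thesis unfolding tau using up by (simp add: field_simps)
  qed
  have summand: "\<Psi> (2 ^ Suc k * u0) / (2 ^ k * u0) * u \<le> Cp / 2 * \<Psi> (4 * u) * (a ^ k * x)"
    if k: "2 ^ k * u0 / 2 < u" for k
  proof -
    define t where "t = 2 ^ k * u0 / (2 * u)"
    have t: "0 < t" "t < 1" using k u0 up by (auto simp: t_def field_simps)
    have eq: "2 ^ Suc k * u0 = t * (4 * u)" "u / (2 ^ k * u0) = 1 / (2 * t)"
      using u0 up by (auto simp: t_def field_simps)
    have "\<Psi> (2 ^ Suc k * u0) \<le> Cp * t powr p * \<Psi> (4 * u)"
      unfolding eq using t up by (intro Psi_lower) auto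
    then have "\<Psi> (2 ^ Suc k * u0) * (u / (2 ^ k * u0)) \<le> Cp * t powr p * \<Psi> (4 * u) * (1 / (2 * t))"
      unfolding eq(2) using t by (intro mult_right_mono) auto
    also have "\<dots> = Cp / 2 * \<Psi> (4 * u) * (t powr (p - 1))"
      using t by (simp add: powr_diff)
    finally show ?thesis unfolding tau t_def by simp
  qed
  have part: "(\<Sum>k<n. ennreal (\<Psi> (2 ^ Suc k * u0) / (2 ^ k * u0)) * (ennreal u * indicator {2 ^ k * u0 / 2 <..} u))
      \<le> ennreal (dyadic_const * \<Psi> (4 * u))" for n
  proof -
    have P4: "0 \<le> \<Psi> (4 * u)" using u by (intro Psi_nonneg) simp
    have "(\<Sum>k<n. ennreal (\<Psi> (2 ^ Suc k * u0) / (2 ^ k * u0)) * (ennreal u * indicator {2 ^ k * u0 / 2 <..} u))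
        \<le> (\<Sum>k<n. ennreal (Cp / 2 * \<Psi> (4 * u) * (if a ^ k * x < 1 then a ^ k * x else 0)))"
    proof (rule sum_mono)
      fix k
      show "ennreal (\<Psi> (2 ^ Suc k * u0) / (2 ^ k * u0)) * (ennreal u * indicator {2 ^ k * u0 / 2 <..} u)
        \<le> ennreal (Cp / 2 * \<Psi> (4 * u) * (if a ^ k * x < 1 then a ^ k * x else 0))"
      proof (cases "2 ^ k * u0 / 2 < u")
        case True
        have "0 \<le> \<Psi> (2 ^ Suc k * u0) / (2 ^ k * u0)"
          using u0 by (intro divide_nonneg_nonneg Psi_nonneg) auto
        then show ?thesis using summand[OF True] True less1[of k] u
          by (simp add: ennreal_leI flip: ennreal_mult)
      qed simp
    qed
    also have "\<dots> = ennreal (\<Sum>k<n. Cp / 2 * \<Psi> (4 * u) * (if a ^ k * x < 1 then a ^ k * x else 0))"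
      using P4 Cp_ge1 a1 by (intro sum_ennreal) (auto simp: x_def)
    also have "\<dots> \<le> ennreal (Cp / 2 * \<Psi> (4 * u) * (a / (a - 1)))"
      unfolding sum_distrib_left[symmetric] using P4 Cp_ge1 a1
      by (intro ennreal_leI mult_left_mono truncated_geometric_sum) (auto simp: x_def)
    also have "\<dots> = ennreal (dyadic_const * \<Psi> (4 * u))" by (simp add: dyadic_const_def a_def mult_ac)
    finally show ?thesis .
  qed
  show ?thesis unfolding suminf_eq_SUP by (rule SUP_least) (rule part)
qed

end

locale orlicz_doubling_space = doubling_space M \<rho> K L + convex_orlicz \<Psi> p Cp
  for M :: "'a measure" and \<rho> K L \<Psi> p Cp
begin

definition modular_const :: real where "modular_const = 2 * dilation_const (K * (1 + 2 * K)) * dyadic_const"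

lemma modular_const_pos: "0 < modular_const"
  using dilation_const_ge1[of "K * (1 + 2 * K)"] dyadic_const_pos by (simp add: modular_const_def)

text \<open>Estimate \<open>\<Psi>\<close> of the maximal function by its dyadic heights, the level sets by the truncated weak
  type inequality, and exchange sum and integral.  The argument \<open>4 h\<close> on the right may stay, since a
  block can be rescaled beforehand.  The term with \<open>u0\<close> accounts for small values on \<open>E\<close>; it is
  harmless when \<open>\<Psi> u0\<close> is the value of \<open>\<phi>\<close> at the ball.\<close>

lemma maximal_modular_inequality:
  fixes h :: "'a \<Rightarrow> real"
  assumes [measurable]: "h \<in> borel_measurable M" "E \<in> sets M" and h: "\<And>x. 0 \<le> h x" and u0: "0 < u0"
  shows "(\<integral>\<^sup>+x\<in>E. ennreal (\<Psi> (enn2real (countable_maximal (\<lambda>x. ennreal (h x)) x))) \<partial>M)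
    \<le> ennreal (\<Psi> u0) * emeasure M E + ennreal modular_const * (\<integral>\<^sup>+x. ennreal (\<Psi> (4 * h x)) \<partial>M)"
proof -
  define H where "H = countable_maximal (\<lambda>x. ennreal (h x))"
  have [measurable]: "H \<in> borel_measurable M" unfolding H_def by measurable
  define D where "D = dilation_const (K * (1 + 2 * K))"
  have D1: "1 \<le> D" unfolding D_def by (rule dilation_const_ge1)
  define F where "F k = {x \<in> space M. ennreal (2 ^ k * u0) < H x}" for k :: nat
  have [measurable]: "F k \<in> sets M" for k unfolding F_def by measurable
  define w where "w k x = ennreal (h x) * indicator {2 ^ k * u0 / 2 <..} (h x)" for k x
  have [measurable]: "w k \<in> borel_measurable M" for k unfolding w_def by measurable
  have Psi_k: "0 \<le> \<Psi> (2 ^ Suc k * u0)" for k using u0 by (intro Psi_nonneg) simp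
  have level: "ennreal (\<Psi> (2 ^ Suc k * u0)) * emeasure M (F k)
     \<le> ennreal (2 * D) * (ennreal (\<Psi> (2 ^ Suc k * u0) / (2 ^ k * u0)) * (\<integral>\<^sup>+x. w k x \<partial>M))" for k
  proof -
    define s where "s = 2 ^ k * u0"
    have s: "0 < s" using u0 by (simp add: s_def)
    have "ennreal s * emeasure M (F k) \<le> ennreal (2 * D) *
        (\<integral>\<^sup>+x. ennreal (h x) * indicator {x \<in> space M. ennreal (s / 2) < ennreal (h x)} x \<partial>M)"
      unfolding F_def H_def D_def s_def[symmetric] using s by (intro weak_type_truncated) auto
    also have "(\<integral>\<^sup>+x. ennreal (h x) * indicator {x \<in> space M. ennreal (s / 2) < ennreal (h x)} x \<partial>M)
       = (\<integral>\<^sup>+x. w k x \<partial>M)"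
      using s by (intro nn_integral_cong) (auto simp: w_def s_def ennreal_less_iff split: split_indicator)
    finally have *: "ennreal s * emeasure M (F k) \<le> ennreal (2 * D) * (\<integral>\<^sup>+x. w k x \<partial>M)" .
    have "ennreal (\<Psi> (2 ^ Suc k * u0)) * emeasure M (F k)
       = ennreal (\<Psi> (2 ^ Suc k * u0) / s) * (ennreal s * emeasure M (F k))"
      using s Psi_k by (simp add: mult.assoc[symmetric] ennreal_mult[symmetric])
    also have "\<dots> \<le> ennreal (\<Psi> (2 ^ Suc k * u0) / s) * (ennreal (2 * D) * (\<integral>\<^sup>+x. w k x \<partial>M))"
      by (intro mult_left_mono *) auto
    finally show ?thesis by (simp add: s_def mult_ac)
  qed
  have main: "(\<integral>\<^sup>+x\<in>E. ennreal (\<Psi> (enn2real (H x))) \<partial>M)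
     \<le> (\<integral>\<^sup>+x. ennreal (\<Psi> u0) * indicator E x + (\<Sum>k. ennreal (\<Psi> (2 ^ Suc k * u0)) * indicator (F k) x) \<partial>M)"
  proof (rule nn_integral_mono)
    fix x assume x: "x \<in> space M"
    have F: "x \<in> F k" if "2 ^ k * u0 < enn2real (H x)" for k
    proof -
      have "ennreal (2 ^ k * u0) < ennreal (enn2real (H x))"
        using that less_trans[OF _ that, of 0] u0 by (intro ennreal_lessI) auto
      also have "\<dots> \<le> H x" by (cases "H x") auto
      finally show ?thesis using x by (simp add: F_def)
    qed
    have "ennreal (\<Psi> (enn2real (H x))) \<le> ennreal (\<Psi> u0) +
      (\<Sum>k. ennreal (\<Psi> (2 ^ Suc k * u0)) * indicator {2 ^ k * u0 <..} (enn2real (H x)))"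
      using u0 by (intro dyadic_upper) auto
    also have "\<dots> \<le> ennreal (\<Psi> u0) + (\<Sum>k. ennreal (\<Psi> (2 ^ Suc k * u0)) * indicator (F k) x)"
      using F by (intro add_left_mono suminf_le) (auto split: split_indicator)
    finally show "ennreal (\<Psi> (enn2real (H x))) * indicator E x \<le> ennreal (\<Psi> u0) * indicator E x +
        (\<Sum>k. ennreal (\<Psi> (2 ^ Suc k * u0)) * indicator (F k) x)"
      by (auto split: split_indicator)
  qed
  have split: "(\<integral>\<^sup>+x. ennreal (\<Psi> u0) * indicator E x + (\<Sum>k. ennreal (\<Psi> (2 ^ Suc k * u0)) * indicator (F k) x) \<partial>M)
      = ennreal (\<Psi> u0) * emeasure M E + (\<Sum>k. ennreal (\<Psi> (2 ^ Suc k * u0)) * emeasure M (F k))"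
    by (simp add: nn_integral_add nn_integral_suminf nn_integral_cmult_indicator)
  have "(\<Sum>k. ennreal (\<Psi> (2 ^ Suc k * u0)) * emeasure M (F k)) \<le>
     (\<Sum>k. ennreal (2 * D) * (ennreal (\<Psi> (2 ^ Suc k * u0) / (2 ^ k * u0)) * (\<integral>\<^sup>+x. w k x \<partial>M)))"
    by (intro suminf_le level) auto
  also have "(\<Sum>k. ennreal (2 * D) * (ennreal (\<Psi> (2 ^ Suc k * u0) / (2 ^ k * u0)) * (\<integral>\<^sup>+x. w k x \<partial>M)))
     = ennreal (2 * D) * (\<integral>\<^sup>+x. (\<Sum>k. ennreal (\<Psi> (2 ^ Suc k * u0) / (2 ^ k * u0)) * w k x) \<partial>M)"
    by (simp add: nn_integral_suminf nn_integral_cmult)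
  also have "\<dots> \<le> ennreal (2 * D) * (\<integral>\<^sup>+x. ennreal (dyadic_const * \<Psi> (4 * h x)) \<partial>M)"
    unfolding w_def using u0 h by (intro mult_left_mono nn_integral_mono dyadic_sum) auto
  also have "(\<integral>\<^sup>+x. ennreal (dyadic_const * \<Psi> (4 * h x)) \<partial>M) = ennreal dyadic_const * (\<integral>\<^sup>+x. ennreal (\<Psi> (4 * h x)) \<partial>M)"
    using dyadic_const_pos h Psi_measurable[of "\<lambda>x. 4 * h x" M]
    by (simp add: ennreal_mult' nn_integral_cmult)
  also have "ennreal (2 * D) * (ennreal dyadic_const * (\<integral>\<^sup>+x. ennreal (\<Psi> (4 * h x)) \<partial>M))
      = ennreal modular_const * (\<integral>\<^sup>+x. ennreal (\<Psi> (4 * h x)) \<partial>M)"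
    using D1 dyadic_const_pos unfolding modular_const_def D_def by (simp add: mult.assoc[symmetric] ennreal_mult)
  finally have "(\<Sum>k. ennreal (\<Psi> (2 ^ Suc k * u0)) * emeasure M (F k))
      \<le> ennreal modular_const * (\<integral>\<^sup>+x. ennreal (\<Psi> (4 * h x)) \<partial>M)" .
  then show ?thesis using main unfolding split H_def by (meson add_left_mono order_trans)
qed

end

section \<open>Blocks and Orlicz--Morrey functions\<close>

locale block_setting = orlicz_doubling_space M \<rho> K L \<Psi> p Cp
  for M :: "'a measure" and \<rho> K L \<Psi> p Cp +
  fixes \<phi> :: "'a \<Rightarrow> real \<Rightarrow> real" and C1 C2 C3 :: real
  assumes phi_pos: "\<And>x r. x \<in> space M \<Longrightarrow> 0 < r \<Longrightarrow> 0 < \<phi> x r"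
    and C1_ge1: "1 \<le> C1"
    and phi_almost_dec: "\<And>x r s. x \<in> space M \<Longrightarrow> 0 < r \<Longrightarrow> r \<le> s \<Longrightarrow> \<phi> x s \<le> C1 * \<phi> x r"
    and mass_almost_inc: "\<And>x r s. x \<in> space M \<Longrightarrow> 0 < r \<Longrightarrow> r \<le> s \<Longrightarrow>
           vol x r * \<phi> x r \<le> C1 * (vol x s * \<phi> x s)"
    and C2_ge1: "1 \<le> C2"
    and near: "\<And>x y r. x \<in> space M \<Longrightarrow> y \<in> space M \<Longrightarrow> 0 < r \<Longrightarrow> \<rho> x y \<le> r \<Longrightarrow>
           \<phi> x r \<le> C2 * \<phi> y r"
    and C3_pos: "0 < C3"
    and phi_integral: "\<And>x r. x \<in> space M \<Longrightarrow> 0 < r \<Longrightarrow>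
           (\<integral>\<^sup>+t\<in>{r<..}. ennreal (\<phi> x t / t) \<partial>lborel) \<le> ennreal (C3 * \<phi> x r)"
begin

abbreviation mass :: "'a \<Rightarrow> real \<Rightarrow> real" where "mass x r \<equiv> vol x r * \<phi> x r"

lemma mass_pos: "x \<in> space M \<Longrightarrow> 0 < r \<Longrightarrow> 0 < mass x r"
  using vol_pos phi_pos by simp

text \<open>The ratio of consecutive radii in the decomposition of the maximal function.  The exponential makes
  \<open>\<phi>\<close> halve at each step; the summand \<open>2 K\<close> keeps the annuli away from the support of the block.\<close>

definition dilation :: real where "dilation = exp (2 * C1 * C3) + 2 * K"

lemma dilation_ge: "2 * K \<le> dilation" "1 < dilation" "2 * C1 * C3 \<le> ln dilation"
proof -
  show "2 * K \<le> dilation" by (simp add: dilation_def)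
  then show "1 < dilation" using K_ge1 by simp
  have "exp (2 * C1 * C3) \<le> dilation" using K_ge1 by (simp add: dilation_def)
  then show "2 * C1 * C3 \<le> ln dilation" using \<open>1 < dilation\<close> by (simp add: ln_ge_iff)
qed

text \<open>On \<open>(r, \<kappa> r)\<close> the function \<open>\<phi> x\<close> is at least \<open>\<phi> x (\<kappa> r) / C1\<close>, so the integral of \<open>\<phi> x t / t\<close> there
  is at least \<open>\<phi> x (\<kappa> r) ln \<kappa> / C1\<close>, while the integral condition bounds it by \<open>C3 \<phi> x r\<close>.\<close>

lemma phi_halving:
  assumes x: "x \<in> space M" and r: "0 < r"
  shows "\<phi> x (dilation * r) \<le> \<phi> x r / 2"
proof -
  define c where "c = \<phi> x (dilation * r) / C1"
  have kr: "r \<le> dilation * r" "0 < dilation * r" using dilation_ge(2) r by auto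
  have c: "0 < c" using phi_pos[OF x kr(2)] C1_ge1 by (simp add: c_def)
  have "ennreal (c * ln (dilation * r) - c * ln r) = (\<integral>\<^sup>+t. ennreal (c / t) * indicator {r..dilation * r} t \<partial>lborel)"
    using r c kr
    by (subst nn_integral_FTC_Icc[where F = "\<lambda>t. c * ln t"])
       (auto intro!: derivative_eq_intros simp: ennreal_minus)
  also have "\<dots> \<le> (\<integral>\<^sup>+t\<in>{r<..}. ennreal (\<phi> x t / t) \<partial>lborel)"
  proof (rule nn_integral_mono_AE, use AE_lborel_singleton[of r] in eventually_elim)
    fix t assume t: "t \<noteq> r"
    show "ennreal (c / t) * indicator {r..dilation * r} t \<le> ennreal (\<phi> x t / t) * indicator {r<..} t"
    proof (cases "t \<in> {r..dilation * r}")
      case True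
      then have tt: "r < t" "t \<le> dilation * r" using t by auto
      then have "c \<le> \<phi> x t"
        using phi_almost_dec[OF x, of t "dilation * r"] r C1_ge1 by (simp add: c_def field_simps)
      then show ?thesis using tt r by (auto intro!: ennreal_leI divide_right_mono)
    qed simp
  qed
  also have "\<dots> \<le> ennreal (C3 * \<phi> x r)" by (rule phi_integral[OF x r])
  finally have "c * ln (dilation * r) - c * ln r \<le> C3 * \<phi> x r"
    using C3_pos phi_pos[OF x r] by (simp add: ennreal_le_iff)
  moreover have "c * ln (dilation * r) - c * ln r = c * ln dilation"
    using dilation_ge(2) r by (simp add: ln_mult algebra_simps)
  moreover have "c * (2 * C1 * C3) \<le> c * ln dilation" using c dilation_ge(3) by (intro mult_left_mono) auto
  ultimately have "c * (2 * C1 * C3) \<le> C3 * \<phi> x r" by linarith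
  then show ?thesis using C1_ge1 C3_pos by (simp add: c_def)
qed

lemma phi_decay:
  assumes x: "x \<in> space M" and r: "0 < r"
  shows "\<phi> x (dilation ^ n * r) \<le> \<phi> x r / 2 ^ n"
proof (induction n)
  case (Suc n)
  have "\<phi> x (dilation * (dilation ^ n * r)) \<le> \<phi> x (dilation ^ n * r) / 2"
    using r dilation_ge(2) by (intro phi_halving[OF x]) auto
  also have "\<dots> \<le> (\<phi> x r / 2 ^ n) / 2" using Suc by (intro divide_right_mono) auto
  finally show ?case by (simp add: mult.assoc)
qed simp

text \<open>Nonnegative blocks described by an integral bound instead of a Luxemburg norm.  As \<open>\<Psi> 0 = 0\<close>,
  the integral over the whole space is the integral over the ball.\<close>

definition modular_block :: "'a \<Rightarrow> real \<Rightarrow> ('a \<Rightarrow> real) \<Rightarrow> bool" where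
  "modular_block x r \<beta> \<longleftrightarrow> x \<in> space M \<and> 0 < r \<and> \<beta> \<in> borel_measurable M \<and> (\<forall>y. 0 \<le> \<beta> y) \<and>
     (\<forall>y\<in>space M. \<beta> y \<noteq> 0 \<longrightarrow> y \<in> B x r) \<and>
     (\<integral>\<^sup>+y. ennreal (\<Psi> (mass x r * \<beta> y)) \<partial>M) \<le> ennreal (mass x r)"

lemma average_le_iff:
  assumes "x \<in> space M" "0 < r"
  shows "I / emeasure M (B x r) \<le> ennreal (\<phi> x r) \<longleftrightarrow> I \<le> ennreal (mass x r)"
proof -
  have v: "0 < vol x r" "0 < \<phi> x r" using vol_pos phi_pos assms by auto
  show ?thesis unfolding emeasure_B[OF assms]
  proof (cases I)
    case (real a)
    then show "(I / ennreal (vol x r) \<le> ennreal (\<phi> x r)) = (I \<le> ennreal (mass x r))"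
      using v by (simp add: divide_ennreal field_simps)
  next
    case top
    then show "(I / ennreal (vol x r) \<le> ennreal (\<phi> x r)) = (I \<le> ennreal (mass x r))"
      using v by (simp add: ennreal_top_divide top_unique)
  qed
qed

text \<open>The factor two absorbs the fact that the infimum in the norm need not be known to be attained.\<close>

lemma modular_block_of_orlicz_block:
  assumes "orlicz_block M \<rho> \<phi> \<Psi> b"
  shows "b \<in> borel_measurable M" "\<exists>x r. modular_block x r (\<lambda>y. norm (b y) / 2)"
proof -
  show bm[measurable]: "b \<in> borel_measurable M"
    using assms by (simp add: orlicz_block_def orlicz_space_def)
  obtain x r where x: "x \<in> space M" "0 < r" and supp: "{y \<in> space M. b y \<noteq> 0} \<subseteq> B x r"
    and bn: "ball_norm M \<rho> \<phi> \<Psi> x r b \<le> ennreal (1 / mass x r)"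
    using assms unfolding orlicz_block_def by blast
  have m: "0 < mass x r" by (rule mass_pos[OF x])
  have "ball_norm M \<rho> \<phi> \<Psi> x r b < ennreal (2 / mass x r)"
    using bn m by (rule_tac order_le_less_trans) (auto intro!: ennreal_lessI divide_strict_right_mono)
  then obtain l where l: "0 < l" "ennreal l < ennreal (2 / mass x r)"
    "(\<integral>\<^sup>+y\<in>B x r. ennreal (\<Psi> (norm (b y) / l)) \<partial>M) / emeasure M (B x r) \<le> ennreal (\<phi> x r)"
    unfolding ball_norm_def Inf_less_iff by blast
  have l2: "l < 2 / mass x r" using l by (simp add: ennreal_less_iff)
  then have ml: "mass x r / 2 \<le> 1 / l" using l m by (simp add: field_simps)
  have "(\<integral>\<^sup>+y. ennreal (\<Psi> (mass x r * (norm (b y) / 2))) \<partial>M)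
      \<le> (\<integral>\<^sup>+y\<in>B x r. ennreal (\<Psi> (norm (b y) / l)) \<partial>M)"
  proof (rule nn_integral_mono)
    fix y assume y: "y \<in> space M"
    show "ennreal (\<Psi> (mass x r * (norm (b y) / 2))) \<le> ennreal (\<Psi> (norm (b y) / l)) * indicator (B x r) y"
    proof (cases "b y = 0")
      case False
      have "mass x r * (norm (b y) / 2) \<le> norm (b y) / l"
        using mult_right_mono[OF ml, of "norm (b y)"] by simp
      then have "\<Psi> (mass x r * (norm (b y) / 2)) \<le> \<Psi> (norm (b y) / l)"
        using m by (intro Psi_mono) auto
      moreover have "y \<in> B x r" using False supp y by auto
      ultimately show ?thesis by (simp add: ennreal_leI)
    qed (simp add: Psi_0)
  qed
  also have "\<dots> \<le> ennreal (mass x r)" using l(3) by (simp add: average_le_iff[OF x])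
  finally have "modular_block x r (\<lambda>y. norm (b y) / 2)"
    using x supp by (auto simp: modular_block_def)
  then show "\<exists>x r. modular_block x r (\<lambda>y. norm (b y) / 2)" by blast
qed

lemma orlicz_block_of_modular_block:
  fixes b :: "'a \<Rightarrow> 'b::real_normed_vector"
  assumes mb: "modular_block x r \<beta>" and [measurable]: "b \<in> borel_measurable M"
    and le: "AE y in M. norm (b y) \<le> \<beta> y" and supp: "\<And>y. y \<in> space M \<Longrightarrow> \<beta> y = 0 \<Longrightarrow> b y = 0"
  shows "orlicz_block M \<rho> \<phi> \<Psi> b"
proof -
  have x: "x \<in> space M" "0 < r" and [measurable]: "\<beta> \<in> borel_measurable M" and b0: "\<And>y. 0 \<le> \<beta> y"
    and \<beta>supp: "\<And>y. y \<in> space M \<Longrightarrow> \<beta> y \<noteq> 0 \<Longrightarrow> y \<in> B x r"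
    and int: "(\<integral>\<^sup>+y. ennreal (\<Psi> (mass x r * \<beta> y)) \<partial>M) \<le> ennreal (mass x r)"
    using mb by (auto simp: modular_block_def)
  define A where "A = mass x r"
  have A: "0 < A" unfolding A_def by (rule mass_pos[OF x])
  have intb: "(\<integral>\<^sup>+y. ennreal (\<Psi> (A * norm (b y))) \<partial>M) \<le> ennreal A"
  proof -
    have "(\<integral>\<^sup>+y. ennreal (\<Psi> (A * norm (b y))) \<partial>M) \<le> (\<integral>\<^sup>+y. ennreal (\<Psi> (A * \<beta> y)) \<partial>M)"
      by (rule nn_integral_mono_AE, use le in eventually_elim)
         (use A in \<open>auto intro!: ennreal_leI Psi_mono mult_left_mono\<close>)
    then show ?thesis using int by (simp add: A_def)
  qed
  have "orlicz_norm M \<Psi> b < \<infinity>"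
  proof -
    \<comment> \<open>Dividing by \<open>max 1 A\<close> brings the modular below one, by convexity.\<close>
    define a where "a = max 1 A"
    have a: "1 \<le> a" "0 < a" "A \<le> a" using A by (auto simp: a_def)
    have "(\<integral>\<^sup>+y. ennreal (\<Psi> (norm (b y) / (a / A))) \<partial>M) \<le> (\<integral>\<^sup>+y. ennreal (1 / a) * ennreal (\<Psi> (A * norm (b y))) \<partial>M)"
    proof (rule nn_integral_mono)
      fix y
      have "\<Psi> (norm (b y) / (a / A)) = \<Psi> (1 / a * (A * norm (b y)))" by (simp add: mult_ac)
      also have "\<dots> \<le> 1 / a * \<Psi> (A * norm (b y))" using a A by (intro Psi_scale) auto
      finally show "ennreal (\<Psi> (norm (b y) / (a / A))) \<le> ennreal (1 / a) * ennreal (\<Psi> (A * norm (b y)))"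
        using a A by (subst ennreal_mult[symmetric]) (auto intro!: ennreal_leI Psi_nonneg)
    qed
    also have "\<dots> = ennreal (1 / a) * (\<integral>\<^sup>+y. ennreal (\<Psi> (A * norm (b y))) \<partial>M)"
      using A Psi_measurable[of "\<lambda>y. A * norm (b y)" M] by (intro nn_integral_cmult) auto
    also have "\<dots> \<le> ennreal (1 / a) * ennreal A" by (intro mult_left_mono intb) auto
    also have "\<dots> \<le> 1" using a A by (simp add: ennreal_le_1 flip: ennreal_mult)
    finally have "orlicz_norm M \<Psi> b \<le> ennreal (a / A)"
      unfolding orlicz_norm_def using a A by (intro Inf_lower) auto
    then show ?thesis by (rule order_le_less_trans) simp
  qed
  moreover have "ball_norm M \<rho> \<phi> \<Psi> x r b \<le> ennreal (1 / A)"
  proof -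
    have "(\<integral>\<^sup>+y\<in>B x r. ennreal (\<Psi> (norm (b y) / (1 / A))) \<partial>M) \<le> (\<integral>\<^sup>+y. ennreal (\<Psi> (A * norm (b y))) \<partial>M)"
      by (intro nn_integral_mono) (auto split: split_indicator simp: mult.commute)
    also note intb
    finally have "(\<integral>\<^sup>+y\<in>B x r. ennreal (\<Psi> (norm (b y) / (1 / A))) \<partial>M) / emeasure M (B x r) \<le> ennreal (\<phi> x r)"
      unfolding average_le_iff[OF x] A_def .
    then show ?thesis unfolding ball_norm_def using A by (intro Inf_lower) auto
  qed
  moreover have "{y \<in> space M. b y \<noteq> 0} \<subseteq> B x r" using supp \<beta>supp by blast
  ultimately show ?thesis unfolding orlicz_block_def orlicz_space_def A_def using x by auto
qed

lemma modular_of_morrey_norm: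
  assumes x: "x \<in> space M" "0 < r" and N: "0 < N" "morrey_norm M \<rho> \<phi> (complementary \<Psi>) g < ennreal N"
  shows "(\<integral>\<^sup>+y\<in>B x r. ennreal (complementary \<Psi> (norm (g y) / N)) \<partial>M) \<le> ennreal (mass x r)"
proof -
  have "ball_norm M \<rho> \<phi> (complementary \<Psi>) x r g \<le> morrey_norm M \<rho> \<phi> (complementary \<Psi>) g"
    unfolding morrey_norm_def by (rule SUP_upper2[of "(x, r)"]) (use x in auto)
  then have "ball_norm M \<rho> \<phi> (complementary \<Psi>) x r g < ennreal N" using N by simp
  then obtain l where l: "0 < l" "ennreal l < ennreal N"
    "(\<integral>\<^sup>+y\<in>B x r. ennreal (complementary \<Psi> (norm (g y) / l)) \<partial>M) / emeasure M (B x r) \<le> ennreal (\<phi> x r)"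
    unfolding ball_norm_def Inf_less_iff by blast
  have lN: "l < N" using l by (simp add: ennreal_less_iff)
  have "(\<integral>\<^sup>+y\<in>B x r. ennreal (complementary \<Psi> (norm (g y) / N)) \<partial>M)
      \<le> (\<integral>\<^sup>+y\<in>B x r. ennreal (complementary \<Psi> (norm (g y) / l)) \<partial>M)"
    using l(1) lN by (intro nn_integral_mono mult_right_mono ennreal_leI complementary_mono divide_left_mono) auto
  also have "\<dots> \<le> ennreal (mass x r)" using l(3) by (simp add: average_le_iff[OF x])
  finally show ?thesis .
qed

text \<open>Young's inequality for \<open>A \<beta>\<close> and \<open>|g| / N\<close>, integrated over the ball of the block: both modulars
  are at most \<open>A\<close>, once \<open>N\<close> exceeds the Orlicz--Morrey norm of \<open>g\<close>.\<close>

lemma block_pairing: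
  assumes mb: "modular_block x r \<beta>" and [measurable]: "g \<in> borel_measurable M"
  shows "(\<integral>\<^sup>+y. ennreal (\<beta> y) * ennreal (norm (g y)) \<partial>M) \<le> 2 * morrey_norm M \<rho> \<phi> (complementary \<Psi>) g"
proof (rule ennreal_le_epsilon)
  fix e :: real assume e: "0 < e" and fin: "2 * morrey_norm M \<rho> \<phi> (complementary \<Psi>) g < top"
  have x: "x \<in> space M" "0 < r" and [measurable]: "\<beta> \<in> borel_measurable M" and b0: "\<And>y. 0 \<le> \<beta> y"
    and supp: "\<And>y. y \<in> space M \<Longrightarrow> \<beta> y \<noteq> 0 \<Longrightarrow> y \<in> B x r"
    and int: "(\<integral>\<^sup>+y. ennreal (\<Psi> (mass x r * \<beta> y)) \<partial>M) \<le> ennreal (mass x r)"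
    using mb by (auto simp: modular_block_def)
  have [measurable]: "B x r \<in> sets M" using x by (rule ball_sets)
  define A where "A = mass x r"
  have A: "0 < A" unfolding A_def by (rule mass_pos[OF x])
  obtain m where m: "morrey_norm M \<rho> \<phi> (complementary \<Psi>) g = ennreal m" "0 \<le> m"
    using fin by (cases "morrey_norm M \<rho> \<phi> (complementary \<Psi>) g") (auto simp: ennreal_mult_eq_top_iff)
  define N where "N = m + e / 2"
  have N: "0 < N" "morrey_norm M \<rho> \<phi> (complementary \<Psi>) g < ennreal N"
    using m e by (auto simp: N_def intro!: ennreal_lessI)
  have "(\<integral>\<^sup>+y. ennreal (A / N) * (ennreal (\<beta> y) * ennreal (norm (g y))) \<partial>M)
     \<le> (\<integral>\<^sup>+y. ennreal (\<Psi> (A * \<beta> y)) + ennreal (complementary \<Psi> (norm (g y) / N)) * indicator (B x r) y \<partial>M)"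
  proof (rule nn_integral_mono)
    fix y assume y: "y \<in> space M"
    show "ennreal (A / N) * (ennreal (\<beta> y) * ennreal (norm (g y)))
       \<le> ennreal (\<Psi> (A * \<beta> y)) + ennreal (complementary \<Psi> (norm (g y) / N)) * indicator (B x r) y"
    proof (cases "\<beta> y = 0")
      case False
      have "A / N * (\<beta> y * norm (g y)) = (A * \<beta> y) * (norm (g y) / N)" by simp
      also have "\<dots> \<le> \<Psi> (A * \<beta> y) + complementary \<Psi> (norm (g y) / N)"
        using A b0 by (intro young_inequality) auto
      finally have "ennreal (A / N * (\<beta> y * norm (g y)))
          \<le> ennreal (\<Psi> (A * \<beta> y)) + ennreal (complementary \<Psi> (norm (g y) / N))"
        using A b0 N by (subst ennreal_plus[symmetric]) (auto intro!: ennreal_leI Psi_nonneg complementary_nonneg)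
      then show ?thesis using A N b0 supp[OF y False] by (simp add: ennreal_mult[symmetric])
    qed simp
  qed
  also have "\<dots> = (\<integral>\<^sup>+y. ennreal (\<Psi> (A * \<beta> y)) \<partial>M) + (\<integral>\<^sup>+y\<in>B x r. ennreal (complementary \<Psi> (norm (g y) / N)) \<partial>M)"
    using A b0 Psi_measurable[of "\<lambda>y. A * \<beta> y" M] by (intro nn_integral_add) auto
  also have "\<dots> \<le> ennreal A + ennreal A"
    unfolding A_def by (intro add_mono int modular_of_morrey_norm x N)
  finally have "ennreal (A / N) * (\<integral>\<^sup>+y. ennreal (\<beta> y) * ennreal (norm (g y)) \<partial>M) \<le> ennreal (2 * A)"
    using A by (simp add: nn_integral_cmult flip: ennreal_plus)
  then have "ennreal (N / A) * (ennreal (A / N) * (\<integral>\<^sup>+y. ennreal (\<beta> y) * ennreal (norm (g y)) \<partial>M))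
     \<le> ennreal (N / A) * ennreal (2 * A)" by (intro mult_left_mono) auto
  also have "ennreal (N / A) * ennreal (2 * A) = ennreal (2 * N)"
    using A N by (subst ennreal_mult[symmetric]) auto
  also have "\<dots> = ennreal (2 * m) + ennreal e"
    using m e by (simp add: N_def flip: ennreal_plus)
  also have "\<dots> = 2 * morrey_norm M \<rho> \<phi> (complementary \<Psi>) g + ennreal e"
    using m by (simp add: ennreal_mult)
  also have "ennreal (N / A) * (ennreal (A / N) * (\<integral>\<^sup>+y. ennreal (\<beta> y) * ennreal (norm (g y)) \<partial>M))
     = (\<integral>\<^sup>+y. ennreal (\<beta> y) * ennreal (norm (g y)) \<partial>M)"
    using A N by (simp add: mult.assoc[symmetric] flip: ennreal_mult)
  finally show "(\<integral>\<^sup>+y. ennreal (\<beta> y) * ennreal (norm (g y)) \<partial>M)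
      \<le> 2 * morrey_norm M \<rho> \<phi> (complementary \<Psi>) g + ennreal e" .
qed

section \<open>Local integrability and series of blocks\<close>

text \<open>Only intersecting balls matter.  If \<open>r \<le> R\<close>, then \<open>\<phi> x r\<close> is bounded below because \<open>\<phi>\<close>
  almost decreases in the radius and is comparable at \<open>x\<close> and \<open>x0\<close>.  If \<open>r > R\<close>, then \<open>mass x r\<close> is comparable to a mass at \<open>x0\<close> with a
  radius greater than \<open>R\<close>, and mass almost increases.\<close>

lemma mass_dominates_ball:
  assumes x0: "x0 \<in> space M" and R: "0 < R"
  shows "\<exists>\<delta>>0. \<forall>x\<in>space M. \<forall>r>0. \<delta> * measure M (B x r \<inter> B x0 R) \<le> mass x r"
proof -
  \<comment> \<open>Bounds the distance of the centres of two intersecting balls of radius at most \<open>R\<close>.\<close>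
  define R' where "R' = 2 * K * R"
  have R': "R \<le> R'" "0 < R'" using K_ge1 R by (auto simp: R'_def)
  define D where "D = dilation_const (4 * K\<^sup>2)"
  define D' where "D' = dilation_const (2 * K)"
  have D1: "1 \<le> D" unfolding D_def by (rule dilation_const_ge1)
  define d1 where "d1 = \<phi> x0 R' / (C2 * C1)"
  define d2 where "d2 = \<phi> x0 R / (C1 * C2 * C1 * D)"
  have d: "0 < d1" "0 < d2" using phi_pos x0 R R' C1_ge1 C2_ge1 D1 by (auto simp: d1_def d2_def)
  have "min d1 d2 * measure M (B x r \<inter> B x0 R) \<le> mass x r" if x: "x \<in> space M" and r: "0 < r" for x r
  proof (cases "B x r \<inter> B x0 R = {}")
    case True then show ?thesis using mass_pos[OF x r] by simp
  next
    case False
    then obtain z where z: "z \<in> space M" "\<rho> x z < r" "\<rho> x0 z < R" by (auto simp: mem_B)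
    have fm: "B x r \<in> fmeasurable M" "B x0 R \<in> fmeasurable M" "B x r \<inter> B x0 R \<in> sets M"
      using ball_sets ball_emeasure_fin x r x0 R by (auto simp: fmeasurable_def)
    have "\<rho> x x0 \<le> K * (\<rho> x z + \<rho> z x0)" using x z x0 by (intro rho_triangle)
    also have "\<dots> \<le> K * (r + R)"
      using z rho_sym[of z x0] x0 K_ge1 by (intro mult_left_mono add_mono) auto
    finally have dist: "\<rho> x x0 \<le> K * (r + R)" .
    show ?thesis
    proof (cases "r \<le> R")
      case True
      then have "r + R \<le> 2 * R" by simp
      then have "K * (r + R) \<le> K * (2 * R)" using K_ge1 by (intro mult_left_mono) auto
      then have dR: "\<rho> x x0 \<le> R'" using dist by (simp add: R'_def)
      have "\<phi> x0 R' \<le> C2 * \<phi> x R'"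
        using dR R' x x0 rho_sym[of x x0] by (intro near) auto
      also have "\<dots> \<le> C2 * (C1 * \<phi> x r)"
        using R' True x r C2_ge1 by (intro mult_left_mono phi_almost_dec) auto
      finally have "d1 \<le> \<phi> x r" using C1_ge1 C2_ge1 by (simp add: d1_def divide_le_eq mult_ac)
      moreover have "measure M (B x r \<inter> B x0 R) \<le> vol x r"
        using fm by (intro measure_mono_fmeasurable) auto
      ultimately have "d1 * measure M (B x r \<inter> B x0 R) \<le> \<phi> x r * vol x r"
        using phi_pos[OF x r] by (intro mult_mono) auto
      moreover have "min d1 d2 * measure M (B x r \<inter> B x0 R) \<le> d1 * measure M (B x r \<inter> B x0 R)"
        by (intro mult_right_mono) auto
      ultimately show ?thesis by (simp add: mult.commute)
    next
      case False
      define S where "S = 2 * K * r"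
      have S: "r \<le> S" "R \<le> S" "0 < S" using K_ge1 r False by (auto simp: S_def intro: order_trans[of _ r])
      have "r + R \<le> 2 * r" using False by simp
      then have "K * (r + R) \<le> K * (2 * r)" using K_ge1 by (intro mult_left_mono) auto
      then have dS: "\<rho> x x0 \<le> S" using dist by (simp add: S_def)
      have "mass x0 R \<le> C1 * mass x0 S" using S x0 R by (intro mass_almost_inc) auto
      also have "mass x0 S \<le> (D * vol x r) * (C2 * (C1 * \<phi> x r))"
      proof (rule mult_mono)
        have "K * (\<rho> x x0 + S) \<le> K * (S + S)" using dS K_ge1 by (intro mult_left_mono) auto
        also have "\<dots> = 4 * K\<^sup>2 * r" by (simp add: S_def power2_eq_square)
        finally show "vol x0 S \<le> D * vol x r"
          unfolding D_def using x x0 r S K_ge1 by (intro vol_compare) auto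
        have "\<phi> x0 S \<le> C2 * \<phi> x S" using dS S x x0 rho_sym[of x x0] by (intro near) auto
        also have "\<dots> \<le> C2 * (C1 * \<phi> x r)"
          using S x r C2_ge1 by (intro mult_left_mono phi_almost_dec) auto
        finally show "\<phi> x0 S \<le> C2 * (C1 * \<phi> x r)" .
        show "0 \<le> D * vol x r" using D1 by simp
        show "0 \<le> \<phi> x0 S" using phi_pos[OF x0 S(3)] by simp
      qed
      finally have "mass x0 R \<le> C1 * ((D * vol x r) * (C2 * (C1 * \<phi> x r)))" using C1_ge1 by simp
      then have "d2 * vol x0 R \<le> mass x r"
        using C1_ge1 C2_ge1 D1 by (simp add: d2_def divide_le_eq mult_ac)
      moreover have "measure M (B x r \<inter> B x0 R) \<le> vol x0 R"
        using fm by (intro measure_mono_fmeasurable) auto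
      then have "min d1 d2 * measure M (B x r \<inter> B x0 R) \<le> d2 * vol x0 R"
        using d by (intro mult_mono) auto
      ultimately show ?thesis by simp
    qed
  qed
  then show ?thesis using d by (intro exI[of _ "min d1 d2"]) auto
qed

text \<open>The preceding estimate is exactly the Orlicz--Morrey condition for a small multiple of an indicator,
  as the complementary function is at most linear on \<open>[0, 1]\<close>.  The constant \<open>c\<close> works for all
  subsets \<open>E\<close> of the ball at once.\<close>

lemma test_functions:
  assumes x0: "x0 \<in> space M" and R: "0 < R"
  shows "\<exists>c>0. \<forall>E\<in>sets M. E \<subseteq> B x0 R \<longrightarrow>
    (\<forall>g::'a \<Rightarrow> 'b::real_normed_vector. g \<in> borel_measurable M \<longrightarrow> (\<forall>y. norm (g y) = c * indicator E y) \<longrightarrow>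
      g \<in> morrey_space M \<rho> \<phi> (complementary \<Psi>) \<and> morrey_norm M \<rho> \<phi> (complementary \<Psi>) g \<le> 1)"
proof -
  obtain \<delta> where \<delta>: "0 < \<delta>" "\<And>x r. x \<in> space M \<Longrightarrow> 0 < r \<Longrightarrow> \<delta> * measure M (B x r \<inter> B x0 R) \<le> mass x r"
    using mass_dominates_ball[OF assms] by blast
  define P1 where "P1 = complementary \<Psi> 1"
  have P1: "0 \<le> P1" unfolding P1_def by (rule complementary_nonneg)
  \<comment> \<open>Makes the complementary function at \<open>c\<close> at most \<open>c P1 \<le> \<delta>\<close>.\<close>
  define c where "c = min 1 (\<delta> / (P1 + 1))"
  have c: "0 < c" "c \<le> 1" using \<delta> P1 by (auto simp: c_def)
  have small: "complementary \<Psi> s \<le> s * P1" if "0 \<le> s" "s \<le> 1" for s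
    using complementary_scale[OF that, of 1] by (simp add: P1_def)
  have "c * (P1 + 1) \<le> \<delta> / (P1 + 1) * (P1 + 1)" using P1 by (intro mult_right_mono) (auto simp: c_def)
  then have "c * (P1 + 1) \<le> \<delta>" using P1 by simp
  then have c\<delta>: "c * P1 \<le> \<delta>" using c by (simp add: algebra_simps)
  show ?thesis
  proof (intro exI[of _ c] conjI ballI impI allI)
    show "0 < c" by fact
    fix E and g :: "'a \<Rightarrow> 'b"
    assume E[measurable]: "E \<in> sets M" and EB: "E \<subseteq> B x0 R" and g[measurable]: "g \<in> borel_measurable M"
      and ng: "\<forall>y. norm (g y) = c * indicator E y"
    have Efin: "emeasure M E \<noteq> \<infinity>"
      using emeasure_mono[OF EB ball_sets[OF x0 R]] ball_emeasure_fin[OF x0 R] by (auto simp: top_unique)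
    have ball: "ball_norm M \<rho> \<phi> (complementary \<Psi>) x r g \<le> 1" if x: "x \<in> space M" and r: "0 < r" for x r
    proof -
      have [measurable]: "B x r \<in> sets M" "B x0 R \<in> sets M" using ball_sets x r x0 R by auto
      have i_fin: "emeasure M (B x r \<inter> B x0 R) \<noteq> \<infinity>"
        using emeasure_mono[of "B x r \<inter> B x0 R" "B x r" M] ball_emeasure_fin[OF x r] by (auto simp: top_unique)
      have "(\<integral>\<^sup>+y\<in>B x r. ennreal (complementary \<Psi> (norm (g y) / 1)) \<partial>M)
          \<le> (\<integral>\<^sup>+y. ennreal \<delta> * indicator (B x r \<inter> B x0 R) y \<partial>M)"
      proof (rule nn_integral_mono)
        fix y
        show "ennreal (complementary \<Psi> (norm (g y) / 1)) * indicator (B x r) y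
           \<le> ennreal \<delta> * indicator (B x r \<inter> B x0 R) y"
        proof (cases "y \<in> E")
          case True
          have "complementary \<Psi> c \<le> \<delta>" using small[of c] c c\<delta> by simp
          then show ?thesis using True EB ng by (auto intro: ennreal_leI split: split_indicator)
        next
          case False
          then show ?thesis using ng by (simp add: complementary_0)
        qed
      qed
      also have "\<dots> = ennreal (\<delta> * measure M (B x r \<inter> B x0 R))"
        using \<delta>(1) i_fin by (simp add: nn_integral_cmult_indicator emeasure_eq_ennreal_measure ennreal_mult)
      also have "\<dots> \<le> ennreal (mass x r)" by (intro ennreal_leI \<delta>(2) x r)
      finally have "ball_norm M \<rho> \<phi> (complementary \<Psi>) x r g \<le> ennreal 1"
        unfolding ball_norm_def average_le_iff[OF x r, symmetric] by (intro Inf_lower) auto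
      then show ?thesis by simp
    qed
    then show mn: "morrey_norm M \<rho> \<phi> (complementary \<Psi>) g \<le> 1"
      unfolding morrey_norm_def by (intro SUP_least) auto
    have loc: "orlicz_norm M (complementary \<Psi>) (\<lambda>y. indicator A y *\<^sub>R g y) < \<infinity>" for A
    proof -
      define l where "l = 1 + P1 * measure M E"
      have l: "1 \<le> l" using P1 by (simp add: l_def)
      have cl: "0 \<le> c / l" "c / l \<le> 1" using c l by auto
      have "(\<integral>\<^sup>+y. ennreal (complementary \<Psi> (norm (indicator A y *\<^sub>R g y) / l)) \<partial>M)
        \<le> (\<integral>\<^sup>+y. ennreal (c / l * P1) * indicator E y \<partial>M)"
      proof (rule nn_integral_mono)
        fix y
        show "ennreal (complementary \<Psi> (norm (indicator A y *\<^sub>R g y) / l)) \<le> ennreal (c / l * P1) * indicator E y"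
        proof (cases "y \<in> E \<and> y \<in> A")
          case True
          then show ?thesis using ng small[OF cl] by (simp add: ennreal_leI)
        next
          case False
          then have "norm (indicator A y *\<^sub>R g y) = 0" using ng by (auto split: split_indicator)
          then show ?thesis by (simp only: div_0 complementary_0 ennreal_0 zero_le)
        qed
      qed
      also have "\<dots> = ennreal (c / l * P1 * measure M E)"
        unfolding nn_integral_cmult_indicator[OF E] emeasure_eq_ennreal_measure[OF Efin[unfolded infinity_ennreal_def]]
        by (rule ennreal_mult[symmetric, OF mult_nonneg_nonneg[OF cl(1) P1] measure_nonneg])
      also have "\<dots> \<le> ennreal 1"
      proof (rule ennreal_leI)
        have "c * (P1 * measure M E) \<le> 1 * (P1 * measure M E)"
          using c P1 by (intro mult_right_mono) auto
        also have "\<dots> \<le> l" by (simp add: l_def)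
        finally show "c / l * P1 * measure M E \<le> 1" using l by (simp add: field_simps)
      qed
      finally have "orlicz_norm M (complementary \<Psi>) (\<lambda>y. indicator A y *\<^sub>R g y) \<le> ennreal l"
        unfolding orlicz_norm_def using l by (intro Inf_lower) auto
      then show ?thesis by (rule order_le_less_trans) simp
    qed
    show "g \<in> morrey_space M \<rho> \<phi> (complementary \<Psi>)"
      unfolding morrey_space_def orlicz_space_loc_def using mn loc
      by (auto intro!: exI[of _ 1] intro: order_le_less_trans)
  qed
qed

lemma block_local_bound:
  assumes "x0 \<in> space M" "0 < R"
  shows "\<exists>D>0. \<forall>x r \<beta>. modular_block x r \<beta> \<longrightarrow> (\<integral>\<^sup>+y\<in>B x0 R. ennreal (\<beta> y) \<partial>M) \<le> ennreal D"
proof -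
  have [measurable]: "B x0 R \<in> sets M" using assms by (rule ball_sets)
  obtain c where c: "0 < c" and test: "\<And>(g :: 'a \<Rightarrow> real). g \<in> borel_measurable M \<Longrightarrow>
    (\<And>y. norm (g y) = c * indicator (B x0 R) y) \<Longrightarrow> morrey_norm M \<rho> \<phi> (complementary \<Psi>) g \<le> 1"
    using test_functions[OF assms, where 'b = real] \<open>B x0 R \<in> sets M\<close> by blast
  define g where "g y = c * indicator (B x0 R) y" for y
  have [measurable]: "g \<in> borel_measurable M" unfolding g_def by measurable
  have mg: "morrey_norm M \<rho> \<phi> (complementary \<Psi>) g \<le> 1" using c by (intro test) (auto simp: g_def)
  have "(\<integral>\<^sup>+y\<in>B x0 R. ennreal (\<beta> y) \<partial>M) \<le> ennreal (2 / c)" if mb: "modular_block x r \<beta>" for x r \<beta>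
  proof -
    have [measurable]: "\<beta> \<in> borel_measurable M" and b0: "\<And>y. 0 \<le> \<beta> y" using mb by (auto simp: modular_block_def)
    have "(\<integral>\<^sup>+y\<in>B x0 R. ennreal (\<beta> y) \<partial>M) = (\<integral>\<^sup>+y. ennreal (1 / c) * (ennreal (\<beta> y) * ennreal (norm (g y))) \<partial>M)"
      using c b0 by (intro nn_integral_cong)
        (auto simp: g_def split: split_indicator simp flip: ennreal_mult)
    also have "\<dots> = ennreal (1 / c) * (\<integral>\<^sup>+y. ennreal (\<beta> y) * ennreal (norm (g y)) \<partial>M)"
      by (intro nn_integral_cmult) auto
    also have "\<dots> \<le> ennreal (1 / c) * (2 * morrey_norm M \<rho> \<phi> (complementary \<Psi>) g)"
      using mb by (intro mult_left_mono block_pairing) auto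
    also have "\<dots> \<le> ennreal (1 / c) * (2 * 1)" by (intro mult_left_mono mg) auto
    also have "\<dots> = ennreal (1 / c) * ennreal 2" by simp
    also have "\<dots> = ennreal (2 / c)" using c by (subst ennreal_mult[symmetric]) auto
    finally show ?thesis .
  qed
  then show ?thesis using c by (intro exI[of _ "2 / c"]) auto
qed

text \<open>All blocks have uniformly bounded integrals over a fixed ball, by pairing with its indicator, so the
  series has a finite integral over each of countably many balls that exhaust the space.\<close>

lemma block_series_AE_finite:
  assumes mb: "\<And>i. modular_block (x i) (r i) (\<beta> i)" and w: "\<And>i. 0 \<le> w i" "summable w"
  shows "AE y in M. (\<Sum>i. ennreal (w i * \<beta> i y)) < \<infinity>"
proof -
  have [measurable]: "\<beta> i \<in> borel_measurable M" for i using mb[of i] by (simp add: modular_block_def)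
  obtain x0 where x0: "x0 \<in> space M" using space_ne by blast
  have loc: "AE y in M. y \<in> B x0 (real (Suc n)) \<longrightarrow> (\<Sum>i. ennreal (w i * \<beta> i y)) < \<infinity>" for n
  proof -
    define R where "R = real (Suc n)"
    have R: "0 < R" by (simp add: R_def)
    have [measurable]: "B x0 (R) \<in> sets M" using x0 R by (rule ball_sets)
    obtain D where D: "0 < D" "\<And>x r \<beta>. modular_block x r \<beta> \<Longrightarrow>
        (\<integral>\<^sup>+y\<in>B x0 (R). ennreal (\<beta> y) \<partial>M) \<le> ennreal D"
      using block_local_bound[OF x0 R] by blast
    have "(\<integral>\<^sup>+y. (\<Sum>i. ennreal (w i * \<beta> i y)) * indicator (B x0 (R)) y \<partial>M)
       = (\<integral>\<^sup>+y. (\<Sum>i. ennreal (w i) * (ennreal (\<beta> i y) * indicator (B x0 (R)) y)) \<partial>M)"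
      using w(1) by (intro nn_integral_cong) (auto split: split_indicator simp: ennreal_mult')
    also have "\<dots> = (\<Sum>i. ennreal (w i) * (\<integral>\<^sup>+y\<in>B x0 (R). ennreal (\<beta> i y) \<partial>M))"
      by (simp add: nn_integral_suminf nn_integral_cmult)
    also have "\<dots> \<le> (\<Sum>i. ennreal (w i) * ennreal D)"
      by (intro suminf_le mult_left_mono D(2)[OF mb]) auto
    also have "\<dots> = ennreal (\<Sum>i. w i * D)"
      using w D(1) by (simp add: ennreal_mult[symmetric] suminf_ennreal2 summable_mult2)
    also have "\<dots> < \<infinity>" by simp
    finally have "AE y in M. (\<Sum>i. ennreal (w i * \<beta> i y)) * indicator (B x0 (R)) y \<noteq> \<infinity>"
      by (intro nn_integral_PInf_AE) auto
    then show ?thesis unfolding R_def[symmetric] by eventually_elim (auto split: split_indicator_asm simp: less_top)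
  qed
  have "AE y in M. \<forall>n. y \<in> B x0 (real (Suc n)) \<longrightarrow> (\<Sum>i. ennreal (w i * \<beta> i y)) < \<infinity>"
    unfolding AE_all_countable using loc by blast
  then show ?thesis
  proof (rule AE_mp, intro AE_I2 impI)
    fix y assume y: "y \<in> space M" and *: "\<forall>n. y \<in> B x0 (real (Suc n)) \<longrightarrow> (\<Sum>i. ennreal (w i * \<beta> i y)) < \<infinity>"
    then show "(\<Sum>i. ennreal (w i * \<beta> i y)) < \<infinity>" using space_exhaust[OF x0 y] by blast
  qed
qed

section \<open>The maximal function of a block\<close>

text \<open>A crude form of Jensen's inequality: by convexity \<open>u \<le> u0 + u0 \<Psi>(u) / \<Psi>(u0)\<close>, integrated with
  \<open>u = A \<beta>\<close> over the ball.\<close>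

lemma block_integral_bound:
  assumes mb: "modular_block x r \<beta>" and u0: "0 < u0" "\<Psi> u0 = \<phi> x r"
  shows "(\<integral>\<^sup>+y. ennreal (\<beta> y) \<partial>M) \<le> ennreal (2 * u0 / \<phi> x r)"
proof -
  have x: "x \<in> space M" "0 < r" and [measurable]: "\<beta> \<in> borel_measurable M" and b0: "\<And>y. 0 \<le> \<beta> y"
    and supp: "\<And>y. y \<in> space M \<Longrightarrow> \<beta> y \<noteq> 0 \<Longrightarrow> y \<in> B x r"
    and int: "(\<integral>\<^sup>+y. ennreal (\<Psi> (mass x r * \<beta> y)) \<partial>M) \<le> ennreal (mass x r)"
    using mb by (auto simp: modular_block_def)
  have [measurable]: "B x r \<in> sets M" using x by (rule ball_sets)
  define A where "A = mass x r"
  have A: "0 < A" unfolding A_def by (rule mass_pos[OF x])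
  have \<phi>: "0 < \<phi> x r" by (rule phi_pos[OF x])
  have lin: "u \<le> u0 + u0 / \<phi> x r * \<Psi> u" if "0 \<le> u" for u
  proof (cases "u \<le> u0")
    case True
    then show ?thesis using u0(1) \<phi> Psi_nonneg[OF that] by (simp add: add_increasing2)
  next
    case False
    have "u / u0 * \<Psi> u0 \<le> \<Psi> (u / u0 * u0)" using False u0 by (intro Psi_scale_up) auto
    then have "u * \<phi> x r \<le> u0 * \<Psi> u" using u0 by (simp add: field_simps)
    then have "u \<le> u0 / \<phi> x r * \<Psi> u" using \<phi> by (simp add: field_simps)
    then show ?thesis using u0 by simp
  qed
  have "ennreal A * (\<integral>\<^sup>+y. ennreal (\<beta> y) \<partial>M) = (\<integral>\<^sup>+y. ennreal (A * \<beta> y) \<partial>M)"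
    using A b0 by (simp add: ennreal_mult nn_integral_cmult)
  also have "\<dots> \<le> (\<integral>\<^sup>+y. ennreal u0 * indicator (B x r) y + ennreal (u0 / \<phi> x r) * ennreal (\<Psi> (A * \<beta> y)) \<partial>M)"
  proof (rule nn_integral_mono)
    fix y assume y: "y \<in> space M"
    show "ennreal (A * \<beta> y) \<le> ennreal u0 * indicator (B x r) y + ennreal (u0 / \<phi> x r) * ennreal (\<Psi> (A * \<beta> y))"
    proof (cases "\<beta> y = 0")
      case False
      have Ab: "0 \<le> A * \<beta> y" using A b0 by simp
      have "ennreal (A * \<beta> y) \<le> ennreal (u0 + u0 / \<phi> x r * \<Psi> (A * \<beta> y))"
        by (intro ennreal_leI lin Ab)
      also have "\<dots> = ennreal u0 + ennreal (u0 / \<phi> x r) * ennreal (\<Psi> (A * \<beta> y))"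
        using u0(1) \<phi> Psi_nonneg[OF Ab] by (simp flip: ennreal_mult)
      finally show ?thesis using supp[OF y False] by simp
    qed simp
  qed
  also have "\<dots> = ennreal u0 * emeasure M (B x r) + ennreal (u0 / \<phi> x r) * (\<integral>\<^sup>+y. ennreal (\<Psi> (A * \<beta> y)) \<partial>M)"
    using A b0 Psi_measurable[of "\<lambda>y. A * \<beta> y" M]
    by (simp add: nn_integral_add nn_integral_cmult nn_integral_cmult_indicator)
  also have "\<dots> \<le> ennreal u0 * emeasure M (B x r) + ennreal (u0 / \<phi> x r) * ennreal A"
    using int by (intro add_left_mono mult_left_mono) (auto simp: A_def)
  also have "\<dots> = ennreal (A * (2 * u0 / \<phi> x r))"
    using u0(1) \<phi> A vol_pos[OF x]
    by (simp add: emeasure_B[OF x] A_def flip: ennreal_mult ennreal_plus)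
  also have "\<dots> = ennreal A * ennreal (2 * u0 / \<phi> x r)" using A u0 \<phi> by (intro ennreal_mult) auto
  finally show ?thesis using A by (simp add: ennreal_mult_le_mult_iff)
qed

text \<open>The ratio of the coefficients for consecutive annuli: \<open>\<phi>\<close> loses a factor two, of which the power
  \<open>1 / p\<close> is spent on the normalisation of the blocks.\<close>

definition decay :: real where "decay = (1 / 2) powr (1 - 1 / p)"

lemma decay: "0 < decay" "decay < 1"
  using p_gt1 powr_less_mono2[of "1 - 1 / p" "1/2" 1] by (auto simp: decay_def)

text \<open>The factors are: the comparison of the two maximal functions, the scaling by four in the modular
  inequality, the growth of the modular, and the growth of the mass from \<open>B\<close> to \<open>B\<^sub>1\<close>.\<close>

definition local_const :: real where
  "local_const = dilation_const (K * (1 + 4 * K)) * 4 * ((dilation_const dilation + modular_const) * C1) * dilation_const dilation"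

text \<open>If a ball of radius \<open>t\<close> meets the support of a block and an annulus, then its dilation by this ratio
  contains the outer ball of the annulus.\<close>

definition tail_ratio :: real where
  "tail_ratio = K * (K * (1 + 4 * K\<^sup>2 * dilation) + 4 * K\<^sup>2 * dilation)"

definition far_const :: real where "far_const = 2 * dilation_const tail_ratio * Cp"

text \<open>The block for the first dilated ball is the countable maximal function itself, restricted and
  normalised; the modular inequality is used at the height \<open>u0\<close> with \<open>\<Psi> u0 = \<phi> x r\<close>.\<close>

lemma maximal_local_part:
  assumes mb: "modular_block x r \<beta>"
  shows "\<exists>\<gamma>. modular_block x (dilation * r) \<gamma> \<and>
    (AE y in M. y \<in> B x (dilation * r) \<longrightarrow> hl_maximal M \<rho> \<beta> y \<le> ennreal (local_const * \<gamma> y))"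
proof -
  have x: "x \<in> space M" "0 < r" and [measurable]: "\<beta> \<in> borel_measurable M" and b0: "\<And>y. 0 \<le> \<beta> y"
    and int: "(\<integral>\<^sup>+y. ennreal (\<Psi> (mass x r * \<beta> y)) \<partial>M) \<le> ennreal (mass x r)"
    using mb by (auto simp: modular_block_def)
  obtain u0 where u0: "0 < u0" "\<Psi> u0 = \<phi> x r" using Psi_surj[OF phi_pos[OF x]] by blast
  define A where "A = mass x r"
  have A: "0 < A" unfolding A_def by (rule mass_pos[OF x])
  define R where "R = dilation * r"
  have R: "0 < R" "r \<le> R" using dilation_ge(2) x by (auto simp: R_def)
  have [measurable]: "B x R \<in> sets M" using x R by (intro ball_sets)
  define E where "E = dilation_const dilation"
  have E: "1 \<le> E" unfolding E_def by (rule dilation_const_ge1)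
  define C5 where "C5 = (E + modular_const) * C1"
  have C5: "1 \<le> C5"
  proof -
    have "1 * 1 \<le> (E + modular_const) * C1" using E modular_const_pos C1_ge1 by (intro mult_mono) auto
    then show ?thesis by (simp add: C5_def)
  qed
  have volR: "vol x R \<le> E * vol x r"
    unfolding E_def R_def using x dilation_ge(2) by (intro vol_dilate) auto
  have A1: "A \<le> C1 * mass x R" unfolding A_def using x R by (intro mass_almost_inc) auto
  have "mass x R \<le> (E * vol x r) * (\<phi> x r / 2)"
    using volR phi_halving[OF x] phi_pos[OF x(1) R(1)] E by (intro mult_mono) (auto simp: R_def)
  also have "\<dots> = E * A / 2" by (simp add: A_def)
  also have "\<dots> \<le> E * A" using E A by simp
  finally have A2: "mass x R \<le> E * A" .
  \<comment> \<open>The factor \<open>1 / 4\<close> turns the modular of \<open>4 h\<close> into the modular in the block condition.\<close>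
  define h where "h y = A / 4 * \<beta> y" for y
  have [measurable]: "h \<in> borel_measurable M" unfolding h_def by measurable
  define H where "H = countable_maximal (\<lambda>y. ennreal (h y))"
  have [measurable]: "H \<in> borel_measurable M" unfolding H_def by measurable
  have modH: "(\<integral>\<^sup>+y\<in>B x R. ennreal (\<Psi> (enn2real (H y))) \<partial>M) \<le> ennreal (C5 * mass x R)"
  proof -
    have "(\<integral>\<^sup>+y\<in>B x R. ennreal (\<Psi> (enn2real (H y))) \<partial>M)
       \<le> ennreal (\<Psi> u0) * emeasure M (B x R) + ennreal modular_const * (\<integral>\<^sup>+y. ennreal (\<Psi> (4 * h y)) \<partial>M)"
      unfolding H_def using u0 A b0 by (intro maximal_modular_inequality) (auto simp: h_def)
    also have "\<dots> \<le> ennreal (\<phi> x r) * ennreal (E * vol x r) + ennreal modular_const * ennreal A"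
      using int volR
      by (intro add_mono mult_mono) (auto simp: h_def A_def u0 emeasure_B[OF x(1) R(1)] intro: ennreal_leI)
    also have "\<dots> = ennreal ((E + modular_const) * A)"
      using phi_pos[OF x] E modular_const_pos A
      by (simp add: A_def algebra_simps flip: ennreal_mult ennreal_plus)
    also have "\<dots> \<le> ennreal (C5 * mass x R)"
      using mult_left_mono[OF A1, of "E + modular_const"] E modular_const_pos
      by (intro ennreal_leI) (simp add: C5_def mult.assoc)
    finally show ?thesis .
  qed
  define \<gamma> where "\<gamma> y = enn2real (H y) * indicator (B x R) y / (C5 * E * A)" for y
  have [measurable]: "\<gamma> \<in> borel_measurable M" unfolding \<gamma>_def by measurable
  have mR: "0 < mass x R" using x R by (intro mass_pos)
  have "modular_block x R \<gamma>" unfolding modular_block_def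
  proof (intro conjI allI ballI impI)
    show "0 \<le> \<gamma> y" for y using C5 E A by (simp add: \<gamma>_def)
    show "y \<in> B x R" if "\<gamma> y \<noteq> 0" for y
      using that by (auto simp: \<gamma>_def split: split_indicator_asm)
    have "(\<integral>\<^sup>+y. ennreal (\<Psi> (mass x R * \<gamma> y)) \<partial>M)
        \<le> (\<integral>\<^sup>+y. ennreal (1 / C5) * (ennreal (\<Psi> (enn2real (H y))) * indicator (B x R) y) \<partial>M)"
    proof (rule nn_integral_mono)
      fix y
      show "ennreal (\<Psi> (mass x R * \<gamma> y)) \<le> ennreal (1 / C5) * (ennreal (\<Psi> (enn2real (H y))) * indicator (B x R) y)"
      proof (cases "y \<in> B x R")
        case True
        have "mass x R * \<gamma> y = mass x R / (E * A) * (enn2real (H y) / C5)"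
          using True by (simp add: \<gamma>_def)
        also have "\<dots> \<le> 1 * (enn2real (H y) / C5)"
          using A2 E A C5 by (intro mult_right_mono) (auto simp: divide_le_eq)
        finally have "mass x R * \<gamma> y \<le> 1 / C5 * enn2real (H y)" by simp
        then have "\<Psi> (mass x R * \<gamma> y) \<le> \<Psi> (1 / C5 * enn2real (H y))"
          using mR C5 E A by (intro Psi_mono) (auto simp: \<gamma>_def)
        also have "\<dots> \<le> 1 / C5 * \<Psi> (enn2real (H y))" using C5 by (intro Psi_scale) auto
        finally have "ennreal (\<Psi> (mass x R * \<gamma> y)) \<le> ennreal (1 / C5 * \<Psi> (enn2real (H y)))"
          by (rule ennreal_leI)
        also have "\<dots> = ennreal (1 / C5) * ennreal (\<Psi> (enn2real (H y)))"
          using C5 Psi_nonneg[of "enn2real (H y)"] by (intro ennreal_mult) auto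
        finally show ?thesis using True by simp
      qed (simp add: \<gamma>_def Psi_0)
    qed
    also have "\<dots> = ennreal (1 / C5) * (\<integral>\<^sup>+y\<in>B x R. ennreal (\<Psi> (enn2real (H y))) \<partial>M)"
      using Psi_measurable[of "\<lambda>y. enn2real (H y)" M] by (intro nn_integral_cmult) auto
    also have "\<dots> \<le> ennreal (1 / C5) * ennreal (C5 * mass x R)" by (intro mult_left_mono modH) auto
    also have "\<dots> = ennreal (mass x R)" using C5 mR by (simp flip: ennreal_mult)
    finally show "(\<integral>\<^sup>+y. ennreal (\<Psi> (mass x R * \<gamma> y)) \<partial>M) \<le> ennreal (mass x R)" .
  qed (use x R in auto)
  moreover have "AE y in M. y \<in> B x R \<longrightarrow> hl_maximal M \<rho> \<beta> y \<le> ennreal (local_const * \<gamma> y)"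
  proof -
    have "ennreal (h y) = ennreal (A / 4) * ennreal (\<beta> y)" for y
      unfolding h_def using A b0 by (intro ennreal_mult) auto
    then have "(\<integral>\<^sup>+y. ennreal (h y) \<partial>M) = ennreal (A / 4) * (\<integral>\<^sup>+y. ennreal (\<beta> y) \<partial>M)"
      by (simp add: nn_integral_cmult)
    also have "\<dots> \<le> ennreal (A / 4) * ennreal (2 * u0 / \<phi> x r)"
      by (intro mult_left_mono block_integral_bound[OF mb u0]) auto
    also have "\<dots> < \<infinity>" by (simp add: ennreal_mult_less_top)
    finally have "AE y in M. H y < \<infinity>" unfolding H_def by (intro countable_maximal_AE_finite) auto
    then show ?thesis
    proof eventually_elim
      case (elim y)
      then obtain a where a: "H y = ennreal a" "0 \<le> a" by (cases "H y") auto
      have \<beta>h: "(\<lambda>z. ennreal (norm (\<beta> z))) = (\<lambda>z. ennreal (4 / A) * ennreal (h z))"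
        using A b0 by (auto simp: h_def fun_eq_iff simp flip: ennreal_mult)
      have "hl_maximal M \<rho> \<beta> y \<le> ennreal (dilation_const (K * (1 + 4 * K))) * (ennreal (4 / A) * H y)"
        using hl_maximal_le_countable_maximal[of \<beta> y] unfolding \<beta>h H_def by (simp add: countable_maximal_cmult)
      also have "\<dots> = ennreal (dilation_const (K * (1 + 4 * K)) * (4 / A * a))"
        using A dilation_const_ge1[of "K * (1 + 4 * K)"] a by (simp flip: ennreal_mult)
      finally have le: "hl_maximal M \<rho> \<beta> y \<le> ennreal (dilation_const (K * (1 + 4 * K)) * (4 / A * a))" .
      have "dilation_const (K * (1 + 4 * K)) * (4 / A * a) = local_const * \<gamma> y" if "y \<in> B x R"
      proof -
        have "local_const = dilation_const (K * (1 + 4 * K)) * 4 * C5 * E" by (simp add: local_const_def C5_def E_def)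
        then show ?thesis using that A C5 E a by (simp add: \<gamma>_def)
      qed
      then show ?case using le by metis
    qed
  qed
  ultimately show ?thesis unfolding R_def by blast
qed

text \<open>A ball through \<open>y\<close> that meets the support of the block has radius comparable to the distance of \<open>y\<close>
  from the centre, so its volume is at least a fixed multiple of the volume of the outer ball.\<close>

lemma maximal_far_bound:
  assumes mb: "modular_block x r \<beta>" and u0: "0 < u0" "\<Psi> u0 = \<phi> x r"
    and y: "y \<in> B x (dilation ^ Suc n * r)" "y \<notin> B x (dilation ^ n * r)" and n: "1 \<le> n"
  shows "hl_maximal M \<rho> \<beta> y \<le> ennreal (dilation_const tail_ratio * (2 * u0 / \<phi> x r) / vol x (dilation ^ Suc n * r))"
  unfolding hl_maximal_eq
proof (rule SUP_least, clarify)
  fix z t assume z: "z \<in> space M" and t: "0 < t" and yz: "y \<in> B z t"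
  have x: "x \<in> space M" "0 < r" and [measurable]: "\<beta> \<in> borel_measurable M" and b0: "\<And>y. 0 \<le> \<beta> y"
    and supp: "\<And>y. y \<in> space M \<Longrightarrow> \<beta> y \<noteq> 0 \<Longrightarrow> y \<in> B x r"
    using mb by (auto simp: modular_block_def)
  have ys: "y \<in> space M" using y by (simp add: mem_B)
  define R where "R = dilation ^ Suc n * r"
  have R: "0 < R" using dilation_ge(2) x by (simp add: R_def)
  have \<phi>: "0 < \<phi> x r" by (rule phi_pos[OF x])
  show "average (\<lambda>z. ennreal (norm (\<beta> z))) z t \<le> ennreal (dilation_const tail_ratio * (2 * u0 / \<phi> x r) / vol x (dilation ^ Suc n * r))"
  proof (cases "B z t \<inter> B x r = {}")
    case True
    have "(\<integral>\<^sup>+w\<in>B z t. ennreal (norm (\<beta> w)) \<partial>M) = (\<integral>\<^sup>+w. 0 \<partial>M)"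
    proof (rule nn_integral_cong)
      fix w assume "w \<in> space M"
      then show "ennreal (norm (\<beta> w)) * indicator (B z t) w = 0"
        using supp[of w] True by (cases "\<beta> w = 0") (auto split: split_indicator)
    qed
    then show ?thesis by (simp add: average_def)
  next
    case False
    then obtain w where w: "w \<in> space M" "\<rho> z w < t" "\<rho> x w < r" by (auto simp: mem_B)
    have sym: "\<rho> w z = \<rho> z w" "\<rho> w x = \<rho> x w" using w z x rho_sym by auto
    have "\<rho> w y \<le> K * (\<rho> w z + \<rho> z y)" using w z ys by (intro rho_triangle)
    also have "\<dots> \<le> K * (t + t)" using w yz sym K_ge1 by (intro mult_left_mono add_mono) (auto simp: mem_B)
    finally have wy: "\<rho> w y \<le> 2 * K * t" by simp
    have "dilation ^ n * r \<le> \<rho> x y" using y(2) ys by (simp add: mem_B)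
    also have "\<dots> \<le> K * (\<rho> x w + \<rho> w y)" using w x ys by (intro rho_triangle)
    also have "\<dots> \<le> K * (r + 2 * K * t)" using w wy K_ge1 by (intro mult_left_mono add_mono) auto
    finally have 1: "dilation ^ n * r \<le> K * r + 2 * K\<^sup>2 * t" by (simp add: algebra_simps power2_eq_square)
    have "2 * K * r \<le> dilation * r" using dilation_ge(1) x by (intro mult_right_mono) auto
    also have "\<dots> \<le> dilation ^ n * r" using n dilation_ge(2) x power_increasing[of 1 n dilation] by (intro mult_right_mono) auto
    finally have 2: "dilation ^ n * r \<le> 4 * K\<^sup>2 * t" using 1 by simp
    have "R = dilation * (dilation ^ n * r)" by (simp add: R_def mult.assoc)
    also have "\<dots> \<le> dilation * (4 * K\<^sup>2 * t)" using 2 dilation_ge(2) by (intro mult_left_mono) auto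
    finally have Rt: "R \<le> 4 * K\<^sup>2 * dilation * t" by (simp add: mult_ac)
    have rR: "r \<le> R" using one_le_power[of dilation "Suc n"] dilation_ge(2) x by (simp add: R_def)
    have "\<rho> z x \<le> K * (\<rho> z w + \<rho> w x)" using w x z by (intro rho_triangle)
    also have "\<dots> \<le> K * (t + 4 * K\<^sup>2 * dilation * t)"
      using w sym rR Rt K_ge1 by (intro mult_left_mono add_mono) auto
    finally have zx: "\<rho> z x \<le> K * (t + 4 * K\<^sup>2 * dilation * t)" .
    have "K * (\<rho> z x + R) \<le> K * (K * (t + 4 * K\<^sup>2 * dilation * t) + 4 * K\<^sup>2 * dilation * t)"
      using zx Rt K_ge1 by (intro mult_left_mono add_mono) auto
    also have "\<dots> = tail_ratio * t" by (simp add: tail_ratio_def algebra_simps)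
    finally have vl: "vol x R \<le> dilation_const tail_ratio * vol z t"
      using x z t R K_ge1 dilation_ge(2) by (intro vol_compare) (auto simp: tail_ratio_def add_pos_pos)
    have v: "0 < vol x R" "0 < vol z t" using vol_pos x z t R by auto
    have "(\<integral>\<^sup>+w\<in>B z t. ennreal (norm (\<beta> w)) \<partial>M) \<le> (\<integral>\<^sup>+w. ennreal (\<beta> w) \<partial>M)"
      using b0 by (intro nn_integral_mono) (auto split: split_indicator)
    also have "\<dots> \<le> ennreal (2 * u0 / \<phi> x r)" by (rule block_integral_bound[OF mb u0])
    finally have "average (\<lambda>z. ennreal (norm (\<beta> z))) z t \<le> ennreal (2 * u0 / \<phi> x r) / ennreal (vol z t)"
      unfolding average_def emeasure_B[OF z t] by (rule divide_right_mono_ennreal)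
    also have "\<dots> = ennreal (2 * u0 / \<phi> x r / vol z t)" using u0 \<phi> v by (intro divide_ennreal) auto
    also have "\<dots> \<le> ennreal (dilation_const tail_ratio * (2 * u0 / \<phi> x r) / vol x R)"
    proof (rule ennreal_leI)
      define a where "a = 2 * u0 / \<phi> x r"
      have "a * vol x R \<le> a * (dilation_const tail_ratio * vol z t)"
        using vl u0 \<phi> by (intro mult_left_mono) (auto simp: a_def)
      then have "a / vol z t \<le> dilation_const tail_ratio * a / vol x R"
        using v by (simp add: field_simps)
      then show "2 * u0 / \<phi> x r / vol z t \<le> dilation_const tail_ratio * (2 * u0 / \<phi> x r) / vol x R"
        by (simp only: a_def)
    qed
    finally show ?thesis unfolding R_def .
  qed
qed

text \<open>With \<open>s = \<phi>(B\<^sub>n) / \<phi>(B)\<close>, the constant \<open>c\<close> on \<open>B\<^sub>n\<close> is chosen so that the lower type just gives the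
  block condition: \<open>\<Psi>(s\<^bsup>1/p\<^esup> u0 / Cp) \<le> s \<Psi>(u0) = \<phi>(B\<^sub>n)\<close>.  The far bound is a multiple \<open>s\<^bsup>1 - 1/p\<^esup>\<close> of
  this constant.\<close>

lemma maximal_far_part:
  assumes mb: "modular_block x r \<beta>" and n: "1 \<le> n"
  shows "\<exists>\<gamma>. modular_block x (dilation ^ Suc n * r) \<gamma> \<and>
    (\<forall>y. y \<in> B x (dilation ^ Suc n * r) \<longrightarrow> y \<notin> B x (dilation ^ n * r) \<longrightarrow>
      hl_maximal M \<rho> \<beta> y \<le> ennreal (far_const * decay ^ Suc n * \<gamma> y))"
proof -
  have x: "x \<in> space M" "0 < r" using mb by (auto simp: modular_block_def)
  obtain u0 where u0: "0 < u0" "\<Psi> u0 = \<phi> x r" using Psi_surj[OF phi_pos[OF x]] by blast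
  define R where "R = dilation ^ Suc n * r"
  have R: "0 < R" using dilation_ge(2) x by (simp add: R_def)
  have [measurable]: "B x R \<in> sets M" using x R by (intro ball_sets)
  have \<phi>: "0 < \<phi> x r" "0 < \<phi> x R" using phi_pos x R by auto
  have mR: "0 < mass x R" "0 < vol x R" using x R mass_pos vol_pos by auto
  define s where "s = \<phi> x R / \<phi> x r"
  have s0: "0 < s" using \<phi> by (simp add: s_def)
  have s2: "s \<le> (1 / 2) ^ Suc n"
    using phi_decay[OF x, of "Suc n"] \<phi> by (simp add: s_def R_def field_simps)
  have "(1 / 2 :: real) ^ Suc n < 1" by (intro power_Suc_less_one) auto
  then have s1: "s < 1" using s2 by simp
  define \<sigma> where "\<sigma> = s powr (1 / p)"
  have "\<sigma> < 1 powr (1 / p)" unfolding \<sigma>_def using s0 s1 p_gt1 by (intro powr_less_mono2) auto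
  then have \<sigma>: "0 < \<sigma>" "\<sigma> < 1" "\<sigma> powr p = s"
    using s0 p_gt1 by (auto simp: \<sigma>_def powr_powr)
  define c where "c = 1 / Cp * (\<sigma> * u0) / mass x R"
  have c: "0 < c" using Cp_ge1 \<sigma> u0 mR by (simp add: c_def)
  have "\<Psi> (mass x R * c) = \<Psi> (1 / Cp * (\<sigma> * u0))" using mR \<phi> by (simp add: c_def)
  also have "\<dots> \<le> 1 / Cp * \<Psi> (\<sigma> * u0)" using Cp_ge1 \<sigma> u0 by (intro Psi_scale) auto
  also have "\<dots> \<le> 1 / Cp * (Cp * \<sigma> powr p * \<Psi> u0)"
    using Cp_ge1 \<sigma> u0 by (intro mult_left_mono Psi_lower) auto
  also have "\<dots> = \<phi> x R" using Cp_ge1 u0 \<phi> \<sigma> by (simp add: s_def)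
  finally have \<Psi>c: "\<Psi> (mass x R * c) \<le> \<phi> x R" .
  define \<gamma> where "\<gamma> y = c * indicator (B x R) y" for y
  have "modular_block x R \<gamma>" unfolding modular_block_def
  proof (intro conjI allI ballI impI)
    show "\<gamma> \<in> borel_measurable M" unfolding \<gamma>_def by measurable
    show "0 \<le> \<gamma> y" for y using c by (simp add: \<gamma>_def)
    show "y \<in> B x R" if "\<gamma> y \<noteq> 0" for y
      using that by (auto simp: \<gamma>_def split: split_indicator_asm)
    have "(\<integral>\<^sup>+y. ennreal (\<Psi> (mass x R * \<gamma> y)) \<partial>M) \<le> (\<integral>\<^sup>+y. ennreal (\<phi> x R) * indicator (B x R) y \<partial>M)"
      using \<Psi>c by (intro nn_integral_mono) (auto simp: \<gamma>_def Psi_0 split: split_indicator intro: ennreal_leI)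
    also have "\<dots> = ennreal (mass x R)"
      using \<phi> by (simp add: nn_integral_cmult_indicator emeasure_B[OF x(1) R] mult.commute flip: ennreal_mult)
    finally show "(\<integral>\<^sup>+y. ennreal (\<Psi> (mass x R * \<gamma> y)) \<partial>M) \<le> ennreal (mass x R)" .
  qed (use x R in auto)
  moreover have "hl_maximal M \<rho> \<beta> y \<le> ennreal (far_const * decay ^ Suc n * \<gamma> y)"
    if y: "y \<in> B x R" "y \<notin> B x (dilation ^ n * r)" for y
  proof -
    have "hl_maximal M \<rho> \<beta> y \<le> ennreal (dilation_const tail_ratio * (2 * u0 / \<phi> x r) / vol x R)"
      unfolding R_def by (rule maximal_far_bound[OF mb u0]) (use y n in \<open>auto simp: R_def\<close>)
    also have "\<dots> \<le> ennreal (far_const * decay ^ Suc n * \<gamma> y)"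
    proof (rule ennreal_leI)
      have "s = \<sigma> * s powr (1 - 1 / p)"
        using s0 by (simp add: \<sigma>_def flip: powr_add)
      also have "\<dots> \<le> \<sigma> * ((1 / 2) ^ Suc n) powr (1 - 1 / p)"
        using s0 s2 p_gt1 \<sigma> by (intro mult_left_mono powr_mono2) auto
      also have "((1 / 2) ^ Suc n) powr (1 - 1 / p) = decay ^ Suc n"
        unfolding decay_def by (simp add: powr_powr powr_realpow[symmetric] mult.commute del: power_Suc)
      finally have st: "s \<le> \<sigma> * decay ^ Suc n" .
      have "dilation_const tail_ratio * (2 * u0 / \<phi> x r) / vol x R = 2 * dilation_const tail_ratio * u0 / mass x R * s"
        using \<phi> mR by (simp add: s_def mult_ac)
      also have "\<dots> \<le> 2 * dilation_const tail_ratio * u0 / mass x R * (\<sigma> * decay ^ Suc n)"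
        using st u0 mR dilation_const_ge1[of tail_ratio] by (intro mult_left_mono) auto
      also have "\<dots> = far_const * decay ^ Suc n * \<gamma> y"
        using y(1) Cp_ge1 by (simp add: far_const_def c_def \<gamma>_def)
      finally show "dilation_const tail_ratio * (2 * u0 / \<phi> x r) / vol x R \<le> far_const * decay ^ Suc n * \<gamma> y" .
    qed
    finally show ?thesis .
  qed
  ultimately show ?thesis unfolding R_def by blast
qed

definition maximal_coeff :: "nat \<Rightarrow> real" where "maximal_coeff k = (local_const + far_const) * decay ^ k"

lemma local_far_const_pos: "0 < local_const" "0 < far_const"
proof -
  have "1 \<le> dilation_const (K * (1 + 4 * K))" "1 \<le> dilation_const dilation" "1 \<le> dilation_const tail_ratio" by (rule dilation_const_ge1)+
  then show "0 < local_const" "0 < far_const" unfolding local_const_def far_const_def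
    using modular_const_pos C1_ge1 Cp_ge1 by (auto intro!: mult_pos_pos add_pos_pos)
qed

lemma maximal_coeff: "0 \<le> maximal_coeff k" "summable maximal_coeff"
  using local_far_const_pos decay unfolding maximal_coeff_def[abs_def] by (auto intro!: summable_mult summable_geometric)

text \<open>Each point lies in the first dilated ball or in exactly one annulus, and there a single term of the
  series dominates.\<close>

lemma maximal_block_decomposition:
  assumes mb: "modular_block x r \<beta>"
  shows "\<exists>s \<gamma>. (\<forall>k. modular_block x (s k) (\<gamma> k)) \<and>
    (AE y in M. hl_maximal M \<rho> \<beta> y \<le> (\<Sum>k. ennreal (maximal_coeff k * \<gamma> k y)))"
proof -
  have x: "x \<in> space M" "0 < r" using mb by (auto simp: modular_block_def)
  obtain \<gamma>0 where \<gamma>0: "modular_block x (dilation * r) \<gamma>0"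
    "AE y in M. y \<in> B x (dilation * r) \<longrightarrow> hl_maximal M \<rho> \<beta> y \<le> ennreal (local_const * \<gamma>0 y)"
    using maximal_local_part[OF mb] by blast
  have "\<forall>n. \<exists>\<gamma>. 1 \<le> n \<longrightarrow> modular_block x (dilation ^ Suc n * r) \<gamma> \<and>
    (\<forall>y. y \<in> B x (dilation ^ Suc n * r) \<longrightarrow> y \<notin> B x (dilation ^ n * r) \<longrightarrow>
      hl_maximal M \<rho> \<beta> y \<le> ennreal (far_const * decay ^ Suc n * \<gamma> y))"
    using maximal_far_part[OF mb] by blast
  then obtain \<gamma>1 where \<gamma>1: "\<And>n. 1 \<le> n \<Longrightarrow> modular_block x (dilation ^ Suc n * r) (\<gamma>1 n)"
    "\<And>n y. 1 \<le> n \<Longrightarrow> y \<in> B x (dilation ^ Suc n * r) \<Longrightarrow> y \<notin> B x (dilation ^ n * r) \<Longrightarrow>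
      hl_maximal M \<rho> \<beta> y \<le> ennreal (far_const * decay ^ Suc n * \<gamma>1 n y)" by metis
  define \<gamma> where "\<gamma> k = (if k = 0 then \<gamma>0 else \<gamma>1 k)" for k
  have mbk: "modular_block x (dilation ^ Suc k * r) (\<gamma> k)" for k
    using \<gamma>0(1) \<gamma>1(1)[of k] by (cases "k = 0") (auto simp: \<gamma>_def)
  have g0: "0 \<le> \<gamma> k y" for k y using mbk[of k] by (simp add: modular_block_def)
  have "AE y in M. hl_maximal M \<rho> \<beta> y \<le> (\<Sum>k. ennreal (maximal_coeff k * \<gamma> k y))"
    using \<gamma>0(2) AE_space
  proof eventually_elim
    case (elim y)
    obtain n0 where "\<rho> x y / r < dilation ^ n0" using real_arch_pow[OF dilation_ge(2)] by blast
    then have ex: "y \<in> B x (dilation ^ n0 * r)" using x elim by (simp add: mem_B field_simps)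
    define m where "m = (LEAST n. y \<in> B x (dilation ^ n * r))"
    have m: "y \<in> B x (dilation ^ m * r)" unfolding m_def by (rule LeastI[of _ n0]) (rule ex)
    have "\<exists>k. hl_maximal M \<rho> \<beta> y \<le> ennreal (maximal_coeff k * \<gamma> k y)"
    proof (cases "m \<le> 1")
      case True
      then have "dilation ^ m \<le> dilation" using dilation_ge(2) power_increasing[of m 1 dilation] by simp
      then have "dilation ^ m * r \<le> dilation * r" using x by (intro mult_right_mono) auto
      then have "y \<in> B x (dilation * r)" using m by (auto simp: mem_B)
      then have "hl_maximal M \<rho> \<beta> y \<le> ennreal (local_const * \<gamma>0 y)" using elim by blast
      also have "\<dots> \<le> ennreal (maximal_coeff 0 * \<gamma> 0 y)"
        using g0[of 0 y] local_far_const_pos by (intro ennreal_leI) (auto simp: maximal_coeff_def \<gamma>_def intro!: mult_right_mono)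
      finally show ?thesis by blast
    next
      case False
      then obtain n where n: "m = Suc n" "1 \<le> n" by (cases m) auto
      have nin: "y \<notin> B x (dilation ^ n * r)"
      proof
        assume "y \<in> B x (dilation ^ n * r)"
        then have "m \<le> n" unfolding m_def by (rule Least_le)
        then show False using n by simp
      qed
      have "hl_maximal M \<rho> \<beta> y \<le> ennreal (far_const * decay ^ Suc n * \<gamma>1 n y)"
        using \<gamma>1(2)[OF n(2)] m nin n(1) by simp
      also have "\<dots> \<le> ennreal (maximal_coeff n * \<gamma> n y)"
      proof (intro ennreal_leI)
        have "far_const * (decay * decay ^ n) \<le> far_const * (1 * decay ^ n)"
          using decay local_far_const_pos by (intro mult_left_mono mult_right_mono) auto
        also have "\<dots> \<le> maximal_coeff n" unfolding maximal_coeff_def using local_far_const_pos decay by (simp add: distrib_right)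
        finally have "far_const * decay ^ Suc n * \<gamma> n y \<le> maximal_coeff n * \<gamma> n y"
          using g0 by (intro mult_right_mono) auto
        then show "far_const * decay ^ Suc n * \<gamma>1 n y \<le> maximal_coeff n * \<gamma> n y" using n by (simp add: \<gamma>_def)
      qed
      finally show ?thesis by blast
    qed
    then obtain k where "hl_maximal M \<rho> \<beta> y \<le> ennreal (maximal_coeff k * \<gamma> k y)" by blast
    also have "\<dots> = (\<Sum>i\<in>{k}. ennreal (maximal_coeff i * \<gamma> i y))" by simp
    also have "\<dots> \<le> (\<Sum>k. ennreal (maximal_coeff k * \<gamma> k y))" by (rule sum_le_suminf) auto
    finally show ?case .
  qed
  then show ?thesis using mbk by (intro exI[of _ "\<lambda>k. dilation ^ Suc k * r"] exI[of _ \<gamma>]) auto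
qed

section \<open>The block space as a function lattice\<close>

text \<open>Dominated by the pairing of the moduli, the series may be integrated against \<open>g\<close> term by term; the
  last claim bounds the tail and yields convergence in the dual norm.\<close>

lemma block_series_pairing:
  fixes b :: "nat \<Rightarrow> 'a \<Rightarrow> 'b::{real_normed_field, banach, second_countable_topology}"
  assumes mb: "\<And>i. modular_block (x i) (r i) (\<beta> i)" and w: "\<And>i. 0 \<le> w i" "summable w"
    and [measurable]: "\<And>i. b i \<in> borel_measurable M" "v \<in> borel_measurable M" "g \<in> borel_measurable M"
    and le: "\<And>i. AE y in M. norm (b i y) \<le> 2 * \<beta> i y"
    and sums: "AE y in M. (\<lambda>i. w i *\<^sub>R b i y) sums v y"
    and m: "morrey_norm M \<rho> \<phi> (complementary \<Psi>) g \<le> ennreal m" "0 \<le> m"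
  shows "integrable M (\<lambda>y. v y * g y)"
    and "(\<lambda>i. w i *\<^sub>R block_functional M (b i) g) sums (\<integral>y. v y * g y \<partial>M)"
    and "norm ((\<integral>y. v y * g y \<partial>M) - (\<Sum>i<n. w i *\<^sub>R block_functional M (b i) g)) \<le> 4 * m * (\<Sum>i. w (i + n))"
proof -
  have [measurable]: "\<beta> i \<in> borel_measurable M" and b0: "0 \<le> \<beta> i y" for i y
    using mb[of i] by (auto simp: modular_block_def)
  define f where "f i y = w i *\<^sub>R (b i y * g y)" for i y
  have [measurable]: "f i \<in> borel_measurable M" for i unfolding f_def by measurable
  have nf: "(\<integral>\<^sup>+y. ennreal (norm (f i y)) \<partial>M) \<le> ennreal (4 * m * w i)" for i
  proof -
    have "(\<integral>\<^sup>+y. ennreal (norm (f i y)) \<partial>M) \<le> (\<integral>\<^sup>+y. ennreal (2 * w i) * (ennreal (\<beta> i y) * ennreal (norm (g y))) \<partial>M)"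
    proof (rule nn_integral_mono_AE, use le[of i] in eventually_elim)
      fix y assume "norm (b i y) \<le> 2 * \<beta> i y"
      then have "w i * (norm (b i y) * norm (g y)) \<le> w i * (2 * \<beta> i y * norm (g y))"
        using w by (intro mult_left_mono mult_right_mono) auto
      then have "norm (f i y) \<le> 2 * w i * (\<beta> i y * norm (g y))"
        using w by (simp add: f_def norm_mult)
      then show "ennreal (norm (f i y)) \<le> ennreal (2 * w i) * (ennreal (\<beta> i y) * ennreal (norm (g y)))"
        using w b0 by (simp add: ennreal_leI flip: ennreal_mult)
    qed
    also have "\<dots> = ennreal (2 * w i) * (\<integral>\<^sup>+y. ennreal (\<beta> i y) * ennreal (norm (g y)) \<partial>M)"
      by (intro nn_integral_cmult) auto
    also have "\<dots> \<le> ennreal (2 * w i) * (2 * ennreal m)"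
      using m by (intro mult_left_mono order_trans[OF block_pairing[OF mb]]) auto
    also have "\<dots> = ennreal (2 * w i) * ennreal (2 * m)" using m by (simp add: ennreal_mult)
    also have "\<dots> = ennreal (4 * m * w i)" using w m by (simp add: mult_ac flip: ennreal_mult)
    finally show ?thesis .
  qed
  have int: "integrable M (f i)" for i
    using nf[of i] by (intro integrableI_bounded) (auto intro: order_le_less_trans)
  have norm_int: "(\<integral>y. norm (f i y) \<partial>M) \<le> 4 * m * w i" for i
  proof -
    have "ennreal (\<integral>y. norm (f i y) \<partial>M) \<le> ennreal (4 * m * w i)"
      using nf[of i] int by (simp add: nn_integral_eq_integral)
    then show ?thesis using m w by (simp add: ennreal_le_iff)
  qed
  have summ_int: "summable (\<lambda>i. \<integral>y. norm (f i y) \<partial>M)"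
  proof (rule summable_comparison_test'[OF summable_mult[OF w(2)], where N = 0])
    show "norm (\<integral>y. norm (f i y) \<partial>M) \<le> 4 * m * w i" for i using norm_int[of i] by simp
  qed
  have "AE y in M. (\<Sum>i. ennreal (w i * \<beta> i y)) < \<infinity>"
    by (rule block_series_AE_finite[OF mb w])
  moreover have "AE y in M. \<forall>i. norm (b i y) \<le> 2 * \<beta> i y" using le by (simp add: AE_all_countable)
  ultimately have summ: "AE y in M. summable (\<lambda>i. norm (f i y))"
  proof eventually_elim
    case (elim y)
    have "summable (\<lambda>i. w i * \<beta> i y)"
      using elim(1) w b0 by (intro summable_suminf_not_top) (auto simp: less_top[symmetric])
    then have s: "summable (\<lambda>i. 2 * norm (g y) * (w i * \<beta> i y))" by (rule summable_mult)
    have "norm (f i y) \<le> 2 * norm (g y) * (w i * \<beta> i y)" for i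
    proof -
      have "w i * (norm (b i y) * norm (g y)) \<le> w i * (2 * \<beta> i y * norm (g y))"
        using w elim(2) by (intro mult_left_mono mult_right_mono) auto
      then show ?thesis using w by (simp add: f_def norm_mult mult_ac)
    qed
    then show ?case by (intro summable_comparison_test'[OF s]) auto
  qed
  have lim: "AE y in M. (\<Sum>i. f i y) = v y * g y"
    using sums
  proof eventually_elim
    case (elim y)
    then have "(\<lambda>i. (w i *\<^sub>R b i y) * g y) sums (v y * g y)" by (rule sums_mult2)
    then show ?case by (simp add: f_def sums_unique[symmetric])
  qed
  have bf: "integral\<^sup>L M (f i) = w i *\<^sub>R block_functional M (b i) g" for i
    unfolding f_def block_functional_def by (cases "w i = 0") auto
  have eq: "(\<integral>y. (\<Sum>i. f i y) \<partial>M) = (\<integral>y. v y * g y \<partial>M)"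
    using lim by (intro integral_cong_AE) auto
  have "integrable M (\<lambda>y. \<Sum>i. f i y)" by (rule integrable_suminf[OF int summ summ_int])
  then show "integrable M (\<lambda>y. v y * g y)"
    using lim by (subst integrable_cong_AE[symmetric]) auto
  have S: "(\<lambda>i. integral\<^sup>L M (f i)) sums (\<integral>y. v y * g y \<partial>M)"
    using sums_integral[OF int summ summ_int] unfolding eq .
  then show "(\<lambda>i. w i *\<^sub>R block_functional M (b i) g) sums (\<integral>y. v y * g y \<partial>M)" by (simp add: bf)
  have "(\<integral>y. v y * g y \<partial>M) - (\<Sum>i<n. integral\<^sup>L M (f i)) = (\<Sum>i. integral\<^sup>L M (f (i + n)))"
    using S suminf_minus_initial_segment[of "\<lambda>i. integral\<^sup>L M (f i)" n] by (simp add: sums_iff)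
  also have "norm \<dots> \<le> (\<Sum>i. 4 * m * w (i + n))"
  proof (rule norm_suminf_le)
    show "norm (integral\<^sup>L M (f (i + n))) \<le> 4 * m * w (i + n)" for i
      using integral_norm_bound[of M "f (i + n)"] norm_int[of "i + n"] by linarith
    show "summable (\<lambda>i. 4 * m * w (i + n))"
      using summable_ignore_initial_segment[OF w(2)] by (rule summable_mult)
  qed
  also have "\<dots> = 4 * m * (\<Sum>i. w (i + n))"
    using summable_ignore_initial_segment[OF w(2)] by (rule suminf_mult)
  finally show "norm ((\<integral>y. v y * g y \<partial>M) - (\<Sum>i<n. w i *\<^sub>R block_functional M (b i) g)) \<le> 4 * m * (\<Sum>i. w (i + n))"
    by (simp add: bf)
qed

text \<open>Distribute \<open>v\<close> proportionally: with \<open>T = \<Sum> w\<^sub>i \<beta>\<^sub>i\<close>, the functions \<open>b\<^sub>i = (\<beta>\<^sub>i / T) v\<close> satisfy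
  \<open>|b\<^sub>i| \<le> \<beta>\<^sub>i\<close> and \<open>\<Sum> w\<^sub>i b\<^sub>i = v\<close>.  Almost everywhere \<open>v\<close> vanishes where \<open>T\<close> does, and there division by zero gives
  the right value.\<close>

lemma majorized_in_block_space:
  fixes v :: "'a \<Rightarrow> 'b::{real_normed_field, banach, second_countable_topology}"
  assumes mb: "\<And>i. modular_block (x i) (r i) (\<beta> i)" and w: "\<And>i. 0 \<le> w i" "summable w"
    and [measurable]: "v \<in> borel_measurable M"
    and le: "AE y in M. ennreal (norm (v y)) \<le> (\<Sum>i. ennreal (w i * \<beta> i y))"
  shows "block_functional M v \<in> block_space M \<rho> \<phi> \<Psi>"
    and "\<exists>b. block_decomposition M \<rho> \<phi> \<Psi> (block_functional M v) w b \<and>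
           (AE y in M. (\<lambda>i. w i *\<^sub>R b i y) sums v y)"
    and "block_norm M \<rho> \<phi> \<Psi> (block_functional M v) \<le> ennreal (\<Sum>i. w i)"
proof -
  have [measurable]: "\<beta> i \<in> borel_measurable M" and b0: "0 \<le> \<beta> i y" for i y
    using mb[of i] by (auto simp: modular_block_def)
  define T where "T y = enn2real (\<Sum>i. ennreal (w i * \<beta> i y))" for y
  have [measurable]: "T \<in> borel_measurable M" unfolding T_def by measurable
  define b where "b i y = (\<beta> i y / T y) *\<^sub>R v y" for i y
  have [measurable]: "b i \<in> borel_measurable M" for i unfolding b_def by measurable
  have fin: "AE y in M. (\<Sum>i. ennreal (w i * \<beta> i y)) < \<infinity>"
    by (rule block_series_AE_finite[OF mb w])
  have T0: "0 \<le> T y" for y by (simp add: T_def)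
  have vT: "AE y in M. norm (v y) \<le> T y \<and> (\<lambda>i. w i * \<beta> i y) sums T y"
    using fin le
  proof eventually_elim
    case (elim y)
    have s: "summable (\<lambda>i. w i * \<beta> i y)"
      using elim(1) w b0 by (intro summable_suminf_not_top) (auto simp: less_top[symmetric])
    then have e: "(\<Sum>i. ennreal (w i * \<beta> i y)) = ennreal (\<Sum>i. w i * \<beta> i y)"
      using w b0 by (intro suminf_ennreal2) auto
    have "0 \<le> (\<Sum>i. w i * \<beta> i y)" using s w b0 by (intro suminf_nonneg) auto
    then have "T y = (\<Sum>i. w i * \<beta> i y)" unfolding T_def e by simp
    then show ?case using elim(2) s \<open>0 \<le> (\<Sum>i. w i * \<beta> i y)\<close> unfolding e
      by (simp add: ennreal_le_iff sums_iff)
  qed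
  have bb: "AE y in M. norm (b i y) \<le> \<beta> i y" for i
    using vT
  proof eventually_elim
    case (elim y)
    have "norm (b i y) = \<beta> i y * (norm (v y) / T y)" using b0 T0 by (simp add: b_def)
    also have "\<dots> \<le> \<beta> i y * 1"
      using elim b0 T0[of y] by (intro mult_left_mono) (auto simp: divide_le_eq)
    finally show ?case by simp
  qed
  have blk: "orlicz_block M \<rho> \<phi> \<Psi> (b i)" for i
    by (rule orlicz_block_of_modular_block[OF mb[of i] _ bb]) (auto simp: b_def)
  have sums: "AE y in M. (\<lambda>i. w i *\<^sub>R b i y) sums v y"
    using vT
  proof eventually_elim
    case (elim y)
    have "(\<lambda>i. (w i * \<beta> i y) *\<^sub>R ((1 / T y) *\<^sub>R v y)) sums (T y *\<^sub>R ((1 / T y) *\<^sub>R v y))"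
      using elim by (intro sums_scaleR_left) auto
    moreover have "T y *\<^sub>R ((1 / T y) *\<^sub>R v y) = v y" using elim by (cases "T y = 0") auto
    ultimately show ?case by (simp add: b_def)
  qed
  have bb2: "AE y in M. norm (b i y) \<le> 2 * \<beta> i y" for i
    using bb[of i] by eventually_elim (use b0 in \<open>auto intro: order_trans\<close>)
  note pairing = block_series_pairing[OF mb w _ _ _ bb2 sums]
  let ?\<X> = "morrey_space M \<rho> \<phi> (complementary \<Psi>) :: ('a \<Rightarrow> 'b) set"
  let ?N = "morrey_norm M \<rho> \<phi> (complementary \<Psi>)"
  have gX: "g \<in> borel_measurable M \<and> (\<exists>m\<ge>0. ?N g = ennreal m)" if "g \<in> ?\<X>" for g
    using that by (cases "?N g") (auto simp: morrey_space_def orlicz_space_loc_def)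
  have dual: "block_functional M v \<in> morrey_dual M \<rho> \<phi> (complementary \<Psi>)"
    unfolding morrey_dual_def
  proof (intro CollectI conjI ballI allI exI)
    fix g h assume gh: "g \<in> ?\<X>" "h \<in> ?\<X>"
    have "integrable M (\<lambda>y. v y * k y)" if k: "k \<in> ?\<X>" for k
    proof -
      obtain m where m: "k \<in> borel_measurable M" "?N k = ennreal m" "0 \<le> m" using gX[OF k] by blast
      show ?thesis by (rule pairing(1)[of k m]) (use m in auto)
    qed
    then have "integrable M (\<lambda>y. v y * g y)" "integrable M (\<lambda>y. v y * h y)" using gh by blast+
    then show "block_functional M v (\<lambda>x. g x + h x) = block_functional M v g + block_functional M v h"
      by (simp add: block_functional_def distrib_left)
  next
    fix c and g :: "'a \<Rightarrow> 'b"
    have "(\<lambda>x. v x * (c * g x)) = (\<lambda>x. c * (v x * g x))" by (simp add: fun_eq_iff mult_ac)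
    then show "block_functional M v (\<lambda>x. c * g x) = c * block_functional M v g"
      by (simp add: block_functional_def)
  next
    show "0 \<le> 4 * (\<Sum>i. w i)" using w by (simp add: suminf_nonneg)
    fix g assume "g \<in> ?\<X>"
    then obtain m where m: "g \<in> borel_measurable M" "?N g = ennreal m" "0 \<le> m" using gX[of g] by auto
    then have "norm (block_functional M v g) \<le> 4 * (\<Sum>i. w i) * m"
      using pairing(3)[of g m 0] by (simp add: block_functional_def mult_ac)
    then have "ennreal (norm (block_functional M v g)) \<le> ennreal (4 * (\<Sum>i. w i) * m)" by (rule ennreal_leI)
    also have "\<dots> = ennreal (4 * (\<Sum>i. w i)) * ?N g"
      using m w by (simp only: m(2)) (intro ennreal_mult; simp add: suminf_nonneg)
    finally show "ennreal (norm (block_functional M v g)) \<le> ennreal (4 * (\<Sum>i. w i)) * ?N g" .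
  qed
  have dec: "block_decomposition M \<rho> \<phi> \<Psi> (block_functional M v) w b"
    unfolding block_decomposition_def
  proof (intro conjI allI blk w)
    let ?d = "\<lambda>n. morrey_dual_norm M \<rho> \<phi> (complementary \<Psi>)
            (\<lambda>g. block_functional M v g - (\<Sum>j<n. w j *\<^sub>R block_functional M (b j) g))"
    have "?d n \<le> ennreal (4 * (\<Sum>i. w (i + n)))" for n
      unfolding morrey_dual_norm_def
    proof (rule SUP_least, clarify)
      fix g assume "g \<in> ?\<X>" "?N g \<le> 1"
      then have "g \<in> borel_measurable M" "?N g \<le> ennreal 1" using gX by auto
      then show "ennreal (norm (block_functional M v g - (\<Sum>j<n. w j *\<^sub>R block_functional M (b j) g)))
          \<le> ennreal (4 * (\<Sum>i. w (i + n)))"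
        using pairing(3)[of g 1 n] by (intro ennreal_leI) (simp add: block_functional_def)
    qed
    moreover have "(\<lambda>n. ennreal (4 * (\<Sum>i. w (i + n)))) \<longlonglongrightarrow> 0"
    proof -
      have "(\<lambda>n. 4 * (\<Sum>i. w (i + n))) \<longlonglongrightarrow> 4 * 0"
        by (intro tendsto_intros suminf_exist_split2 w)
      then have "(\<lambda>n. ennreal (4 * (\<Sum>i. w (i + n)))) \<longlonglongrightarrow> ennreal (4 * 0)" by (rule tendsto_ennrealI)
      then show ?thesis by simp
    qed
    ultimately show "?d \<longlonglongrightarrow> 0" by (rule_tac tendsto_sandwich[of "\<lambda>_. 0"]) auto
  qed
  show "block_functional M v \<in> block_space M \<rho> \<phi> \<Psi>"
    unfolding block_space_def using dual dec by blast
  show "\<exists>b. block_decomposition M \<rho> \<phi> \<Psi> (block_functional M v) w b \<and>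
           (AE y in M. (\<lambda>i. w i *\<^sub>R b i y) sums v y)" using dec sums by blast
  show "block_norm M \<rho> \<phi> \<Psi> (block_functional M v) \<le> ennreal (\<Sum>i. w i)"
    unfolding block_norm_def by (rule Inf_lower) (use dec in blast)
qed

lemma block_decomposition_data:
  assumes "block_decomposition M \<rho> \<phi> \<Psi> F l b"
  shows "\<And>j. b j \<in> borel_measurable M" "\<And>j. 0 \<le> l j" "summable l"
    "\<exists>x r. \<forall>j. modular_block (x j) (r j) (\<lambda>y. norm (b j y) / 2)"
    "AE y in M. (\<lambda>j. l j *\<^sub>R b j y) sums (\<Sum>j. l j *\<^sub>R b j y)"
    "AE y in M. ennreal (norm (\<Sum>j. l j *\<^sub>R b j y)) \<le> (\<Sum>j. ennreal (2 * l j) * ennreal (norm (b j y) / 2))"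
proof -
  have blk: "orlicz_block M \<rho> \<phi> \<Psi> (b j)" and l: "0 \<le> l j" "summable l" for j
    using assms by (auto simp: block_decomposition_def)
  show "b j \<in> borel_measurable M" for j by (rule modular_block_of_orlicz_block(1)[OF blk])
  show "0 \<le> l j" for j by (rule l)
  show "summable l" by (rule l)
  have "\<forall>j. \<exists>x r. modular_block x r (\<lambda>y. norm (b j y) / 2)"
    using modular_block_of_orlicz_block(2)[OF blk] by blast
  then show ex: "\<exists>x r. \<forall>j. modular_block (x j) (r j) (\<lambda>y. norm (b j y) / 2)" by metis
  then obtain x r where mb: "\<And>j. modular_block (x j) (r j) (\<lambda>y. norm (b j y) / 2)" by blast
  have "AE y in M. (\<Sum>j. ennreal (l j * (norm (b j y) / 2))) < \<infinity>"
    by (rule block_series_AE_finite[OF mb l])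
  then have summ: "AE y in M. summable (\<lambda>j. norm (l j *\<^sub>R b j y))"
  proof eventually_elim
    case (elim y)
    have "summable (\<lambda>j. l j * (norm (b j y) / 2))"
      using elim l by (intro summable_suminf_not_top) (auto simp: less_top[symmetric])
    then have "summable (\<lambda>j. 2 * (l j * (norm (b j y) / 2)))" by (rule summable_mult)
    then show ?case using l by simp
  qed
  then show "AE y in M. (\<lambda>j. l j *\<^sub>R b j y) sums (\<Sum>j. l j *\<^sub>R b j y)"
    by eventually_elim (rule summable_sums[OF summable_norm_cancel])
  show "AE y in M. ennreal (norm (\<Sum>j. l j *\<^sub>R b j y)) \<le> (\<Sum>j. ennreal (2 * l j) * ennreal (norm (b j y) / 2))"
    using summ
  proof eventually_elim
    case (elim y)
    have "ennreal (norm (\<Sum>j. l j *\<^sub>R b j y)) \<le> ennreal (\<Sum>j. norm (l j *\<^sub>R b j y))"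
      by (intro ennreal_leI summable_norm elim)
    also have "\<dots> = (\<Sum>j. ennreal (norm (l j *\<^sub>R b j y)))"
      using elim by (intro suminf_ennreal2[symmetric]) auto
    also have "\<dots> = (\<Sum>j. ennreal (2 * l j) * ennreal (norm (b j y) / 2))"
      using l by (intro suminf_cong) (simp flip: ennreal_mult)
    finally show ?case .
  qed
qed

lemma decomposition_pairing:
  fixes F :: "('a \<Rightarrow> 'b::{real_normed_field, banach, second_countable_topology}) \<Rightarrow> 'b"
  assumes dec: "block_decomposition M \<rho> \<phi> \<Psi> F l b"
    and g: "g \<in> morrey_space M \<rho> \<phi> (complementary \<Psi>)" "morrey_norm M \<rho> \<phi> (complementary \<Psi>) g \<le> 1"
  shows "integrable M (\<lambda>y. (\<Sum>j. l j *\<^sub>R b j y) * g y)"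
    and "F g = (\<integral>y. (\<Sum>j. l j *\<^sub>R b j y) * g y \<partial>M)"
proof -
  note [measurable] = block_decomposition_data(1)[OF dec]
  have [measurable]: "g \<in> borel_measurable M"
    using g by (simp add: morrey_space_def orlicz_space_loc_def)
  obtain x r where mb: "\<And>j. modular_block (x j) (r j) (\<lambda>y. norm (b j y) / 2)"
    using block_decomposition_data(4)[OF dec] by blast
  let ?v = "\<lambda>y. \<Sum>j. l j *\<^sub>R b j y"
  have m1: "morrey_norm M \<rho> \<phi> (complementary \<Psi>) g \<le> ennreal 1" using g by simp
  have "?v \<in> borel_measurable M" by measurable
  note pairing = block_series_pairing[OF mb block_decomposition_data(2,3)[OF dec] _ this _ _
      block_decomposition_data(5)[OF dec] m1]
  show "integrable M (\<lambda>y. ?v y * g y)" by (rule pairing(1)) auto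
  have lim1: "(\<lambda>n. \<Sum>j<n. l j *\<^sub>R block_functional M (b j) g) \<longlonglongrightarrow> (\<integral>y. ?v y * g y \<partial>M)"
    unfolding sums_def[symmetric] by (rule pairing(2)) auto
  let ?d = "\<lambda>n. morrey_dual_norm M \<rho> \<phi> (complementary \<Psi>)
            (\<lambda>g. F g - (\<Sum>j<n. l j *\<^sub>R block_functional M (b j) g))"
  have d: "?d \<longlonglongrightarrow> 0" using dec by (simp add: block_decomposition_def)
  have "ennreal (norm (F g - (\<Sum>j<n. l j *\<^sub>R block_functional M (b j) g))) \<le> ?d n" for n
    unfolding morrey_dual_norm_def by (rule SUP_upper2[of g]) (use g in auto)
  then have "(\<lambda>n. ennreal (norm (F g - (\<Sum>j<n. l j *\<^sub>R block_functional M (b j) g)))) \<longlonglongrightarrow> 0"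
    by (intro tendsto_sandwich[OF _ _ tendsto_const d]) auto
  then have "(\<lambda>n. norm (F g - (\<Sum>j<n. l j *\<^sub>R block_functional M (b j) g))) \<longlonglongrightarrow> 0"
    by (subst (asm) ennreal_0[symmetric], subst (asm) tendsto_ennreal_iff) auto
  then have "(\<lambda>n. F g - (F g - (\<Sum>j<n. l j *\<^sub>R block_functional M (b j) g))) \<longlonglongrightarrow> F g - 0"
    by (intro tendsto_diff tendsto_const) (simp add: tendsto_norm_zero_iff)
  then have lim2: "(\<lambda>n. \<Sum>j<n. l j *\<^sub>R block_functional M (b j) g) \<longlonglongrightarrow> F g" by simp
  show "F g = (\<integral>y. ?v y * g y \<partial>M)" by (rule LIMSEQ_unique[OF lim2 lim1])
qed

text \<open>Both sums, integrated against any test function, give the value of \<open>F\<close>.  As the test functions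
  include multiples of all indicators of measurable subsets of balls, the sums agree almost
  everywhere.\<close>

lemma decomposition_sum_unique:
  fixes F :: "('a \<Rightarrow> 'b::{real_normed_field, banach, second_countable_topology}) \<Rightarrow> 'b"
  assumes dec: "block_decomposition M \<rho> \<phi> \<Psi> F l b" and dec': "block_decomposition M \<rho> \<phi> \<Psi> F l' b'"
  shows "AE y in M. (\<Sum>j. l j *\<^sub>R b j y) = (\<Sum>j. l' j *\<^sub>R b' j y)"
proof -
  note [measurable] = block_decomposition_data(1)[OF dec] block_decomposition_data(1)[OF dec']
  define v where "v y = (\<Sum>j. l j *\<^sub>R b j y)" for y
  define v' where "v' y = (\<Sum>j. l' j *\<^sub>R b' j y)" for y
  have [measurable]: "v \<in> borel_measurable M" "v' \<in> borel_measurable M"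
    unfolding v_def v'_def by measurable
  interpret sf: sigma_finite_measure M by (rule sigma_finite)
  obtain x0 where x0: "x0 \<in> space M" using space_ne by blast
  have loc: "AE y in M. indicator (B x0 R) y *\<^sub>R (v y - v' y) = 0" if R: "0 < R" for R
  proof -
    have [measurable]: "B x0 R \<in> sets M" using x0 R by (rule ball_sets)
    obtain c where c: "0 < c" and test: "\<And>E (g :: 'a \<Rightarrow> 'b). E \<in> sets M \<Longrightarrow> E \<subseteq> B x0 R \<Longrightarrow>
        g \<in> borel_measurable M \<Longrightarrow> (\<And>y. norm (g y) = c * indicator E y) \<Longrightarrow>
        g \<in> morrey_space M \<rho> \<phi> (complementary \<Psi>) \<and> morrey_norm M \<rho> \<phi> (complementary \<Psi>) g \<le> 1"
      using test_functions[OF x0 R, where 'b = 'b] by blast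
    have E: "integrable M (\<lambda>y. indicator E y *\<^sub>R (v y - v' y)) \<and>
        (\<integral>y. indicator E y *\<^sub>R (v y - v' y) \<partial>M) = 0" if [measurable]: "E \<in> sets M" and EB: "E \<subseteq> B x0 R" for E
    proof -
      define g :: "'a \<Rightarrow> 'b" where "g y = of_real (c * indicator E y)" for y
      have [measurable]: "g \<in> borel_measurable M" unfolding g_def by measurable
      have g: "g \<in> morrey_space M \<rho> \<phi> (complementary \<Psi>)" "morrey_norm M \<rho> \<phi> (complementary \<Psi>) g \<le> 1"
      proof -
        have "norm (g y) = c * indicator E y" for y using c by (cases "y \<in> E") (auto simp: g_def)
        then show "g \<in> morrey_space M \<rho> \<phi> (complementary \<Psi>)" "morrey_norm M \<rho> \<phi> (complementary \<Psi>) g \<le> 1"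
          using test[of E g] EB by auto
      qed
      note P = decomposition_pairing[OF dec g, folded v_def] decomposition_pairing[OF dec' g, folded v'_def]
      have i: "integrable M (\<lambda>y. v y * g y - v' y * g y)"
        by (intro Bochner_Integration.integrable_diff P)
      have "(\<integral>y. v y * g y - v' y * g y \<partial>M) = 0"
        using P by (simp add: Bochner_Integration.integral_diff)
      moreover have eq: "(1 / c) *\<^sub>R (v y * g y - v' y * g y) = indicator E y *\<^sub>R (v y - v' y)" for y
        using c by (cases "y \<in> E") (auto simp: g_def scaleR_conv_of_real algebra_simps)
      have "integrable M (\<lambda>y. (1 / c) *\<^sub>R (v y * g y - v' y * g y))"
        by (intro integrable_scaleR_right i)
      moreover have "(\<integral>y. (1 / c) *\<^sub>R (v y * g y - v' y * g y) \<partial>M) = (1 / c) *\<^sub>R (\<integral>y. v y * g y - v' y * g y \<partial>M)"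
        by (rule integral_scaleR_right)
      ultimately show ?thesis unfolding eq by simp
    qed
    show ?thesis
    proof (rule sf.density_zero)
      show "integrable M (\<lambda>y. indicator (B x0 R) y *\<^sub>R (v y - v' y))" using E[of "B x0 R"] by simp
      fix A assume A: "A \<in> sets M"
      have "set_lebesgue_integral M A (\<lambda>y. indicator (B x0 R) y *\<^sub>R (v y - v' y))
         = (\<integral>y. indicator (A \<inter> B x0 R) y *\<^sub>R (v y - v' y) \<partial>M)"
        unfolding set_lebesgue_integral_def by (intro Bochner_Integration.integral_cong) (auto split: split_indicator)
      also have "\<dots> = 0" using E[of "A \<inter> B x0 R"] A by auto
      finally show "set_lebesgue_integral M A (\<lambda>y. indicator (B x0 R) y *\<^sub>R (v y - v' y)) = 0" .
    qed
  qed
  have "AE y in M. \<forall>n. indicator (B x0 (real (Suc n))) y *\<^sub>R (v y - v' y) = 0"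
    unfolding AE_all_countable by (intro allI loc) simp
  then have "AE y in M. v y = v' y"
    using AE_space
  proof eventually_elim
    case (elim y)
    obtain n where "y \<in> B x0 (real (Suc n))" using space_exhaust[OF x0] elim(2) by blast
    then have "indicator (B x0 (real (Suc n))) y = (1::real)" by simp
    then show ?case using elim(1)[rule_format, of n] by simp
  qed
  then show ?thesis by (simp add: v_def v'_def)
qed

section \<open>Boundedness of the maximal operator\<close>

text \<open>Sublinearity of the maximal operator combined with the decomposition for single blocks; the double
  series is enumerated by pairs of natural numbers.\<close>

lemma maximal_of_decomposition:
  fixes F :: "('a \<Rightarrow> 'b::{real_normed_field, banach, second_countable_topology}) \<Rightarrow> 'b"
  assumes dec: "block_decomposition M \<rho> \<phi> \<Psi> F l b" and f: "AE y in M. f y = (\<Sum>j. l j *\<^sub>R b j y)"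
  shows "\<exists>x r \<gamma> w. (\<forall>i. modular_block (x i) (r i) (\<gamma> i)) \<and> (\<forall>i. 0 \<le> w i) \<and> summable w \<and>
    (\<Sum>i. w i) = 2 * (\<Sum>j. l j) * (\<Sum>k. maximal_coeff k) \<and>
    (AE y in M. hl_maximal M \<rho> f y \<le> (\<Sum>i. ennreal (w i * \<gamma> i y)))"
proof -
  note [measurable] = block_decomposition_data(1)[OF dec]
  note l = block_decomposition_data(2,3)[OF dec]
  obtain x r where mb: "\<And>j. modular_block (x j) (r j) (\<lambda>y. norm (b j y) / 2)"
    using block_decomposition_data(4)[OF dec] by blast
  define P where "P j s \<gamma> \<longleftrightarrow> (\<forall>k. modular_block (x j) (s k) (\<gamma> k)) \<and>
    (AE y in M. hl_maximal M \<rho> (\<lambda>y. norm (b j y) / 2) y \<le> (\<Sum>k. ennreal (maximal_coeff k * \<gamma> k y)))" for j s \<gamma>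
  have "\<forall>j. \<exists>s \<gamma>. P j s \<gamma>"
    unfolding P_def using maximal_block_decomposition[OF mb] by blast
  then obtain s \<gamma> where P: "\<And>j. P j (s j) (\<gamma> j)" by metis
  have \<gamma>: "modular_block (x j) (s j k) (\<gamma> j k)"
    "AE y in M. hl_maximal M \<rho> (\<lambda>y. norm (b j y) / 2) y \<le> (\<Sum>k. ennreal (maximal_coeff k * \<gamma> j k y))" for j k
    using P[of j] unfolding P_def by auto
  \<comment> \<open>The factor two comes from the blocks \<open>|b\<^sub>j| / 2\<close>.\<close>
  define w where "w i = (case prod_decode i of (j, k) \<Rightarrow> 2 * l j * maximal_coeff k)" for i
  define G where "G i = (case prod_decode i of (j, k) \<Rightarrow> \<gamma> j k)" for i
  have w0: "0 \<le> w i" for i using l(1) maximal_coeff(1) by (auto simp: w_def split: prod.split)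
  have g0: "0 \<le> \<gamma> j k y" for j k y using \<gamma>(1)[of j k] by (simp add: modular_block_def)
  have S: "0 \<le> (\<Sum>j. l j)" "0 \<le> (\<Sum>k. maximal_coeff k)" using l maximal_coeff by (auto intro!: suminf_nonneg)
  have "(\<Sum>i. ennreal (w i)) = (\<Sum>i. (case prod_decode i of (j, k) \<Rightarrow> ennreal (2 * l j * maximal_coeff k)))"
    by (intro suminf_cong) (simp add: w_def split: prod.split)
  also have "\<dots> = (\<Sum>j. \<Sum>k. ennreal (2 * l j * maximal_coeff k))"
    by (rule suminf_ennreal_2dimen) simp
  also have "\<dots> = (\<Sum>j. ennreal (2 * l j) * (\<Sum>k. ennreal (maximal_coeff k)))"
    using l(1) maximal_coeff(1) by (simp add: ennreal_mult)
  also have "\<dots> = (\<Sum>j. ennreal (2 * l j)) * (\<Sum>k. ennreal (maximal_coeff k))" by (rule ennreal_suminf_multc)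
  also have "\<dots> = ennreal (\<Sum>j. 2 * l j) * ennreal (\<Sum>k. maximal_coeff k)"
    using l maximal_coeff by (simp add: suminf_ennreal2 summable_mult)
  also have "\<dots> = ennreal (2 * (\<Sum>j. l j) * (\<Sum>k. maximal_coeff k))"
    using l S by (simp add: suminf_mult ennreal_mult)
  finally have sw: "(\<Sum>i. ennreal (w i)) = ennreal (2 * (\<Sum>j. l j) * (\<Sum>k. maximal_coeff k))" .
  then have summ: "summable w" using w0 by (intro summable_suminf_not_top) auto
  then have "ennreal (\<Sum>i. w i) = ennreal (2 * (\<Sum>j. l j) * (\<Sum>k. maximal_coeff k))"
    using sw w0 by (simp add: suminf_ennreal2)
  then have sum: "(\<Sum>i. w i) = 2 * (\<Sum>j. l j) * (\<Sum>k. maximal_coeff k)"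
    using S w0 summ by (subst (asm) ennreal_inj) (auto intro: suminf_nonneg)
  have fle: "AE y in M. ennreal (norm (f y)) \<le> (\<Sum>j. ennreal (2 * l j) * ennreal (norm (b j y) / 2))"
    using f block_decomposition_data(6)[OF dec] by eventually_elim simp
  have "AE y in M. \<forall>j. hl_maximal M \<rho> (\<lambda>y. norm (b j y) / 2) y \<le> (\<Sum>k. ennreal (maximal_coeff k * \<gamma> j k y))"
    unfolding AE_all_countable using \<gamma>(2) by blast
  then have "AE y in M. hl_maximal M \<rho> f y \<le> (\<Sum>i. ennreal (w i * G i y))"
  proof eventually_elim
    case (elim y)
    have "hl_maximal M \<rho> f y \<le> (\<Sum>j. ennreal (2 * l j) * hl_maximal M \<rho> (\<lambda>y. norm (b j y) / 2) y)"
      by (rule hl_maximal_suminf_le[OF fle]) auto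
    also have "\<dots> \<le> (\<Sum>j. ennreal (2 * l j) * (\<Sum>k. ennreal (maximal_coeff k * \<gamma> j k y)))"
      using elim by (intro suminf_le mult_left_mono) auto
    also have "\<dots> = (\<Sum>j. \<Sum>k. ennreal (2 * l j * maximal_coeff k * \<gamma> j k y))"
      using l(1) maximal_coeff(1) g0 by (simp add: ennreal_mult mult.assoc flip: ennreal_suminf_cmult)
    also have "\<dots> = (\<Sum>i. (case prod_decode i of (j, k) \<Rightarrow> ennreal (2 * l j * maximal_coeff k * \<gamma> j k y)))"
      by (rule suminf_ennreal_2dimen[symmetric]) simp
    also have "\<dots> = (\<Sum>i. ennreal (w i * G i y))"
      by (intro suminf_cong) (simp add: w_def G_def split: prod.split)
    finally show ?case .
  qed
  moreover have "modular_block (x (fst (prod_decode i))) (case prod_decode i of (j, k) \<Rightarrow> s j k) (G i)" for i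
    using \<gamma>(1) by (auto simp: G_def split: prod.split)
  ultimately show ?thesis using w0 summ sum
    by (intro exI[of _ "\<lambda>i. x (fst (prod_decode i))"] exI[of _ "\<lambda>i. case prod_decode i of (j, k) \<Rightarrow> s j k"]
        exI[of _ G] exI[of _ w]) simp
qed

text \<open>The functional \<open>G\<close> is integration against a measurable version of the maximal function, chosen
  before any decomposition of \<open>F\<close>.  Every decomposition of \<open>F\<close> then yields one of this same \<open>G\<close>, which
  permits passing to the infimum.\<close>

lemma maximal_bounded:
  fixes F :: "('a \<Rightarrow> 'b::{real_normed_field, banach, second_countable_topology}) \<Rightarrow> 'b"
  assumes f: "identified_with M \<rho> \<phi> \<Psi> F f"
    and meas: "hl_maximal M \<rho> f \<in> borel_measurable (completion M)"
  shows "AE y in M. hl_maximal M \<rho> f y < \<infinity>"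
    and "\<exists>G\<in>block_space M \<rho> \<phi> \<Psi>.
      identified_with M \<rho> \<phi> \<Psi> G (\<lambda>y. of_real (enn2real (hl_maximal M \<rho> f y)) :: 'b) \<and>
      block_norm M \<rho> \<phi> \<Psi> G \<le> ennreal (2 * (\<Sum>k. maximal_coeff k)) * block_norm M \<rho> \<phi> \<Psi> F"
proof -
  obtain l b where dec: "block_decomposition M \<rho> \<phi> \<Psi> F l b"
    and lb: "AE y in M. (\<lambda>j. l j *\<^sub>R b j y) sums f y"
    using f unfolding identified_with_def by blast
  have fs: "AE y in M. f y = (\<Sum>j. l' j *\<^sub>R b' j y)" if "block_decomposition M \<rho> \<phi> \<Psi> F l' b'" for l' b'
    using lb decomposition_sum_unique[OF dec that] by eventually_elim (simp add: sums_iff)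
  obtain h where [measurable]: "h \<in> borel_measurable M" and h: "AE y in M. hl_maximal M \<rho> f y = h y"
    using completion_ex_borel_measurable[OF meas] by blast
  define v :: "'a \<Rightarrow> 'b" where "v y = of_real (enn2real (h y))" for y
  have [measurable]: "v \<in> borel_measurable M" unfolding v_def by measurable
  \<comment> \<open>Uniqueness of the sum lets any decomposition of \<open>F\<close> serve for the same function \<open>f\<close>.\<close>
  have key: "\<exists>x r \<gamma> w. (\<forall>i. modular_block (x i) (r i) (\<gamma> i)) \<and> (\<forall>i. 0 \<le> w i) \<and> summable w \<and>
      (\<Sum>i. w i) = 2 * (\<Sum>j. l' j) * (\<Sum>k. maximal_coeff k) \<and>
      (AE y in M. hl_maximal M \<rho> f y < \<infinity>) \<and>
      (AE y in M. ennreal (norm (v y)) \<le> (\<Sum>i. ennreal (w i * \<gamma> i y)))"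
    if dec': "block_decomposition M \<rho> \<phi> \<Psi> F l' b'" for l' b'
  proof -
    obtain x r \<gamma> w where \<gamma>: "\<And>i. modular_block (x i) (r i) (\<gamma> i)" "\<And>i. 0 \<le> w i" "summable w"
      "(\<Sum>i. w i) = 2 * (\<Sum>j. l' j) * (\<Sum>k. maximal_coeff k)"
      "AE y in M. hl_maximal M \<rho> f y \<le> (\<Sum>i. ennreal (w i * \<gamma> i y))"
      using maximal_of_decomposition[OF dec' fs[OF dec']] by blast
    have "AE y in M. hl_maximal M \<rho> f y < \<infinity>"
      using \<gamma>(5) block_series_AE_finite[OF \<gamma>(1-3)] by eventually_elim (rule order_le_less_trans)
    moreover from this have "AE y in M. ennreal (norm (v y)) \<le> (\<Sum>i. ennreal (w i * \<gamma> i y))"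
      using \<gamma>(5) h by eventually_elim (simp add: v_def less_top)
    ultimately show ?thesis using \<gamma> by blast
  qed
  show fin: "AE y in M. hl_maximal M \<rho> f y < \<infinity>" using key[OF dec] by blast
  define G where "G = block_functional M v"
  have GF: "G \<in> block_space M \<rho> \<phi> \<Psi>" "\<exists>w b. block_decomposition M \<rho> \<phi> \<Psi> G w b \<and>
           (AE y in M. (\<lambda>i. w i *\<^sub>R b i y) sums v y)"
    and le: "block_norm M \<rho> \<phi> \<Psi> G \<le> ennreal (2 * (\<Sum>k. maximal_coeff k)) * ennreal (\<Sum>j. l' j)"
    if dec': "block_decomposition M \<rho> \<phi> \<Psi> F l' b'" for l' b'
  proof -
    obtain x r \<gamma> w where \<gamma>: "\<And>i. modular_block (x i) (r i) (\<gamma> i)" "\<And>i. 0 \<le> w i" "summable w"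
      "(\<Sum>i. w i) = 2 * (\<Sum>j. l' j) * (\<Sum>k. maximal_coeff k)"
      "AE y in M. ennreal (norm (v y)) \<le> (\<Sum>i. ennreal (w i * \<gamma> i y))"
      using key[OF dec'] by blast
    note m = majorized_in_block_space[OF \<gamma>(1-3) \<open>v \<in> borel_measurable M\<close> \<gamma>(5)]
    show "G \<in> block_space M \<rho> \<phi> \<Psi>" "\<exists>w b. block_decomposition M \<rho> \<phi> \<Psi> G w b \<and>
           (AE y in M. (\<lambda>i. w i *\<^sub>R b i y) sums v y)"
      unfolding G_def using m(1,2) by blast+
    have "0 \<le> (\<Sum>j. l' j)" "0 \<le> (\<Sum>k. maximal_coeff k)"
      using block_decomposition_data(2,3)[OF dec'] maximal_coeff by (auto intro!: suminf_nonneg)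
    then have "ennreal (\<Sum>i. w i) = ennreal (2 * (\<Sum>k. maximal_coeff k)) * ennreal (\<Sum>j. l' j)"
      unfolding \<gamma>(4) by (subst ennreal_mult[symmetric]) (auto simp: mult_ac)
    then show "block_norm M \<rho> \<phi> \<Psi> G \<le> ennreal (2 * (\<Sum>k. maximal_coeff k)) * ennreal (\<Sum>j. l' j)"
      using m(3) unfolding G_def by simp
  qed
  have "identified_with M \<rho> \<phi> \<Psi> G (\<lambda>y. of_real (enn2real (hl_maximal M \<rho> f y)))"
  proof -
    obtain w c where "block_decomposition M \<rho> \<phi> \<Psi> G w c" and c: "AE y in M. (\<lambda>i. w i *\<^sub>R c i y) sums v y"
      using GF(2)[OF dec] by blast
    moreover have "AE y in M. (\<lambda>i. w i *\<^sub>R c i y) sums of_real (enn2real (hl_maximal M \<rho> f y))"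
      using c h by eventually_elim (simp add: v_def)
    ultimately show ?thesis unfolding identified_with_def by blast
  qed
  moreover have "block_norm M \<rho> \<phi> \<Psi> G \<le> ennreal (2 * (\<Sum>k. maximal_coeff k)) * block_norm M \<rho> \<phi> \<Psi> F"
  proof -
    define C where "C = 2 * (\<Sum>k. maximal_coeff k)"
    have "0 < maximal_coeff k" for k using local_far_const_pos decay by (simp add: maximal_coeff_def)
    then have C: "0 < C" using maximal_coeff(2) by (simp add: C_def suminf_pos)
    have "ennreal (1 / C) * block_norm M \<rho> \<phi> \<Psi> G \<le> block_norm M \<rho> \<phi> \<Psi> F"
      unfolding block_norm_def[of M \<rho> \<phi> \<Psi> F]
    proof (rule Inf_greatest, clarify)
      fix l' b' assume "block_decomposition M \<rho> \<phi> \<Psi> F l' b'"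
      then have "ennreal (1 / C) * block_norm M \<rho> \<phi> \<Psi> G \<le> ennreal (1 / C) * (ennreal C * ennreal (\<Sum>j. l' j))"
        using le[of l' b'] by (intro mult_left_mono) (auto simp: C_def)
      also have "\<dots> = ennreal (\<Sum>j. l' j)"
        using C by (simp add: mult.assoc[symmetric] flip: ennreal_mult)
      finally show "ennreal (1 / C) * block_norm M \<rho> \<phi> \<Psi> G \<le> ennreal (\<Sum>j. l' j)" .
    qed
    then have "ennreal C * (ennreal (1 / C) * block_norm M \<rho> \<phi> \<Psi> G) \<le> ennreal C * block_norm M \<rho> \<phi> \<Psi> F"
      by (intro mult_left_mono) auto
    then show ?thesis using C by (simp add: mult.assoc[symmetric] C_def flip: ennreal_mult)
  qed
  ultimately show "\<exists>G\<in>block_space M \<rho> \<phi> \<Psi>.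
      identified_with M \<rho> \<phi> \<Psi> G (\<lambda>y. of_real (enn2real (hl_maximal M \<rho> f y)) :: 'b) \<and>
      block_norm M \<rho> \<phi> \<Psi> G \<le> ennreal (2 * (\<Sum>k. maximal_coeff k)) * block_norm M \<rho> \<phi> \<Psi> F"
    using GF(1)[OF dec] by blast
qed

end

theorem theorem4p43:
  fixes M :: "'a measure"
    and \<rho> :: "'a \<Rightarrow> 'a \<Rightarrow> real"
    and \<phi> :: "'a \<Rightarrow> real \<Rightarrow> real"
    and \<Psi> :: "real \<Rightarrow> real"
    and p q :: real
  assumes "homogeneous_space M \<rho>"
    and "weak_reverse_doubling M \<rho>"
    and "\<phi> \<in> G1_dec M \<rho>"
    and "nearness M \<rho> \<phi>"
    and "orlicz_function \<Psi>"
    and "strict_mono_on {0..} \<Psi>"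
    and "convex_on {0..} \<Psi>"
    and "lower_type \<Psi> p"
    and "upper_type \<Psi> q"
    and "1 < p"
    and "p \<le> q"
    and "\<exists>C>0. \<forall>x\<in>space M. \<forall>r>0.
           (\<integral>\<^sup>+t\<in>{r<..}. ennreal (\<phi> x t / t) \<partial>lborel) \<le> ennreal (C * \<phi> x r)"
  shows "\<exists>C>0. \<forall>F \<in> (block_space M \<rho> \<phi> \<Psi> ::
             (('a \<Rightarrow> 'b::{real_normed_field, banach, second_countable_topology}) \<Rightarrow> 'b) set).
           (\<exists>f. identified_with M \<rho> \<phi> \<Psi> F f) \<and>
           (\<forall>f. identified_with M \<rho> \<phi> \<Psi> F f \<longrightarrow>
             hl_maximal M \<rho> f \<in> borel_measurable (completion M) \<longrightarrow>
             (AE x in M. hl_maximal M \<rho> f x < \<infinity>) \<and>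
             (\<exists>G \<in> block_space M \<rho> \<phi> \<Psi>.
                identified_with M \<rho> \<phi> \<Psi> G (\<lambda>x. of_real (enn2real (hl_maximal M \<rho> f x)) :: 'b) \<and>
                block_norm M \<rho> \<phi> \<Psi> G \<le> ennreal C * block_norm M \<rho> \<phi> \<Psi> F))"
proof -
  have qm: "quasi_metric_on (space M) \<rho>" using assms(1) by (simp add: homogeneous_space_def)
  obtain K where K: "1 \<le> K" "\<And>x y z. x \<in> space M \<Longrightarrow> y \<in> space M \<Longrightarrow> z \<in> space M \<Longrightarrow> \<rho> x z \<le> K * (\<rho> x y + \<rho> y z)"
  proof -
    have "\<exists>K\<ge>1. \<forall>x\<in>space M. \<forall>y\<in>space M. \<forall>z\<in>space M. \<rho> x z \<le> K * (\<rho> x y + \<rho> y z)"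
      using qm unfolding quasi_metric_on_def by (elim conjE)
    then show ?thesis using that by metis
  qed
  obtain L where L: "1 \<le> L" and bs: "\<And>x r. x \<in> space M \<Longrightarrow> 0 < r \<Longrightarrow> qball M \<rho> x r \<in> sets M"
    and dilation_const: "\<And>x r. x \<in> space M \<Longrightarrow> 0 < r \<Longrightarrow> 0 < emeasure M (qball M \<rho> x (2 * r)) \<and>
       emeasure M (qball M \<rho> x (2 * r)) \<le> ennreal L * emeasure M (qball M \<rho> x r) \<and>
       ennreal L * emeasure M (qball M \<rho> x r) < \<infinity>"
    using assms(1) unfolding homogeneous_space_def by metis
  have fin: "emeasure M (qball M \<rho> x r) < \<infinity>" if "x \<in> space M" "0 < r" for x r
    using dilation_const[OF that] L by (auto simp: ennreal_mult_less_top)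
  have ds: "doubling_space M \<rho> K L"
  proof
    show "space M \<noteq> {}" using qm by (simp add: quasi_metric_on_def)
    show "0 \<le> \<rho> x y" if "x \<in> space M" "y \<in> space M" for x y
      using qm that by (simp add: quasi_metric_on_def)
    show "\<rho> x x = 0" if "x \<in> space M" for x using qm that by (simp add: quasi_metric_on_def)
    show "\<rho> x y = \<rho> y x" if "x \<in> space M" "y \<in> space M" for x y
      using qm that unfolding quasi_metric_on_def by blast
    show "0 < emeasure M (qball M \<rho> x r)" if "x \<in> space M" "0 < r" for x r
      using dilation_const[of x "r / 2"] that by simp
    show "measure M (qball M \<rho> x (2 * r)) \<le> L * measure M (qball M \<rho> x r)"
      if x: "x \<in> space M" "0 < r" for x r
    proof -
      have "ennreal (measure M (qball M \<rho> x (2 * r))) \<le> ennreal L * ennreal (measure M (qball M \<rho> x r))"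
        using dilation_const[OF x] fin[OF x] fin[of x "2 * r"] x by (simp add: emeasure_eq_ennreal_measure less_top)
      then show ?thesis using L by (simp flip: ennreal_mult)
    qed
  qed (fact K L bs fin)+
  obtain Cp where Cp: "1 \<le> Cp" "\<And>s t. 0 < t \<Longrightarrow> 0 < s \<Longrightarrow> s < 1 \<Longrightarrow> \<Psi> (s * t) \<le> Cp * s powr p * \<Psi> t"
    using assms(8) unfolding lower_type_def by blast
  have co: "convex_orlicz \<Psi> p Cp"
  proof
    show "\<Psi> s \<le> \<Psi> t" if "0 \<le> s" "s \<le> t" for s t
      using assms(5) that by (auto simp: orlicz_function_def mono_on_def)
    show "\<Psi> 0 = 0" "\<And>t. 0 < t \<Longrightarrow> 0 < \<Psi> t" using assms(5) by (auto simp: orlicz_function_def)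
  qed (fact assms Cp)+
  have pos: "0 < \<phi> x r" if "x \<in> space M" "0 < r" for x r
    using assms(3) that by (simp add: G1_dec_def)
  obtain c1 where c1: "0 < c1" "\<And>x r s. x \<in> space M \<Longrightarrow> 0 < r \<Longrightarrow> r < s \<Longrightarrow>
      measure M (qball M \<rho> x r) * \<phi> x r \<le> c1 * (measure M (qball M \<rho> x s) * \<phi> x s) \<and> \<phi> x s \<le> c1 * \<phi> x r"
    using assms(3) unfolding G1_dec_def by blast
  obtain c2 where c2: "0 < c2" "\<And>x y r. x \<in> space M \<Longrightarrow> y \<in> space M \<Longrightarrow> 0 < r \<Longrightarrow> \<rho> x y \<le> r \<Longrightarrow>
      \<phi> x r / \<phi> y r \<le> c2"
    using assms(4) unfolding nearness_def by blast
  obtain C3 where C3: "0 < C3" "\<And>x r. x \<in> space M \<Longrightarrow> 0 < r \<Longrightarrow>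
      (\<integral>\<^sup>+t\<in>{r<..}. ennreal (\<phi> x t / t) \<partial>lborel) \<le> ennreal (C3 * \<phi> x r)"
    using assms(12) by blast
  \<comment> \<open>Constants at least one extend the monotonicity conditions to equal radii.\<close>
  define C1 where "C1 = max 1 c1"
  define C2 where "C2 = max 1 c2"
  interpret block_setting M \<rho> K L \<Psi> p Cp \<phi> C1 C2 C3
  proof (intro block_setting.intro orlicz_doubling_space.intro ds co block_setting_axioms.intro)
    fix x r s assume x: "x \<in> space M" "0 < r" "r \<le> (s::real)"
    show "\<phi> x s \<le> C1 * \<phi> x r"
    proof (cases "r = s")
      case True
      then show ?thesis using mult_right_mono[of 1 C1 "\<phi> x s"] pos[of x s] x by (simp add: C1_def)
    next
      case False
      then have "\<phi> x s \<le> c1 * \<phi> x r" using c1(2)[of x r s] x by simp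
      also have "\<dots> \<le> C1 * \<phi> x r" using pos[OF x(1,2)] by (intro mult_right_mono) (auto simp: C1_def)
      finally show ?thesis .
    qed
    show "measure M (qball M \<rho> x r) * \<phi> x r \<le> C1 * (measure M (qball M \<rho> x s) * \<phi> x s)"
    proof (cases "r = s")
      case True
      then show ?thesis using mult_right_mono[of 1 C1 "measure M (qball M \<rho> x s) * \<phi> x s"] pos[of x s] x
        by (simp add: C1_def)
    next
      case False
      then have "measure M (qball M \<rho> x r) * \<phi> x r \<le> c1 * (measure M (qball M \<rho> x s) * \<phi> x s)"
        using c1(2)[of x r s] x by simp
      also have "\<dots> \<le> C1 * (measure M (qball M \<rho> x s) * \<phi> x s)"
        using pos[of x s] x by (intro mult_right_mono) (auto simp: C1_def)
      finally show ?thesis .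
    qed
  next
    fix x y r assume x: "x \<in> space M" "y \<in> space M" "0 < r" "\<rho> x y \<le> r"
    have "\<phi> x r \<le> c2 * \<phi> y r" using c2(2)[OF x] pos[OF x(2,3)] by (simp add: divide_le_eq)
    also have "\<dots> \<le> C2 * \<phi> y r" using pos[OF x(2,3)] by (intro mult_right_mono) (auto simp: C2_def)
    finally show "\<phi> x r \<le> C2 * \<phi> y r" .
  qed (use pos C3 in \<open>auto simp: C1_def C2_def\<close>)
  have "0 < maximal_coeff k" for k using local_far_const_pos decay by (simp add: maximal_coeff_def)
  then have C: "0 < 2 * (\<Sum>k. maximal_coeff k)" using maximal_coeff(2) by (simp add: suminf_pos)
  have ex: "\<exists>f. identified_with M \<rho> \<phi> \<Psi> F f" if F: "F \<in> block_space M \<rho> \<phi> \<Psi>"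
    for F :: "('a \<Rightarrow> 'b) \<Rightarrow> 'b"
  proof -
    obtain l b where dec: "block_decomposition M \<rho> \<phi> \<Psi> F l b"
      using F unfolding block_space_def by blast
    show ?thesis unfolding identified_with_def
      by (intro exI[of _ "\<lambda>y. \<Sum>j. l j *\<^sub>R b j y"] exI[of _ l] exI[of _ b] conjI dec
          block_decomposition_data(5)[OF dec])
  qed
  show ?thesis
  proof (intro exI[of _ "2 * (\<Sum>k. maximal_coeff k)"] conjI ballI allI impI C)
    fix F :: "('a \<Rightarrow> 'b) \<Rightarrow> 'b" and f
    assume "F \<in> block_space M \<rho> \<phi> \<Psi>"
    then show "\<exists>f. identified_with M \<rho> \<phi> \<Psi> F f" by (rule ex)
  next
    fix F :: "('a \<Rightarrow> 'b) \<Rightarrow> 'b" and f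
    assume "identified_with M \<rho> \<phi> \<Psi> F f" "hl_maximal M \<rho> f \<in> borel_measurable (completion M)"
    note bounded = maximal_bounded[OF this]
    show "AE x in M. hl_maximal M \<rho> f x < \<infinity>" by (rule bounded(1))
    show "\<exists>G\<in>block_space M \<rho> \<phi> \<Psi>.
      identified_with M \<rho> \<phi> \<Psi> G (\<lambda>x. of_real (enn2real (hl_maximal M \<rho> f x)) :: 'b) \<and>
      block_norm M \<rho> \<phi> \<Psi> G \<le> ennreal (2 * (\<Sum>k. maximal_coeff k)) * block_norm M \<rho> \<phi> \<Psi> F"
      by (rule bounded(2))
  qed
qed

end
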